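(* For every integer $k\ge 2$, it is NP-hard to decide whether a digraph $D=(V,E)$ is $k$-colorable, even if $D$ has a feedback vertex set of size $k$, a feedback arc set of size $k^2$, and maximum degree $\Delta=4k-1$.
   Context: Digraphs are loopless and have no parallel arcs, but digons are allowed. The degree of a vertex is its in-degree plus its out-degree. A digraph is $k$-colorable if its vertices can be colored with $k$ colors so that each color class induces an acyclic subdigraph. A feedback vertex set is a vertex set whose removal makes $D$ acyclic; a feedback arc set is an arc set whose removal makes $D$ acyclic. *)

theory Defs
  imports "Graph_Theory.Graph_Theory" "HOL-Computational_Algebra.Polynomial"
begin

text \<open>
  Tapes are infinite in both directions. A tape consists of its head position and its cell
  contents. Machines have finitely many transitions, so only finitely many states and symbols
  of the (infinite) types below are relevant to any given machine.
\<close>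

datatype symbol = Blank | Bit bool | Work nat

datatype direction = MoveLeft | Stay | MoveRight

type_synonym tape = "int \<times> (int \<Rightarrow> symbol)"

text \<open>(state, symbols read, new state, symbols written, head moves), one list entry per tape\<close>
type_synonym transition = "nat \<times> symbol list \<times> nat \<times> symbol list \<times> direction list"

type_synonym config = "nat \<times> tape list"

record tm =
  tm_tapes :: nat
  tm_start :: nat
  tm_accept :: nat
  tm_delta :: "transition set"

text \<open>The accepting state is halting; a configuration without successor in any other state rejects.\<close>
definition wf_tm :: "tm \<Rightarrow> bool" where
  "wf_tm M \<longleftrightarrow> tm_tapes M \<ge> 1 \<and> finite (tm_delta M) \<and>
     (\<forall>(q, rs, q', ws, ds) \<in> tm_delta M.
        q \<noteq> tm_accept M \<and>
        length rs = tm_tapes M \<and> length ws = tm_tapes M \<and> length ds = tm_tapes M)"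

definition deterministic :: "tm \<Rightarrow> bool" where
  "deterministic M \<longleftrightarrow>
     (\<forall>q rs a b. (q, rs, a) \<in> tm_delta M \<longrightarrow> (q, rs, b) \<in> tm_delta M \<longrightarrow> a = b)"

fun tape_read :: "tape \<Rightarrow> symbol" where
  "tape_read (h, t) = t h"

fun offset :: "direction \<Rightarrow> int" where
  "offset MoveLeft = -1"
| "offset Stay = 0"
| "offset MoveRight = 1"

fun tape_update :: "symbol \<times> direction \<Rightarrow> tape \<Rightarrow> tape" where
  "tape_update (w, d) (h, t) = (h + offset d, t(h := w))"

definition step :: "tm \<Rightarrow> (config \<times> config) set" where
  "step M = {((q, ts), (q', map2 tape_update (zip ws ds) ts)) | q ts q' ws ds.
               (q, map tape_read ts, q', ws, ds) \<in> tm_delta M}"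

definition word_tape :: "bool list \<Rightarrow> tape" where
  "word_tape x = (0, \<lambda>j. if 0 \<le> j \<and> j < int (length x) then Bit (x ! nat j) else Blank)"

text \<open>The input is on the first tape; all other tapes are blank.\<close>
definition initial :: "tm \<Rightarrow> bool list \<Rightarrow> config" where
  "initial M x = (tm_start M, word_tape x # replicate (tm_tapes M - 1) (word_tape []))"

text \<open>
  The output is the maximal word of bits starting in cell 0, delimited by a blank; the head
  position and all remaining cells are irrelevant.
\<close>
definition tape_holds :: "tape \<Rightarrow> bool list \<Rightarrow> bool" where
  "tape_holds t y \<longleftrightarrow> (\<forall>j < length y. snd t (int j) = Bit (y ! j)) \<and> snd t (int (length y)) = Blank"

text \<open>The output is taken from the last tape.\<close>
definition polytime_computable :: "(bool list \<Rightarrow> bool list) \<Rightarrow> bool" where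
  "polytime_computable f \<longleftrightarrow>
     (\<exists>M (p :: nat poly). wf_tm M \<and> deterministic M \<and>
        (\<forall>x. \<exists>n ts. n \<le> poly p (length x) \<and> (initial M x, (tm_accept M, ts)) \<in> step M ^^ n \<and>
                    tape_holds (last ts) (f x)))"

text \<open>Every run of the nondeterministic machine has to stop within the time bound.\<close>
definition NP :: "bool list set set" where
  "NP = {L. \<exists>M (p :: nat poly). wf_tm M \<and>
              (\<forall>x n c. (initial M x, c) \<in> step M ^^ n \<longrightarrow> n \<le> poly p (length x)) \<and>
              (\<forall>x. x \<in> L \<longleftrightarrow> (\<exists>ts. (initial M x, (tm_accept M, ts)) \<in> (step M)\<^sup>*))}"

text \<open>
  A decision problem whose instances are restricted to a class is given by its yes-instances and
  its no-instances in that class. It is NP-hard if every problem in NP has a polynomial-time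
  many-one reduction to it; all words produced by the reduction must be instances in the class.
\<close>
definition NP_hard :: "bool list set \<Rightarrow> bool list set \<Rightarrow> bool" where
  "NP_hard yes no \<longleftrightarrow>
     (\<forall>L \<in> NP. \<exists>f. polytime_computable f \<and>
        (\<forall>x. (x \<in> L \<longrightarrow> f x \<in> yes) \<and> (x \<notin> L \<longrightarrow> f x \<in> no)))"

text \<open>The library notion of cycle includes digons, i.e. cycles of length two.\<close>
definition acyclic_digraph :: "('a, 'b) pre_digraph \<Rightarrow> bool" where
  "acyclic_digraph G \<longleftrightarrow> \<not> (\<exists>p. pre_digraph.cycle G p)"

definition k_colorable :: "nat \<Rightarrow> ('a, 'b) pre_digraph \<Rightarrow> bool" where
  "k_colorable k G \<longleftrightarrow>
     (\<exists>c :: 'a \<Rightarrow> nat. (\<forall>v \<in> verts G. c v < k) \<and>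
        (\<forall>i < k. acyclic_digraph (G \<restriction> {v \<in> verts G. c v = i})))"

definition feedback_vertex_set :: "('a, 'b) pre_digraph \<Rightarrow> 'a set \<Rightarrow> bool" where
  "feedback_vertex_set G F \<longleftrightarrow> F \<subseteq> verts G \<and> acyclic_digraph (G \<restriction> (verts G - F))"

definition feedback_arc_set :: "('a, 'b) pre_digraph \<Rightarrow> 'b set \<Rightarrow> bool" where
  "feedback_arc_set G F \<longleftrightarrow> F \<subseteq> arcs G \<and> acyclic_digraph (G\<lparr>arcs := arcs G - F\<rparr>)"

text \<open>Only meaningful for a finite nonempty vertex set.\<close>
definition max_degree :: "('a, 'b) pre_digraph \<Rightarrow> nat" where
  "max_degree G = Max ((\<lambda>v. in_degree G v + out_degree G v) ` verts G)"

text \<open>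
  As inputs to machines, digraphs have vertices \<open>0, \<dots>, n - 1\<close> and are given by their adjacency
  matrix, row by row.
\<close>
definition standard_digraph :: "nat pair_pre_digraph \<Rightarrow> bool" where
  "standard_digraph D \<longleftrightarrow> pair_digraph D \<and> pverts D = {0..<card (pverts D)}"

definition encode :: "nat pair_pre_digraph \<Rightarrow> bool list" where
  "encode D = (let n = card (pverts D) in
     concat (map (\<lambda>u. map (\<lambda>v. (u, v) \<in> parcs D) [0..<n]) [0..<n]))"

end

theory Submission
  imports Defs
begin

text \<open>
  A run of a nondeterministic machine is a choice of one option per tableau cell (symbol, head bit,
  current transition) without pairwise conflicts. Such a choice is encoded as a \<open>0\<close>/\<open>1\<close>-colouring of
  a DAG without monochromatic paths from source vertices to sink vertices. This in turn becomes a
  \<open>k\<close>-colouring of a digraph: \<open>k\<close> mutually adjacent roots receive distinct colours, chains of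
  vertices copy the root colours forwards (reachable from the root of their colour by a
  monochromatic path) and backwards (reaching it), and a vertex between a forward and a backward
  copy of one colour cannot have this colour, since it would close a monochromatic cycle. All
  cycles pass through the roots. The adjacency matrix is an arithmetic function of its index and
  the input, hence computable by counters of polynomial size.
\<close>

section \<open>Counter programs on Turing machines\<close>

text \<open>Hardness is shown for every language of \<open>NP\<close> from the machine model itself.
  Each tableau option carries the whole current transition; this turns the local condition of a
  computation step into a relation between pairs of options, and no larger constraints arise. On the
  graph side the degree bound is the obstacle: colours are passed on only along monochromatic paths,
  and a root has few arcs to spare, so every DAG vertex gets its own forward and backward copy of
  each colour. A copy spends at most 4k-2 arcs on having its colour forced and has one left. A DAG
  vertex spends 2(k-2) arcs on excluding the colours from 2 on; for k = 2 exactly 7 of its 4k-1 arcs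
  remain, which is the degree allowed inside the DAG. The feedback arcs are the k(k-1)/2 arcs
  between roots against one linear order and the k(k+1)/2 arcs from the first backward copies to the
  roots, together k^2. Counters are unary, so each matrix entry has to be a fixed arithmetic
  expression whose intermediate values are polynomial in the input length.\<close>

text \<open>
  Tape \<open>0\<close> holds the input, tapes \<open>1, \<dots>, R\<close> are counters, tape \<open>R + 1\<close> takes the output. The value of
  a counter is the head position on its tape; cell \<open>0\<close> is marked by \<open>Work 0\<close> (written by \<open>Init\<close>), so
  that zero can be recognised. The states of the machine are the continuations of the program.
\<close>

datatype test = Pos nat | Inp "bool option" | Nonblank

datatype com = Init | Skip | Inc nat | Dec nat | InpL | InpR | Out bool
  | Seq com com | If test com com | While test com

text \<open>States of a \<open>tm\<close> are natural numbers; countability lets lists of commands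
  serve as states via \<open>to_nat\<close>.\<close>

instance test :: countable by countable_datatype
instance com :: countable by countable_datatype

fun sym_of :: "bool option \<Rightarrow> symbol" where
  "sym_of None = Blank"
| "sym_of (Some b) = Bit b"

fun holds :: "test \<Rightarrow> symbol list \<Rightarrow> bool" where
  "holds (Pos r) rs \<longleftrightarrow> rs ! Suc r \<noteq> Work 0"
| "holds (Inp b) rs \<longleftrightarrow> rs ! 0 = sym_of b"
| "holds Nonblank rs \<longleftrightarrow> rs ! 0 \<noteq> Blank"

definition stay :: "nat \<Rightarrow> direction list" where
  "stay R = replicate (R + 2) Stay"

lemma length_stay [simp]: "length (stay R) = R + 2"
  by (simp add: stay_def)

lemma nth_stay [simp]: "i < R + 2 \<Longrightarrow> stay R ! i = Stay"
  by (simp add: stay_def del: replicate_Suc)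

fun nxt :: "nat \<Rightarrow> com list \<Rightarrow> symbol list \<Rightarrow> com list \<times> symbol list \<times> direction list" where
  "nxt R [] rs = ([], rs, stay R)"
| "nxt R (Init # K) rs =
     (K, map (\<lambda>i. if i = 0 \<or> i = Suc R then rs ! i else Work 0) [0..<R + 2], stay R)"
| "nxt R (Skip # K) rs = (K, rs, stay R)"
| "nxt R (Inc r # K) rs = (K, rs, (stay R)[Suc r := MoveRight])"
| "nxt R (Dec r # K) rs =
     (K, rs, (stay R)[Suc r := if rs ! Suc r = Work 0 then Stay else MoveLeft])"
| "nxt R (InpL # K) rs = (K, rs, (stay R)[0 := MoveLeft])"
| "nxt R (InpR # K) rs = (K, rs, (stay R)[0 := MoveRight])"
| "nxt R (Out b # K) rs = (K, rs[Suc R := Bit b], (stay R)[Suc R := MoveRight])"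
| "nxt R (Seq a b # K) rs = (a # b # K, rs, stay R)"
| "nxt R (If t a b # K) rs = ((if holds t rs then a else b) # K, rs, stay R)"
| "nxt R (While t a # K) rs =
     ((if holds t rs then a # While t a # K else K), rs, stay R)"

text \<open>The continuations met while the command runs in front of \<open>K\<close>. The set is
  syntactic, hence finite although loops unfold repeatedly; \<open>K\<close> itself is left out, so
  the accepting state, coded by \<open>[]\<close>, gets no outgoing transition.\<close>

fun conts :: "com \<Rightarrow> com list \<Rightarrow> com list set" where
  "conts (Seq a b) K = insert (Seq a b # K) (conts a (b # K) \<union> conts b K)"
| "conts (If t a b) K = insert (If t a b # K) (conts a K \<union> conts b K)"
| "conts (While t a) K = insert (While t a # K) (conts a (While t a # K))"
| "conts c K = {c # K}"

lemma finite_conts: "finite (conts c K)"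
  by (induction c K rule: conts.induct) auto

lemma conts_nonempty: "K' \<in> conts c K \<Longrightarrow> K' \<noteq> []"
  by (induction c K rule: conts.induct) auto

definition alphabet :: "symbol set" where
  "alphabet = {Blank, Bit True, Bit False, Work 0}"

definition machine :: "nat \<Rightarrow> com \<Rightarrow> tm" where
  "machine R c = \<lparr>tm_tapes = R + 2, tm_start = to_nat [c], tm_accept = to_nat ([] :: com list),
     tm_delta = {(to_nat K, rs, to_nat K', ws, ds) | K rs K' ws ds. K \<in> conts c [] \<and>
       set rs \<subseteq> alphabet \<and> length rs = R + 2 \<and> nxt R K rs = (K', ws, ds)}\<rparr>"

lemma in_delta_machine:
  "(q, rs, q', ws, ds) \<in> tm_delta (machine R c) \<longleftrightarrow>
     (\<exists>K \<in> conts c []. \<exists>K'. nxt R K rs = (K', ws, ds) \<and> q = to_nat K \<and> q' = to_nat K' \<and>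
        set rs \<subseteq> alphabet \<and> length rs = R + 2)"
  unfolding machine_def by auto

lemma nxt_length:
  "length rs = R + 2 \<Longrightarrow> nxt R K rs = (K', ws, ds) \<Longrightarrow> length ws = R + 2 \<and> length ds = R + 2"
  by (induction R K rs rule: nxt.induct) (auto simp del: upt.simps)

lemma wf_machine: "wf_tm (machine R c)"
proof -
  let ?g = "\<lambda>(K, rs). case nxt R K rs of (K', ws, ds) \<Rightarrow> (to_nat K, rs, to_nat K', ws, ds)"
  have "finite (conts c [] \<times> {rs. set rs \<subseteq> alphabet \<and> length rs = R + 2})"
    by (intro finite_cartesian_product finite_conts finite_lists_length_eq) (simp add: alphabet_def)
  then have "finite (?g ` (conts c [] \<times> {rs. set rs \<subseteq> alphabet \<and> length rs = R + 2}))"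
    by simp
  moreover have "tm_delta (machine R c) \<subseteq> ?g ` (conts c [] \<times> {rs. set rs \<subseteq> alphabet \<and> length rs = R + 2})"
  proof
    fix tr assume "tr \<in> tm_delta (machine R c)"
    then obtain K rs K' ws ds where K: "tr = (to_nat K, rs, to_nat K', ws, ds)" "K \<in> conts c []"
      "set rs \<subseteq> alphabet" "length rs = R + 2" "nxt R K rs = (K', ws, ds)"
      unfolding machine_def by auto
    then show "tr \<in> ?g ` (conts c [] \<times> {rs. set rs \<subseteq> alphabet \<and> length rs = R + 2})"
      by (intro image_eqI[of _ _ "(K, rs)"]) auto
  qed
  ultimately have "finite (tm_delta (machine R c))"
    by (rule finite_subset[rotated])
  moreover have "q \<noteq> to_nat ([] :: com list) \<and> length rs = R + 2 \<and> length ws = R + 2 \<and> length ds = R + 2"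
    if tr: "(q, rs, q', ws, ds) \<in> tm_delta (machine R c)" for q rs q' ws ds
  proof -
    obtain K K' where K: "K \<in> conts c []" "length rs = R + 2" "nxt R K rs = (K', ws, ds)" "q = to_nat K"
      using tr unfolding in_delta_machine by auto
    show ?thesis
      using conts_nonempty[OF K(1)] nxt_length[OF K(2,3)] K(2,4) by simp
  qed
  moreover have "tm_tapes (machine R c) = R + 2" "tm_accept (machine R c) = to_nat ([] :: com list)"
    by (simp_all add: machine_def)
  ultimately show ?thesis
    unfolding wf_tm_def by (auto split: prod.splits) blast+
qed

lemma deterministic_machine: "deterministic (machine R c)"
  unfolding deterministic_def by (auto simp: in_delta_machine)

section \<open>Big-step semantics with step counts, and its simulation\<close>

type_synonym store = "int \<times> (nat \<Rightarrow> nat) \<times> bool list"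

definition marked :: "int \<Rightarrow> symbol" where
  "marked j = (if j = 0 then Work 0 else Blank)"

fun tapes :: "nat \<Rightarrow> bool list \<Rightarrow> store \<Rightarrow> tape list" where
  "tapes R x (p, g, y) =
     (p, snd (word_tape x)) # map (\<lambda>r. (int (g r), marked)) [0..<R]
       @ [(int (length y), snd (word_tape y))]"

fun sat :: "bool list \<Rightarrow> test \<Rightarrow> store \<Rightarrow> bool" where
  "sat x (Pos r) (p, g, y) \<longleftrightarrow> g r > 0"
| "sat x (Inp b) (p, g, y) \<longleftrightarrow> snd (word_tape x) p = sym_of b"
| "sat x Nonblank (p, g, y) \<longleftrightarrow> snd (word_tape x) p \<noteq> Blank"

text \<open>The number is the exact count of machine steps, with one step for each unfolding of
  \<open>Seq\<close>, \<open>If\<close> or \<open>While\<close>. \<open>Init\<close> has no rule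
  because before it the counter tapes lack their marks and do not represent a store.\<close>

inductive exec :: "bool list \<Rightarrow> com \<Rightarrow> store \<Rightarrow> nat \<Rightarrow> store \<Rightarrow> bool" for x where
  Skip: "exec x Skip s 1 s"
| Inc: "exec x (Inc r) (p, g, y) 1 (p, g(r := Suc (g r)), y)"
| Dec: "exec x (Dec r) (p, g, y) 1 (p, g(r := g r - 1), y)"
| InpL: "exec x InpL (p, g, y) 1 (p - 1, g, y)"
| InpR: "exec x InpR (p, g, y) 1 (p + 1, g, y)"
| Out: "exec x (Out b) (p, g, y) 1 (p, g, y @ [b])"
| Seq: "exec x a s m s' \<Longrightarrow> exec x b s' n s'' \<Longrightarrow> exec x (Seq a b) s (Suc (m + n)) s''"
| IfT: "sat x t s \<Longrightarrow> exec x a s n s' \<Longrightarrow> exec x (If t a b) s (Suc n) s'"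
| IfF: "\<not> sat x t s \<Longrightarrow> exec x b s n s' \<Longrightarrow> exec x (If t a b) s (Suc n) s'"
| WhileF: "\<not> sat x t s \<Longrightarrow> exec x (While t a) s 1 s"
| WhileT: "sat x t s \<Longrightarrow> exec x a s m s' \<Longrightarrow> exec x (While t a) s' n s''
     \<Longrightarrow> exec x (While t a) s (Suc (m + n)) s''"

fun test_regs :: "test \<Rightarrow> nat set" where
  "test_regs (Pos r) = {r}"
| "test_regs _ = {}"

fun regs :: "com \<Rightarrow> nat set" where
  "regs (Inc r) = {r}"
| "regs (Dec r) = {r}"
| "regs (Seq a b) = regs a \<union> regs b"
| "regs (If t a b) = test_regs t \<union> regs a \<union> regs b"
| "regs (While t a) = test_regs t \<union> regs a"
| "regs _ = {}"

lemma finite_regs: "finite (regs c)"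
proof -
  have "finite (test_regs t)" for t by (cases t) auto
  then show ?thesis by (induction c) auto
qed

lemma length_tapes [simp]: "length (tapes R x s) = R + 2"
  by (cases s) auto

lemma nth_tapes [simp]:
  "tapes R x (p, g, y) ! 0 = (p, snd (word_tape x))"
  "r < R \<Longrightarrow> tapes R x (p, g, y) ! Suc r = (int (g r), marked)"
  "tapes R x (p, g, y) ! Suc R = (int (length y), snd (word_tape y))"
  by (auto simp: nth_append)

lemma marked_int_iff [simp]: "marked (int n) = Work 0 \<longleftrightarrow> n = 0"
  by (simp add: marked_def)

lemma word_tape_alphabet: "snd (word_tape x) j \<in> alphabet"
  by (cases "x ! nat j") (auto simp: word_tape_def alphabet_def)

lemma tapes_alphabet: "set (map tape_read (tapes R x s)) \<subseteq> alphabet"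
  by (cases s) (auto simp: word_tape_alphabet, auto simp: marked_def alphabet_def)

lemma holds_sat:
  "test_regs t \<subseteq> {..<R} \<Longrightarrow> holds t (map tape_read (tapes R x s)) \<longleftrightarrow> sat x t s"
  by (cases t; cases s) (auto simp del: tapes.simps)

lemma machine_step:
  assumes "K \<in> conts c []" "length ts = R + 2" "set (map tape_read ts) \<subseteq> alphabet"
    and "nxt R K (map tape_read ts) = (K', ws, ds)"
    and "ts' = map2 tape_update (zip ws ds) ts"
  shows "((to_nat K, ts), (to_nat K', ts')) \<in> step (machine R c)"
proof -
  have "(to_nat K, map tape_read ts, to_nat K', ws, ds) \<in> tm_delta (machine R c)"
    using assms by (auto simp: in_delta_machine)
  then show ?thesis
    using assms(5) unfolding step_def by blast
qed

lemma machine_step_tapes: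
  assumes K: "K \<in> conts c []"
    and n: "nxt R K (map tape_read (tapes R x s)) = (K', ws, ds)"
    and upd: "tape_update (ws ! 0, ds ! 0) (tapes R x s ! 0) = tapes R x s' ! 0"
      "\<And>r. r < R \<Longrightarrow> tape_update (ws ! Suc r, ds ! Suc r) (tapes R x s ! Suc r) = tapes R x s' ! Suc r"
      "tape_update (ws ! Suc R, ds ! Suc R) (tapes R x s ! Suc R) = tapes R x s' ! Suc R"
  shows "((to_nat K, tapes R x s), (to_nat K', tapes R x s')) \<in> step (machine R c)"
proof (rule machine_step[OF K length_tapes tapes_alphabet n])
  have l: "length ws = R + 2 \<and> length ds = R + 2"
    using nxt_length[OF _ n] by simp
  have "tape_update (ws ! i, ds ! i) (tapes R x s ! i) = tapes R x s' ! i" if "i < R + 2" for i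
    using that upd by (cases i) (auto simp: less_Suc_eq)
  then show "tapes R x s' = map2 tape_update (zip ws ds) (tapes R x s)"
    using l by (intro nth_equalityI) simp_all
qed

lemma word_tape_snoc: "snd (word_tape (y @ [b])) = (snd (word_tape y))(int (length y) := Bit b)"
  by (auto simp: word_tape_def nth_append fun_eq_iff)

lemma relpow_chain:
  "(a, b) \<in> r \<Longrightarrow> (b, c) \<in> r ^^ m \<Longrightarrow> (c, d) \<in> r ^^ n \<Longrightarrow> (a, d) \<in> r ^^ Suc (m + n)"
  by (rule relpow_Suc_I2) (auto simp: relpow_add)

lemma update_stay:
  assumes "length ts = R + 2"
  shows "map2 tape_update (zip (map tape_read ts) (stay R)) ts = ts"
proof (rule nth_equalityI)
  fix i assume "i < length (map2 tape_update (zip (map tape_read ts) (stay R)) ts)"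
  then show "map2 tape_update (zip (map tape_read ts) (stay R)) ts ! i = ts ! i"
    using assms by (cases "ts ! i") simp
qed (use assms in simp)

text \<open>Generalising over the continuation \<open>K\<close> makes the induction work: the second
  half of \<open>Seq a b\<close> belongs to the continuation of \<open>a\<close>, and a loop belongs
  to the continuation of its own body.\<close>

lemma exec_machine:
  assumes "exec x a s n s'" and "regs a \<subseteq> {..<R}" and "conts a K \<subseteq> conts c []"
  shows "((to_nat (a # K), tapes R x s), (to_nat K, tapes R x s')) \<in> step (machine R c) ^^ n"
  using assms
proof (induction arbitrary: K rule: exec.induct)
  case (Skip s)
  then show ?case
    by (cases s) (auto intro!: machine_step_tapes simp del: tapes.simps)
next
  case (Inc r p g y)
  then show ?case
    by (auto intro!: machine_step_tapes simp: nth_list_update simp del: tapes.simps)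
next
  case (Dec r p g y)
  then show ?case
    by (auto intro!: machine_step_tapes simp: nth_list_update
        simp del: tapes.simps)
next
  case (InpL p g y)
  then show ?case
    by (auto intro!: machine_step_tapes simp: nth_list_update simp del: tapes.simps)
next
  case (InpR p g y)
  then show ?case
    by (auto intro!: machine_step_tapes simp: nth_list_update simp del: tapes.simps)
next
  case (Out b p g y)
  then show ?case
    by (auto intro!: machine_step_tapes
        simp: nth_list_update word_tape_snoc simp del: tapes.simps)
next
  case (Seq a s m s' b n s'')
  have "((to_nat (Seq a b # K), tapes R x s), (to_nat (a # b # K), tapes R x s)) \<in> step (machine R c)"
    using Seq.prems
    by (cases s) (auto intro!: machine_step_tapes simp del: tapes.simps)
  moreover have "((to_nat (a # b # K), tapes R x s), (to_nat (b # K), tapes R x s')) \<in> step (machine R c) ^^ m"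
    using Seq.prems by (intro Seq.IH) auto
  moreover have "((to_nat (b # K), tapes R x s'), (to_nat K, tapes R x s'')) \<in> step (machine R c) ^^ n"
    using Seq.prems by (intro Seq.IH) auto
  ultimately show ?case
    by (rule relpow_chain)
next
  case (IfT t s a n s' b)
  have "((to_nat (If t a b # K), tapes R x s), (to_nat (a # K), tapes R x s)) \<in> step (machine R c)"
    using IfT by (cases s) (auto intro!: machine_step_tapes simp: holds_sat simp del: tapes.simps holds.simps sat.simps)
  moreover have "((to_nat (a # K), tapes R x s), (to_nat K, tapes R x s')) \<in> step (machine R c) ^^ n"
    using IfT.prems by (intro IfT.IH) auto
  ultimately show ?case
    by (rule relpow_Suc_I2)
next
  case (IfF t s b n s' a)
  have "((to_nat (If t a b # K), tapes R x s), (to_nat (b # K), tapes R x s)) \<in> step (machine R c)"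
    using IfF by (cases s) (auto intro!: machine_step_tapes simp: holds_sat simp del: tapes.simps holds.simps sat.simps)
  moreover have "((to_nat (b # K), tapes R x s), (to_nat K, tapes R x s')) \<in> step (machine R c) ^^ n"
    using IfF.prems by (intro IfF.IH) auto
  ultimately show ?case
    by (rule relpow_Suc_I2)
next
  case (WhileF t s a)
  then show ?case
    by (cases s) (auto intro!: machine_step_tapes simp: holds_sat simp del: tapes.simps holds.simps sat.simps)
next
  case (WhileT t s a m s' n s'')
  have "((to_nat (While t a # K), tapes R x s), (to_nat (a # While t a # K), tapes R x s)) \<in> step (machine R c)"
    using WhileT by (cases s) (auto intro!: machine_step_tapes simp: holds_sat simp del: tapes.simps holds.simps sat.simps)
  moreover have "((to_nat (a # While t a # K), tapes R x s), (to_nat (While t a # K), tapes R x s')) \<in> step (machine R c) ^^ m"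
    using WhileT.prems by (intro WhileT.IH) auto
  moreover have "((to_nat (While t a # K), tapes R x s'), (to_nat K, tapes R x s'')) \<in> step (machine R c) ^^ n"
    using WhileT.prems by (intro WhileT.IH) auto
  ultimately show ?case
    by (rule relpow_chain)
qed

lemma exec_polytime:
  fixes P :: "nat poly"
  assumes "\<And>x. \<exists>n \<le> poly P (length x). \<exists>p g. exec x c (0, \<lambda>_. 0, []) n (p, g, f x)"
  shows "polytime_computable f"
proof -
  obtain R where R: "regs c \<subseteq> {..<R}"
    using finite_regs finite_nat_iff_bounded by blast
  let ?M = "machine R (Seq Init c)"
  \<comment> \<open>The summand 2 pays for splitting \<open>Seq Init c\<close> and for
    \<open>Init\<close>.\<close>
  have "\<exists>n ts. n \<le> poly (P + 2) (length x) \<and> (initial ?M x, (tm_accept ?M, ts)) \<in> step ?M ^^ n \<and>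
        tape_holds (last ts) (f x)" for x
  proof -
    obtain n p g where n: "n \<le> poly P (length x)" and e: "exec x c (0, \<lambda>_. 0, []) n (p, g, f x)"
      using assms by blast
    define ts where "ts = word_tape x # replicate (R + 1) (word_tape [])"
    let ?s = "(0, \<lambda>_. 0, []) :: store"
    have len: "length ts = R + 2"
      by (simp add: ts_def)
    have al: "set (map tape_read ts) \<subseteq> alphabet"
    proof -
      have "tape_read (word_tape z) \<in> alphabet" for z
        using word_tape_alphabet[of z 0] by (simp add: word_tape_def)
      then show ?thesis
        by (auto simp: ts_def)
    qed
    have "((to_nat [Seq Init c], ts), (to_nat [Init, c], ts)) \<in> step ?M"
      by (rule machine_step[OF _ len al nxt.simps(9)]) (simp_all add: update_stay[OF len])
    moreover have "((to_nat [Init, c], ts), (to_nat [c], tapes R x ?s)) \<in> step ?M"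
    proof (rule machine_step[OF _ len al nxt.simps(2)])
      let ?ws = "map (\<lambda>i. if i = 0 \<or> i = Suc R then map tape_read ts ! i else Work 0) [0..<R + 2]"
      have upd: "map2 tape_update (zip ?ws (stay R)) ts ! i = tape_update (?ws ! i, Stay) (ts ! i)"
        if "i < R + 2" for i
        using that len by (simp del: upt.simps)
      have mark: "(snd (word_tape []))(0 := Work 0) = marked"
        by (auto simp: word_tape_def marked_def)
      have w: "word_tape z = (0, snd (word_tape z))" for z
        by (simp add: word_tape_def)
      have "tapes R x ?s ! i = map2 tape_update (zip ?ws (stay R)) ts ! i" if i: "i < R + 2" for i
      proof -
        have ws: "?ws ! i = (if i = 0 \<or> i = Suc R then map tape_read ts ! i else Work 0)"
          using i by (simp del: upt.simps)
        consider "i = 0" | "i = Suc R" | r where "i = Suc r" "r < R"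
          using i by (cases i) (auto simp: less_Suc_eq)
        then show ?thesis
        proof cases
          case 1
          then have "map tape_read ts ! i = snd (word_tape x) 0" "ts ! i = (0, snd (word_tape x))"
            using w by (simp_all add: ts_def word_tape_def)
          with 1 show ?thesis
            unfolding upd[OF i] ws by (simp del: tapes.simps)
        next
          case 2
          then have "ts ! i = (0, snd (word_tape []))"
            using w[of "[]"] by (simp add: ts_def del: replicate_Suc)
          moreover then have "map tape_read ts ! i = snd (word_tape []) 0"
            using i len by simp
          ultimately show ?thesis
            using 2 unfolding upd[OF i] ws by (simp del: tapes.simps)
        next
          case 3
          then have "ts ! i = (0, snd (word_tape []))"
            using w[of "[]"] by (simp add: ts_def del: replicate_Suc)
          with 3 show ?thesis
            using mark unfolding upd[OF i] ws by (simp del: tapes.simps)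
        qed
      qed
      then show "tapes R x ?s = map2 tape_update (zip ?ws (stay R)) ts"
        using len by (intro nth_equalityI) (simp_all del: tapes.simps upt.simps)
    qed simp
    moreover have "((to_nat [c], tapes R x ?s), (to_nat ([] :: com list), tapes R x (p, g, f x))) \<in> step ?M ^^ n"
      using R by (intro exec_machine[OF e]) auto
    ultimately have "((to_nat [Seq Init c], ts), (to_nat ([] :: com list), tapes R x (p, g, f x))) \<in> step ?M ^^ (Suc (Suc n))"
      by (meson relpow_Suc_I2)
    moreover have "initial ?M x = (to_nat [Seq Init c], ts)"
      by (simp add: initial_def machine_def ts_def)
    moreover have "tm_accept ?M = to_nat ([] :: com list)"
      by (simp add: machine_def)
    moreover have "tape_holds (last (tapes R x (p, g, f x))) (f x)"
      by (simp add: tape_holds_def word_tape_def)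
    ultimately show ?thesis
      using n by (intro exI[of _ "Suc (Suc n)"] exI[of _ "tapes R x (p, g, f x)"]) (auto simp: eval_nat_numeral)
  qed
  then show ?thesis
    unfolding polytime_computable_def using wf_machine deterministic_machine by blast
qed

section \<open>Evaluation of arithmetic expressions\<close>

text \<open>Upper bounds compose without tracking which branch was taken and what it really
  cost.\<close>

definition runs :: "bool list \<Rightarrow> com \<Rightarrow> store \<Rightarrow> nat \<Rightarrow> store \<Rightarrow> bool" where
  "runs x c s T s' \<longleftrightarrow> (\<exists>n \<le> T. exec x c s n s')"

lemma runs_mono: "runs x c s T s' \<Longrightarrow> T \<le> T' \<Longrightarrow> runs x c s T' s'"
  unfolding runs_def by (meson order_trans)

lemma runs_Skip: "s' = s \<Longrightarrow> runs x Skip s (Suc T) s'"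
  unfolding runs_def using exec.Skip by fastforce

lemma runs_Inc: "s' = (p, g(r := Suc (g r)), y) \<Longrightarrow> runs x (Inc r) (p, g, y) 1 s'"
  unfolding runs_def using exec.Inc by blast

lemma runs_Dec: "s' = (p, g(r := g r - 1), y) \<Longrightarrow> runs x (Dec r) (p, g, y) 1 s'"
  unfolding runs_def using exec.Dec by blast

lemma runs_InpL: "s' = (p - 1, g, y) \<Longrightarrow> runs x InpL (p, g, y) 1 s'"
  unfolding runs_def using exec.InpL by blast

lemma runs_InpR: "s' = (p + 1, g, y) \<Longrightarrow> runs x InpR (p, g, y) 1 s'"
  unfolding runs_def using exec.InpR by blast

lemma runs_Out: "s' = (p, g, y @ [b]) \<Longrightarrow> runs x (Out b) (p, g, y) 1 s'"
  unfolding runs_def using exec.Out by blast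

lemma runs_Seq:
  assumes "runs x a s m s'" "runs x b s' n s''"
  shows "runs x (Seq a b) s (Suc (m + n)) s''"
proof -
  obtain m' n' where "m' \<le> m" "n' \<le> n" "exec x a s m' s'" "exec x b s' n' s''"
    using assms unfolding runs_def by blast
  then show ?thesis
    unfolding runs_def by (intro exI[of _ "Suc (m' + n')"]) (auto intro: exec.Seq)
qed

lemma runs_If:
  assumes "sat x t s \<Longrightarrow> runs x a s T s'" "\<not> sat x t s \<Longrightarrow> runs x b s T s'"
  shows "runs x (If t a b) s (Suc T) s'"
proof (cases "sat x t s")
  case True
  then obtain n where "n \<le> T" "exec x a s n s'"
    using assms unfolding runs_def by blast
  then show ?thesis
    using True unfolding runs_def by (intro exI[of _ "Suc n"]) (auto intro: exec.IfT)
next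
  case False
  then obtain n where "n \<le> T" "exec x b s n s'"
    using assms unfolding runs_def by blast
  then show ?thesis
    using False unfolding runs_def by (intro exI[of _ "Suc n"]) (auto intro: exec.IfF)
qed

text \<open>\<open>f j\<close> is the store after \<open>j\<close> rounds; the loops below are all
  verified by supplying such an explicit sequence of stores.\<close>

lemma runs_While:
  assumes "\<And>j. j < k \<Longrightarrow> sat x t (f j)" "\<not> sat x t (f k)"
    and "\<And>j. j < k \<Longrightarrow> runs x a (f j) T (f (Suc j))"
    and "s = f 0" "s' = f k"
  shows "runs x (While t a) s (k * Suc T + 1) s'"
proof -
  \<comment> \<open>Induction over the number of rounds still to come, since \<open>exec\<close>
    adds rounds at the front.\<close>
  have "j \<le> k \<Longrightarrow> runs x (While t a) (f (k - j)) (j * Suc T + 1) (f k)" for j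
  proof (induction j)
    case 0
    then show ?case
      using exec.WhileF[OF assms(2)] unfolding runs_def by auto
  next
    case (Suc j)
    then have j: "k - Suc j < k" "Suc (k - Suc j) = k - j"
      by auto
    obtain m where m: "m \<le> T" "exec x a (f (k - Suc j)) m (f (k - j))"
      using assms(3)[OF j(1)] unfolding j(2) runs_def by blast
    obtain n where n: "n \<le> j * Suc T + 1" "exec x (While t a) (f (k - j)) n (f k)"
      using Suc unfolding runs_def by auto
    have "exec x (While t a) (f (k - Suc j)) (Suc (m + n)) (f k)"
      by (rule exec.WhileT[OF assms(1)[OF j(1)] m(2) n(2)])
    then show ?case
      using m(1) n(1) unfolding runs_def by (intro exI[of _ "Suc (m + n)"]) auto
  qed
  from this[of k] show ?thesis
    using assms(4,5) by simp
qed

definition transfer :: "nat \<Rightarrow> nat \<Rightarrow> com" where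
  "transfer r q = While (Pos r) (Seq (Dec r) (Inc q))"

lemma runs_transfer:
  assumes "r \<noteq> q" "s' = (p, g(r := 0, q := g q + g r), y)"
  shows "runs x (transfer r q) (p, g, y) (4 * g r + 1) s'"
proof -
  let ?f = "\<lambda>j. (p, g(r := g r - j, q := g q + j), y)"
  have "runs x (transfer r q) (p, g, y) (g r * Suc 3 + 1) s'"
    unfolding transfer_def
  proof (rule runs_While[where f = ?f])
    fix j assume "j < g r"
    have "runs x (Seq (Dec r) (Inc q)) (?f j) (Suc (1 + 1)) (?f (Suc j))"
      by (rule runs_Seq[OF runs_Dec[OF refl] runs_Inc]) (use assms \<open>j < g r\<close> in auto)
    then show "runs x (Seq (Dec r) (Inc q)) (?f j) 3 (?f (Suc j))"
      by (simp add: eval_nat_numeral)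
  qed (use assms in auto)
  then show ?thesis
    by (rule runs_mono) simp
qed

text \<open>\<open>transfer\<close> empties its source; the scratch register \<open>t\<close>
  collects a second copy from which \<open>r\<close> is restored.\<close>

definition copy :: "nat \<Rightarrow> nat \<Rightarrow> nat \<Rightarrow> com" where
  "copy r q t = Seq (While (Pos r) (Seq (Dec r) (Seq (Inc q) (Inc t)))) (transfer t r)"

lemma runs_copy:
  assumes "distinct [r, q, t]" "g t = 0" "s' = (p, g(q := g q + g r), y)"
  shows "runs x (copy r q t) (p, g, y) (10 * g r + 3) s'"
proof -
  let ?f = "\<lambda>j. (p, g(r := g r - j, q := g q + j, t := j), y)"
  have 1: "runs x (While (Pos r) (Seq (Dec r) (Seq (Inc q) (Inc t)))) (p, g, y) (g r * Suc 5 + 1) (?f (g r))"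
  proof (rule runs_While[where f = ?f])
    fix j assume "j < g r"
    have "runs x (Seq (Dec r) (Seq (Inc q) (Inc t))) (?f j) (Suc (1 + Suc (1 + 1))) (?f (Suc j))"
      by (rule runs_Seq[OF runs_Dec[OF refl] runs_Seq[OF runs_Inc[OF refl] runs_Inc]])
        (use assms \<open>j < g r\<close> in \<open>auto simp: fun_eq_iff\<close>)
    then show "runs x (Seq (Dec r) (Seq (Inc q) (Inc t))) (?f j) 5 (?f (Suc j))"
      by (simp add: eval_nat_numeral)
  qed (use assms in \<open>auto simp: fun_eq_iff\<close>)
  have 2: "runs x (transfer t r) (?f (g r)) (4 * (g(r := g r - g r, q := g q + g r, t := g r)) t + 1) s'"
    by (rule runs_transfer) (use assms in \<open>auto simp: fun_eq_iff\<close>)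
  show ?thesis
    unfolding copy_def by (rule runs_mono[OF runs_Seq[OF 1 2]]) (use assms in simp)
qed

definition zero :: "nat \<Rightarrow> com" where
  "zero r = While (Pos r) (Dec r)"

lemma runs_zero:
  assumes "s' = (p, g(r := 0), y)"
  shows "runs x (zero r) (p, g, y) (2 * g r + 1) s'"
proof -
  let ?f = "\<lambda>j. (p, g(r := g r - j), y)"
  have "runs x (zero r) (p, g, y) (g r * Suc 1 + 1) s'"
    unfolding zero_def
    by (rule runs_While[where f = ?f]) (use assms in \<open>auto intro!: runs_Dec[THEN runs_mono]\<close>)
  then show ?thesis
    by (rule runs_mono) simp
qed

text \<open>\<open>DivS\<close> divides by the successor of its second argument, which avoids division by zero.\<close>
datatype aexp = Const nat | Len | Idx | Symb aexp
  | Add aexp aexp | Sub aexp aexp | Mul aexp aexp | DivS aexp aexp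

text \<open>Three values, so that the end of the input is visible to arithmetic as well.\<close>

definition input_code :: "bool list \<Rightarrow> nat \<Rightarrow> nat" where
  "input_code x j = (if j < length x then if x ! j then 2 else 1 else 0)"

fun aval :: "aexp \<Rightarrow> bool list \<Rightarrow> nat \<Rightarrow> nat" where
  "aval (Const n) x i = n"
| "aval Len x i = length x"
| "aval Idx x i = i"
| "aval (Symb a) x i = input_code x (aval a x i)"
| "aval (Add a b) x i = aval a x i + aval b x i"
| "aval (Sub a b) x i = aval a x i - aval b x i"
| "aval (Mul a b) x i = aval a x i * aval b x i"
| "aval (DivS a b) x i = aval a x i div Suc (aval b x i)"

fun incs :: "nat \<Rightarrow> nat \<Rightarrow> com" where
  "incs r 0 = Skip"
| "incs r (Suc n) = Seq (Inc r) (incs r n)"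

definition lookup_loop :: "nat \<Rightarrow> com" where
  "lookup_loop r = While (Pos r) (Seq (Dec r) (Seq (Inc (r + 1)) InpR))"

definition lookup_back :: "nat \<Rightarrow> com" where
  "lookup_back r = While (Pos r) (Seq (Dec r) InpL)"

text \<open>The input is addressed in unary: \<open>r + 1\<close> records how far the head has moved
  and brings it back to cell 0, where the next evaluation expects it.\<close>

definition lookup :: "nat \<Rightarrow> com" where
  "lookup r = Seq (lookup_loop r)
     (Seq (If (Inp None) Skip (If (Inp (Some True)) (Seq (Inc r) (Inc r)) (Inc r)))
        (lookup_back (r + 1)))"

definition sub_loop :: "nat \<Rightarrow> com" where
  "sub_loop r = While (Pos (r + 1)) (Seq (Dec (r + 1)) (Dec r))"

definition mul_loop :: "nat \<Rightarrow> com" where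
  "mul_loop r = Seq (While (Pos (r + 1)) (Seq (Dec (r + 1)) (copy (r + 2) r (r + 3)))) (zero (r + 2))"

text \<open>
  Register \<open>r + 3\<close> counts down from the divisor in \<open>r + 2\<close> and is reloaded when it reaches zero.
\<close>
definition div_body :: "nat \<Rightarrow> com" where
  "div_body r = Seq (Dec (r + 1)) (Seq (Dec (r + 3))
     (If (Pos (r + 3)) Skip (Seq (Inc r) (copy (r + 2) (r + 3) (r + 4)))))"

definition div_loop :: "nat \<Rightarrow> com" where
  "div_loop r = Seq (Inc (r + 2)) (Seq (copy (r + 2) (r + 3) (r + 4))
     (Seq (While (Pos (r + 1)) (div_body r)) (Seq (zero (r + 2)) (zero (r + 3)))))"

text \<open>The value goes to register \<open>r\<close>; registers from \<open>r\<close> on must be zero and serve as a stack.\<close>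
fun comp :: "aexp \<Rightarrow> nat \<Rightarrow> com" where
  "comp (Const n) r = incs r n"
| "comp Len r = copy 0 r (r + 1)"
| "comp Idx r = copy 1 r (r + 1)"
| "comp (Symb a) r = Seq (comp a r) (lookup r)"
| "comp (Add a b) r = Seq (comp a r) (Seq (comp b (r + 1)) (transfer (r + 1) r))"
| "comp (Sub a b) r = Seq (comp a r) (Seq (comp b (r + 1)) (sub_loop r))"
| "comp (Mul a b) r = Seq (comp a (r + 1)) (Seq (comp b (r + 2)) (mul_loop r))"
| "comp (DivS a b) r = Seq (comp a (r + 1)) (Seq (comp b (r + 2)) (div_loop r))"

lemma runs_incs: "s' = (p, g(r := g r + n), y) \<Longrightarrow> runs x (incs r n) (p, g, y) (2 * n + 1) s'"
proof (induction n arbitrary: g s')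
  case 0
  then show ?case
    by (auto intro!: runs_Skip[THEN runs_mono])
next
  case (Suc n)
  have "runs x (incs r n) (p, g(r := Suc (g r)), y) (2 * n + 1) s'"
    by (rule Suc.IH) (use Suc.prems in \<open>auto simp: fun_eq_iff\<close>)
  from runs_Seq[OF runs_Inc[OF refl] this] show ?case
    by (simp add: runs_mono)
qed

lemma word_tape_input_code:
  "snd (word_tape x) (int j) = Blank \<longleftrightarrow> input_code x j = 0"
  "snd (word_tape x) (int j) = Bit True \<longleftrightarrow> input_code x j = 2"
  by (auto simp: word_tape_def input_code_def)

lemma runs_lookup:
  assumes "g (Suc r) = 0" "s' = (0, g(r := input_code x (g r)), y)"
  shows "runs x (lookup r) (0, g, y) (10 * g r + 9) s'"
proof -
  let ?f = "\<lambda>j. (int j, g(r := g r - j, Suc r := j), y)"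
  have 1: "runs x (lookup_loop r) (0, g, y) (g r * Suc 5 + 1) (?f (g r))"
    unfolding lookup_loop_def
  proof (rule runs_While[where f = ?f])
    fix j assume "j < g r"
    have "runs x (Seq (Dec r) (Seq (Inc (r + 1)) InpR)) (?f j) (Suc (1 + Suc (1 + 1))) (?f (Suc j))"
      by (rule runs_Seq[OF runs_Dec[OF refl] runs_Seq[OF runs_Inc[OF refl] runs_InpR]])
        (use \<open>j < g r\<close> in \<open>auto simp: fun_eq_iff\<close>)
    then show "runs x (Seq (Dec r) (Seq (Inc (r + 1)) InpR)) (?f j) 5 (?f (Suc j))"
      by (simp add: eval_nat_numeral)
  qed (use assms in \<open>auto simp: fun_eq_iff\<close>)
  let ?h = "\<lambda>j. (int (g r - j), g(r := input_code x (g r), Suc r := g r - j), y)"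
  have 2: "runs x (If (Inp None) Skip (If (Inp (Some True)) (Seq (Inc r) (Inc r)) (Inc r))) (?f (g r))
      (Suc (Suc 3)) (?h 0)"
  proof (intro runs_If)
    assume "sat x (Inp None) (?f (g r))"
    then show "runs x Skip (?f (g r)) (Suc 3) (?h 0)"
      by (intro runs_Skip) (auto simp: word_tape_input_code)
  next
    assume "sat x (Inp (Some True)) (?f (g r))"
    then have c: "input_code x (g r) = Suc (Suc 0)"
      by (auto simp: word_tape_input_code)
    have "runs x (Seq (Inc r) (Inc r)) (?f (g r)) (Suc (1 + 1)) (?h 0)"
      by (rule runs_Seq[OF runs_Inc[OF refl] runs_Inc]) (auto simp: fun_eq_iff c)
    then show "runs x (Seq (Inc r) (Inc r)) (?f (g r)) 3 (?h 0)"
      by (simp add: eval_nat_numeral)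
  next
    assume "\<not> sat x (Inp None) (?f (g r))" "\<not> sat x (Inp (Some True)) (?f (g r))"
    then have c: "input_code x (g r) = Suc 0"
      by (auto simp: word_tape_input_code) (auto simp: input_code_def split: if_splits)
    have "runs x (Inc r) (?f (g r)) 1 (?h 0)"
      by (rule runs_Inc) (auto simp: fun_eq_iff c)
    then show "runs x (Inc r) (?f (g r)) 3 (?h 0)"
      by (rule runs_mono) simp
  qed
  have 3: "runs x (lookup_back (r + 1)) (?h 0) (g r * Suc 3 + 1) (?h (g r))"
    unfolding lookup_back_def
  proof (rule runs_While[where f = ?h])
    fix j assume "j < g r"
    have "runs x (Seq (Dec (r + 1)) InpL) (?h j) (Suc (1 + 1)) (?h (Suc j))"
      by (rule runs_Seq[OF runs_Dec[OF refl] runs_InpL]) (use \<open>j < g r\<close> in \<open>auto simp: fun_eq_iff\<close>)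
    then show "runs x (Seq (Dec (r + 1)) InpL) (?h j) 3 (?h (Suc j))"
      by (simp add: eval_nat_numeral)
  qed auto
  have s': "?h (g r) = s'"
    using assms by (auto simp: fun_eq_iff)
  show ?thesis
    using runs_Seq[OF 1 runs_Seq[OF 2 3]] unfolding lookup_def s' by (rule runs_mono) simp
qed

lemma runs_sub_loop:
  assumes "s' = (p, g(r := g r - g (Suc r), Suc r := 0), y)"
  shows "runs x (sub_loop r) (p, g, y) (4 * g (Suc r) + 1) s'"
proof -
  let ?f = "\<lambda>j. (p, g(r := g r - j, Suc r := g (Suc r) - j), y)"
  have "runs x (sub_loop r) (p, g, y) (g (Suc r) * Suc 3 + 1) s'"
    unfolding sub_loop_def
  proof (rule runs_While[where f = ?f])
    fix j assume "j < g (Suc r)"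
    have "runs x (Seq (Dec (r + 1)) (Dec r)) (?f j) (Suc (1 + 1)) (?f (Suc j))"
      by (rule runs_Seq[OF runs_Dec[OF refl] runs_Dec]) (auto simp: fun_eq_iff)
    then show "runs x (Seq (Dec (r + 1)) (Dec r)) (?f j) 3 (?f (Suc j))"
      by (simp add: eval_nat_numeral)
  qed (use assms in auto)
  then show ?thesis
    by (rule runs_mono) simp
qed

lemma runs_mul_loop:
  assumes "g r = 0" "g (r + 1) = a" "g (r + 2) = b" "g (r + 3) = 0"
    and "s' = (p, g(r := a * b, r + 1 := 0, r + 2 := 0), y)"
  shows "runs x (mul_loop r) (p, g, y) (a * (10 * b + 6) + 2 * b + 3) s'"
proof -
  let ?f = "\<lambda>j. (p, g(r := j * b, r + 1 := a - j), y)"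
  have 1: "runs x (While (Pos (r + 1)) (Seq (Dec (r + 1)) (copy (r + 2) r (r + 3)))) (p, g, y)
      (a * Suc (Suc (1 + (10 * b + 3))) + 1) (?f a)"
  proof (rule runs_While[where f = ?f])
    fix j assume "j < a"
    have "runs x (copy (r + 2) r (r + 3)) (p, g(r := j * b, r + 1 := a - Suc j), y)
        (10 * (g(r := j * b, r + 1 := a - Suc j)) (r + 2) + 3) (?f (Suc j))"
      by (rule runs_copy) (use assms in \<open>auto simp: fun_eq_iff\<close>)
    then have c: "runs x (copy (r + 2) r (r + 3)) (p, g(r := j * b, r + 1 := a - Suc j), y)
        (10 * b + 3) (?f (Suc j))"
      using assms by simp
    show "runs x (Seq (Dec (r + 1)) (copy (r + 2) r (r + 3))) (?f j) (Suc (1 + (10 * b + 3))) (?f (Suc j))"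
      by (rule runs_Seq[OF runs_Dec c]) (use assms \<open>j < a\<close> in \<open>auto simp: fun_eq_iff\<close>)
  qed (use assms in \<open>auto simp: fun_eq_iff\<close>)
  have 2: "runs x (zero (r + 2)) (?f a) (2 * (g(r := a * b, r + 1 := a - a)) (r + 2) + 1) s'"
    by (rule runs_zero) (use assms in \<open>auto simp: fun_eq_iff\<close>)
  show ?thesis
    unfolding mul_loop_def by (rule runs_mono[OF runs_Seq[OF 1 2]]) (use assms in simp)
qed

text \<open>Loop invariant after \<open>j\<close> units of the dividend: the quotient in
  \<open>r\<close>, and in \<open>r + 3\<close> the distance \<open>d - j mod d\<close> to the next
  multiple of \<open>d\<close>, which is never zero between rounds.\<close>

lemma runs_div_body:
  assumes "j < a" "d > 0" "h (r + 2) = d" "h (r + 4) = 0"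
    and f: "\<And>j. f j = (p, h(r := j div d, r + 1 := a - j, r + 3 := d - j mod d), y)"
  shows "runs x (div_body r) (f j) (10 * d + 11) (f (Suc j))"
proof -
  let ?g = "h(r := j div d, r + 1 := a - Suc j, r + 3 := d - Suc (j mod d))"
  have 1: "runs x (Dec (r + 1)) (f j) 1 (p, h(r := j div d, r + 1 := a - Suc j, r + 3 := d - j mod d), y)"
    unfolding f by (rule runs_Dec) (auto simp: fun_eq_iff)
  have 2: "runs x (Dec (r + 3)) (p, h(r := j div d, r + 1 := a - Suc j, r + 3 := d - j mod d), y) 1 (p, ?g, y)"
    by (rule runs_Dec) (auto simp: fun_eq_iff)
  have 3: "runs x (If (Pos (r + 3)) Skip (Seq (Inc r) (copy (r + 2) (r + 3) (r + 4)))) (p, ?g, y)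
      (Suc (Suc (10 * d + 5))) (f (Suc j))"
  proof (intro runs_If)
    assume "sat x (Pos (r + 3)) (p, ?g, y)"
    then have "Suc (j mod d) < d"
      by simp
    then have "Suc j mod d = Suc (j mod d)" "Suc j div d = j div d"
      by (simp_all add: mod_Suc div_Suc)
    then show "runs x Skip (p, ?g, y) (Suc (10 * d + 5)) (f (Suc j))"
      unfolding f by (intro runs_Skip) simp
  next
    assume "\<not> sat x (Pos (r + 3)) (p, ?g, y)"
    then have "\<not> Suc (j mod d) < d"
      by simp
    then have "Suc (j mod d) = d"
      using mod_less_divisor[OF \<open>d > 0\<close>, of j] by linarith
    then have m: "Suc j mod d = 0" "Suc j div d = Suc (j div d)"
      by (simp_all add: mod_Suc div_Suc)
    have "runs x (copy (r + 2) (r + 3) (r + 4)) (p, ?g(r := Suc (j div d)), y)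
        (10 * (?g(r := Suc (j div d))) (r + 2) + 3) (f (Suc j))"
      unfolding f by (rule runs_copy) (use assms m \<open>Suc (j mod d) = d\<close> in \<open>auto simp: fun_eq_iff\<close>)
    then have c: "runs x (copy (r + 2) (r + 3) (r + 4)) (p, ?g(r := Suc (j div d)), y) (10 * d + 3) (f (Suc j))"
      using assms by simp
    have "runs x (Seq (Inc r) (copy (r + 2) (r + 3) (r + 4))) (p, ?g, y) (Suc (1 + (10 * d + 3))) (f (Suc j))"
      by (rule runs_Seq[OF runs_Inc c]) (auto simp: fun_eq_iff)
    then show "runs x (Seq (Inc r) (copy (r + 2) (r + 3) (r + 4))) (p, ?g, y) (Suc (10 * d + 5)) (f (Suc j))"
      by (rule runs_mono) simp
  qed
  show ?thesis
    unfolding div_body_def by (rule runs_mono[OF runs_Seq[OF 1 runs_Seq[OF 2 3]]]) simp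
qed

lemma runs_div_loop:
  assumes "g r = 0" "g (r + 1) = a" "g (r + 2) = b" "g (r + 3) = 0" "g (r + 4) = 0"
    and "s' = (p, g(r := a div Suc b, r + 1 := 0, r + 2 := 0), y)"
  shows "runs x (div_loop r) (p, g, y) (a * (10 * b + 22) + 14 * b + 26) s'"
proof -
  let ?d = "Suc b"
  let ?g = "g(r + 2 := ?d)"
  let ?f = "\<lambda>j. (p, ?g(r := j div ?d, r + 1 := a - j, r + 3 := ?d - j mod ?d), y)"
  have 1: "runs x (Inc (r + 2)) (p, g, y) 1 (p, ?g, y)"
    by (rule runs_Inc) (use assms in auto)
  have "runs x (copy (r + 2) (r + 3) (r + 4)) (p, ?g, y) (10 * ?g (r + 2) + 3) (?f 0)"
    by (rule runs_copy) (use assms in \<open>auto simp: fun_eq_iff\<close>)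
  then have 2: "runs x (copy (r + 2) (r + 3) (r + 4)) (p, ?g, y) (10 * ?d + 3) (?f 0)"
    by simp
  have 3: "runs x (While (Pos (r + 1)) (div_body r)) (?f 0) (a * Suc (10 * ?d + 11) + 1) (?f a)"
  proof (rule runs_While[where f = ?f])
    fix j assume "j < a"
    then show "runs x (div_body r) (?f j) (10 * ?d + 11) (?f (Suc j))"
      by (rule runs_div_body[where h = ?g and d = ?d]) (use assms in auto)
  qed (use assms in auto)
  have 4: "runs x (zero (r + 2)) (?f a) (2 * ?d + 1) (p, ?g(r := a div ?d, r + 1 := 0, r + 3 := ?d - a mod ?d, r + 2 := 0), y)"
    by (rule runs_mono[OF runs_zero]) (auto simp: fun_eq_iff)
  have 5: "runs x (zero (r + 3)) (p, ?g(r := a div ?d, r + 1 := 0, r + 3 := ?d - a mod ?d, r + 2 := 0), y) (2 * ?d + 1) s'"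
    by (rule runs_mono[OF runs_zero]) (use assms in \<open>auto simp: fun_eq_iff\<close>)
  show ?thesis
    unfolding div_loop_def
    by (rule runs_mono[OF runs_Seq[OF 1 runs_Seq[OF 2 runs_Seq[OF 3 runs_Seq[OF 4 5]]]]]) (simp add: algebra_simps)
qed

text \<open>Counters work in unary, so time is governed by the size of intermediate values. For a
  fixed expression these are polynomial in \<open>length x + i\<close>, as \<open>aexp\<close>
  offers no exponentiation.\<close>

definition pbounded :: "(bool list \<Rightarrow> nat \<Rightarrow> nat) \<Rightarrow> bool" where
  "pbounded f \<longleftrightarrow> (\<exists>p :: nat poly. \<forall>x i. f x i \<le> poly p (length x + i))"

lemma pbounded_mono: "pbounded g \<Longrightarrow> (\<And>x i. f x i \<le> g x i) \<Longrightarrow> pbounded f"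
  unfolding pbounded_def by (meson order_trans)

lemma pbounded_const: "pbounded (\<lambda>x i. c)"
  unfolding pbounded_def by (rule exI[of _ "[:c:]"]) simp

lemma pbounded_len: "pbounded (\<lambda>x i. length x)" and pbounded_idx: "pbounded (\<lambda>x i. i)"
  unfolding pbounded_def by (rule exI[of _ "[:0, 1:]"], simp)+

lemma pbounded_add: "pbounded f \<Longrightarrow> pbounded g \<Longrightarrow> pbounded (\<lambda>x i. f x i + g x i)"
  unfolding pbounded_def
proof (elim exE)
  fix p q :: "nat poly"
  assume "\<forall>x i. f x i \<le> poly p (length x + i)" "\<forall>x i. g x i \<le> poly q (length x + i)"
  then show "\<exists>p :: nat poly. \<forall>x i. f x i + g x i \<le> poly p (length x + i)"
    by (intro exI[of _ "p + q"]) (simp add: add_mono)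
qed

lemma pbounded_mult: "pbounded f \<Longrightarrow> pbounded g \<Longrightarrow> pbounded (\<lambda>x i. f x i * g x i)"
  unfolding pbounded_def
proof (elim exE)
  fix p q :: "nat poly"
  assume "\<forall>x i. f x i \<le> poly p (length x + i)" "\<forall>x i. g x i \<le> poly q (length x + i)"
  then show "\<exists>p :: nat poly. \<forall>x i. f x i * g x i \<le> poly p (length x + i)"
    by (intro exI[of _ "p * q"]) (simp add: mult_mono)
qed

lemmas pbounded_intros = pbounded_const pbounded_len pbounded_idx pbounded_add pbounded_mult

lemma poly_nat_mono: "a \<le> b \<Longrightarrow> poly p a \<le> poly p b" for p :: "nat poly"
  by (induction p) (auto intro!: add_mono mult_mono)

lemma pbounded_aval: "pbounded (aval e)"
proof (induction e)
  case (Symb a)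
  show ?case
    by (rule pbounded_mono[OF pbounded_const[of 2]]) (simp add: input_code_def)
next
  case (Sub a b)
  show ?case
    by (rule pbounded_mono[OF Sub.IH(1)]) simp
next
  case (DivS a b)
  show ?case
    by (rule pbounded_mono[OF DivS.IH(1)]) (simp add: div_le_dividend)
qed (auto simp: fun_eq_iff intro: pbounded_mono[OF pbounded_const] pbounded_mono[OF pbounded_len]
    pbounded_mono[OF pbounded_idx] pbounded_mono[OF pbounded_add] pbounded_mono[OF pbounded_mult])

definition evaluates :: "aexp \<Rightarrow> (bool list \<Rightarrow> nat \<Rightarrow> nat) \<Rightarrow> bool" where
  "evaluates e T \<longleftrightarrow> (\<forall>x i r g y. r \<ge> 2 \<longrightarrow> g 0 = length x \<longrightarrow> g 1 = i \<longrightarrow> (\<forall>q \<ge> r. g q = 0) \<longrightarrow>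
     runs x (comp e r) (0, g, y) (T x i) (0, g(r := aval e x i), y))"

lemma evaluatesD:
  assumes "evaluates e T" "r \<ge> 2" "g 0 = length x" "g 1 = i" "\<And>q. q \<ge> r \<Longrightarrow> g q = 0"
    and "s' = (0, g(r := aval e x i), y)"
  shows "runs x (comp e r) (0, g, y) (T x i) s'"
  using assms unfolding evaluates_def by blast

text \<open>Subcalls work on registers above those in use, so earlier results survive; the loops
  that combine the results take time polynomial in the values of the subexpressions, which
  \<open>pbounded_aval\<close> controls.\<close>

lemma comp_evaluates: "\<exists>T. pbounded T \<and> evaluates e T"
proof (induction e)
  case (Const n)
  have "evaluates (Const n) (\<lambda>x i. 2 * n + 1)"
    unfolding evaluates_def by (auto intro!: runs_mono[OF runs_incs] simp del: One_nat_def)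
  then show ?case
    using pbounded_const by blast
next
  case Len
  have "evaluates Len (\<lambda>x i. 10 * length x + 3)"
    unfolding evaluates_def by (auto intro!: runs_mono[OF runs_copy] simp del: One_nat_def)
  then show ?case
    by (intro exI conjI) (auto intro!: pbounded_intros)
next
  case Idx
  have "evaluates Idx (\<lambda>x i. 10 * i + 3)"
    unfolding evaluates_def by (auto intro!: runs_mono[OF runs_copy])
  then show ?case
    by (intro exI conjI) (auto intro!: pbounded_intros)
next
  case (Symb a)
  then obtain T where T: "pbounded T" "evaluates a T"
    by blast
  have "evaluates (Symb a) (\<lambda>x i. Suc (T x i + (10 * aval a x i + 9)))"
    unfolding evaluates_def comp.simps
  proof (intro allI impI)
    fix x :: "bool list" and i r and g :: "nat \<Rightarrow> nat" and y
    assume g: "2 \<le> r" "g 0 = length x" "g 1 = i" "\<forall>q\<ge>r. g q = 0"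
    have 1: "runs x (comp a r) (0, g, y) (T x i) (0, g(r := aval a x i), y)"
      by (rule evaluatesD[OF T(2)]) (use g in auto)
    have 2: "runs x (lookup r) (0, g(r := aval a x i), y) (10 * aval a x i + 9)
        (0, g(r := aval (Symb a) x i), y)"
      by (rule runs_mono[OF runs_lookup]) (use g in auto)
    show "runs x (Seq (comp a r) (lookup r)) (0, g, y) (Suc (T x i + (10 * aval a x i + 9)))
        (0, g(r := aval (Symb a) x i), y)"
      by (rule runs_Seq[OF 1 2])
  qed
  moreover have "pbounded (\<lambda>x i. Suc (T x i + (10 * aval a x i + 9)))"
    unfolding Suc_eq_plus1 by (intro pbounded_intros T pbounded_aval)
  ultimately show ?case
    by blast
next
  case (Add a b)
  then obtain S T where T: "pbounded S" "evaluates a S" "pbounded T" "evaluates b T"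
    by blast
  have "evaluates (Add a b) (\<lambda>x i. Suc (S x i + Suc (T x i + (4 * aval b x i + 1))))"
    unfolding evaluates_def comp.simps
  proof (intro allI impI)
    fix x :: "bool list" and i r and g :: "nat \<Rightarrow> nat" and y
    assume g: "2 \<le> r" "g 0 = length x" "g 1 = i" "\<forall>q\<ge>r. g q = 0"
    have 1: "runs x (comp a r) (0, g, y) (S x i) (0, g(r := aval a x i), y)"
      by (rule evaluatesD[OF T(2)]) (use g in auto)
    have 2: "runs x (comp b (r + 1)) (0, g(r := aval a x i), y) (T x i) (0, g(r := aval a x i, r + 1 := aval b x i), y)"
      by (rule evaluatesD[OF T(4)]) (use g in auto)
    have 3: "runs x (transfer (r + 1) r) (0, g(r := aval a x i, r + 1 := aval b x i), y) (4 * aval b x i + 1)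
        (0, g(r := aval (Add a b) x i), y)"
      by (rule runs_mono[OF runs_transfer]) (use g in \<open>auto simp: fun_eq_iff\<close>)
    show "runs x (Seq (comp a r) (Seq (comp b (r + 1)) (transfer (r + 1) r))) (0, g, y)
        (Suc (S x i + Suc (T x i + (4 * aval b x i + 1)))) (0, g(r := aval (Add a b) x i), y)"
      by (rule runs_Seq[OF 1 runs_Seq[OF 2 3]])
  qed
  moreover have "pbounded (\<lambda>x i. Suc (S x i + Suc (T x i + (4 * aval b x i + 1))))"
    unfolding Suc_eq_plus1 by (intro pbounded_intros T pbounded_aval)
  ultimately show ?case
    by blast
next
  case (Sub a b)
  then obtain S T where T: "pbounded S" "evaluates a S" "pbounded T" "evaluates b T"
    by blast
  have "evaluates (Sub a b) (\<lambda>x i. Suc (S x i + Suc (T x i + (4 * aval b x i + 1))))"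
    unfolding evaluates_def comp.simps
  proof (intro allI impI)
    fix x :: "bool list" and i r and g :: "nat \<Rightarrow> nat" and y
    assume g: "2 \<le> r" "g 0 = length x" "g 1 = i" "\<forall>q\<ge>r. g q = 0"
    have 1: "runs x (comp a r) (0, g, y) (S x i) (0, g(r := aval a x i), y)"
      by (rule evaluatesD[OF T(2)]) (use g in auto)
    have 2: "runs x (comp b (r + 1)) (0, g(r := aval a x i), y) (T x i) (0, g(r := aval a x i, r + 1 := aval b x i), y)"
      by (rule evaluatesD[OF T(4)]) (use g in auto)
    have 3: "runs x (sub_loop r) (0, g(r := aval a x i, r + 1 := aval b x i), y) (4 * aval b x i + 1)
        (0, g(r := aval (Sub a b) x i), y)"
      by (rule runs_mono[OF runs_sub_loop]) (use g in \<open>auto simp: fun_eq_iff\<close>)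
    show "runs x (Seq (comp a r) (Seq (comp b (r + 1)) (sub_loop r))) (0, g, y)
        (Suc (S x i + Suc (T x i + (4 * aval b x i + 1)))) (0, g(r := aval (Sub a b) x i), y)"
      by (rule runs_Seq[OF 1 runs_Seq[OF 2 3]])
  qed
  moreover have "pbounded (\<lambda>x i. Suc (S x i + Suc (T x i + (4 * aval b x i + 1))))"
    unfolding Suc_eq_plus1 by (intro pbounded_intros T pbounded_aval)
  ultimately show ?case
    by blast
next
  case (Mul a b)
  then obtain S T where T: "pbounded S" "evaluates a S" "pbounded T" "evaluates b T"
    by blast
  let ?U = "\<lambda>x i. aval a x i * (10 * aval b x i + 6) + 2 * aval b x i + 3"
  have "evaluates (Mul a b) (\<lambda>x i. Suc (S x i + Suc (T x i + ?U x i)))"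
    unfolding evaluates_def comp.simps
  proof (intro allI impI)
    fix x :: "bool list" and i r and g :: "nat \<Rightarrow> nat" and y
    assume g: "2 \<le> r" "g 0 = length x" "g 1 = i" "\<forall>q\<ge>r. g q = 0"
    have 1: "runs x (comp a (r + 1)) (0, g, y) (S x i) (0, g(r + 1 := aval a x i), y)"
      by (rule evaluatesD[OF T(2)]) (use g in auto)
    have 2: "runs x (comp b (r + 2)) (0, g(r + 1 := aval a x i), y) (T x i)
        (0, g(r + 1 := aval a x i, r + 2 := aval b x i), y)"
      by (rule evaluatesD[OF T(4)]) (use g in auto)
    have 3: "runs x (mul_loop r) (0, g(r + 1 := aval a x i, r + 2 := aval b x i), y) (?U x i)
        (0, g(r := aval (Mul a b) x i), y)"
      by (rule runs_mul_loop) (use g in \<open>auto simp: fun_eq_iff\<close>)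
    show "runs x (Seq (comp a (r + 1)) (Seq (comp b (r + 2)) (mul_loop r))) (0, g, y)
        (Suc (S x i + Suc (T x i + ?U x i))) (0, g(r := aval (Mul a b) x i), y)"
      by (rule runs_Seq[OF 1 runs_Seq[OF 2 3]])
  qed
  moreover have "pbounded (\<lambda>x i. Suc (S x i + Suc (T x i + ?U x i)))"
    unfolding Suc_eq_plus1 by (intro pbounded_intros T pbounded_aval)
  ultimately show ?case
    by blast
next
  case (DivS a b)
  then obtain S T where T: "pbounded S" "evaluates a S" "pbounded T" "evaluates b T"
    by blast
  let ?U = "\<lambda>x i. aval a x i * (10 * aval b x i + 22) + 14 * aval b x i + 26"
  have "evaluates (DivS a b) (\<lambda>x i. Suc (S x i + Suc (T x i + ?U x i)))"
    unfolding evaluates_def comp.simps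
  proof (intro allI impI)
    fix x :: "bool list" and i r and g :: "nat \<Rightarrow> nat" and y
    assume g: "2 \<le> r" "g 0 = length x" "g 1 = i" "\<forall>q\<ge>r. g q = 0"
    have 1: "runs x (comp a (r + 1)) (0, g, y) (S x i) (0, g(r + 1 := aval a x i), y)"
      by (rule evaluatesD[OF T(2)]) (use g in auto)
    have 2: "runs x (comp b (r + 2)) (0, g(r + 1 := aval a x i), y) (T x i)
        (0, g(r + 1 := aval a x i, r + 2 := aval b x i), y)"
      by (rule evaluatesD[OF T(4)]) (use g in auto)
    have 3: "runs x (div_loop r) (0, g(r + 1 := aval a x i, r + 2 := aval b x i), y) (?U x i)
        (0, g(r := aval (DivS a b) x i), y)"
      by (rule runs_div_loop) (use g in \<open>auto simp: fun_eq_iff\<close>)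
    show "runs x (Seq (comp a (r + 1)) (Seq (comp b (r + 2)) (div_loop r))) (0, g, y)
        (Suc (S x i + Suc (T x i + ?U x i))) (0, g(r := aval (DivS a b) x i), y)"
      by (rule runs_Seq[OF 1 runs_Seq[OF 2 3]])
  qed
  moreover have "pbounded (\<lambda>x i. Suc (S x i + Suc (T x i + ?U x i)))"
    unfolding Suc_eq_plus1 by (intro pbounded_intros T pbounded_aval)
  ultimately show ?case
    by blast
qed

section \<open>Printing a word bit by bit\<close>

definition len_prog :: com where
  "len_prog = Seq (While Nonblank (Seq (Inc 0) (Seq (Inc 2) InpR))) (lookup_back 2)"

text \<open>Register 2 keeps a second count of the length, consumed on the way back to cell
  0.\<close>

lemma runs_len_prog:
  "runs x len_prog (0, \<lambda>_. 0, []) (10 * length x + 3) (0, (\<lambda>_. 0)(0 := length x), [])"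
proof -
  let ?f = "\<lambda>j. (int j, (\<lambda>_. 0)(0 := j, 2 := j), [])"
  have 1: "runs x (While Nonblank (Seq (Inc 0) (Seq (Inc 2) InpR))) (0, \<lambda>_. 0, [])
      (length x * Suc 5 + 1) (?f (length x))"
  proof (rule runs_While[where f = ?f])
    fix j assume "j < length x"
    have "runs x (Seq (Inc 0) (Seq (Inc 2) InpR)) (?f j) (Suc (1 + Suc (1 + 1))) (?f (Suc j))"
      by (rule runs_Seq[OF runs_Inc[OF refl] runs_Seq[OF runs_Inc[OF refl] runs_InpR]])
        (auto simp: fun_eq_iff)
    then show "runs x (Seq (Inc 0) (Seq (Inc 2) InpR)) (?f j) 5 (?f (Suc j))"
      by (simp add: eval_nat_numeral)
  qed (auto simp: fun_eq_iff word_tape_def)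
  let ?h = "\<lambda>j. (int (length x - j), (\<lambda>_. 0)(0 := length x, 2 := length x - j), [])"
  have 2: "runs x (lookup_back 2) (?f (length x)) (length x * Suc 3 + 1) (0, (\<lambda>_. 0)(0 := length x), [])"
    unfolding lookup_back_def
  proof (rule runs_While[where f = ?h])
    fix j assume "j < length x"
    have "runs x (Seq (Dec 2) InpL) (?h j) (Suc (1 + 1)) (?h (Suc j))"
      by (rule runs_Seq[OF runs_Dec[OF refl] runs_InpL]) (use \<open>j < length x\<close> in \<open>auto simp: fun_eq_iff\<close>)
    then show "runs x (Seq (Dec 2) InpL) (?h j) 3 (?h (Suc j))"
      by (simp add: eval_nat_numeral)
  qed (auto simp: fun_eq_iff)
  show ?thesis
    unfolding len_prog_def by (rule runs_mono[OF runs_Seq[OF 1 2]]) simp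
qed

definition out_body :: "aexp \<Rightarrow> com" where
  "out_body F = Seq (comp F 3) (Seq (If (Pos 3) (Seq (Out True) (zero 3)) (Out False)) (Seq (Inc 1) (Dec 2)))"

lemma runs_out_body:
  assumes T: "evaluates F T" and "j < G"
    and f: "\<And>j. f j = (0, (\<lambda>_. 0)(0 := length x, 1 := j, 2 := G - j), map (\<lambda>i. aval F x i \<noteq> 0) [0..<j])"
  shows "runs x (out_body F) (f j) (T x j + 2 * aval F x j + 9) (f (Suc j))"
proof -
  let ?g = "(\<lambda>_. 0)(0 := length x, 1 := j, 2 := G - j) :: nat \<Rightarrow> nat"
  let ?y = "map (\<lambda>i. aval F x i \<noteq> 0) [0..<j]"
  have 1: "runs x (comp F 3) (f j) (T x j) (0, ?g(3 := aval F x j), ?y)"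
    unfolding f by (rule evaluatesD[OF T]) auto
  have 2: "runs x (If (Pos 3) (Seq (Out True) (zero 3)) (Out False)) (0, ?g(3 := aval F x j), ?y)
     (Suc (2 * aval F x j + 3)) (0, ?g, ?y @ [aval F x j \<noteq> 0])"
  proof (intro runs_If)
    assume "sat x (Pos 3) (0, ?g(3 := aval F x j), ?y)"
    then have "runs x (Seq (Out True) (zero 3)) (0, ?g(3 := aval F x j), ?y)
       (Suc (1 + (2 * (?g(3 := aval F x j)) 3 + 1))) (0, ?g, ?y @ [aval F x j \<noteq> 0])"
      by (intro runs_Seq[OF runs_Out[OF refl] runs_zero]) (auto simp: fun_eq_iff)
    then show "runs x (Seq (Out True) (zero 3)) (0, ?g(3 := aval F x j), ?y)
       (2 * aval F x j + 3) (0, ?g, ?y @ [aval F x j \<noteq> 0])"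
      by (rule runs_mono) simp
  next
    assume "\<not> sat x (Pos 3) (0, ?g(3 := aval F x j), ?y)"
    then show "runs x (Out False) (0, ?g(3 := aval F x j), ?y)
       (2 * aval F x j + 3) (0, ?g, ?y @ [aval F x j \<noteq> 0])"
      by (intro runs_mono[OF runs_Out]) (auto simp: fun_eq_iff)
  qed
  have 3: "runs x (Seq (Inc 1) (Dec 2)) (0, ?g, ?y @ [aval F x j \<noteq> 0]) (Suc (1 + 1)) (f (Suc j))"
    unfolding f by (rule runs_Seq[OF runs_Inc[OF refl] runs_Dec]) (use \<open>j < G\<close> in \<open>auto simp: fun_eq_iff\<close>)
  show ?thesis
    unfolding out_body_def by (rule runs_mono[OF runs_Seq[OF 1 runs_Seq[OF 2 3]]]) simp
qed

theorem aexp_polytime_computable: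
  "polytime_computable (\<lambda>x. map (\<lambda>i. aval F x i \<noteq> 0) [0..<aval G x 0])"
proof -
  obtain S where S: "pbounded S" "evaluates G S"
    using comp_evaluates by blast
  obtain T where T: "pbounded T" "evaluates F T"
    using comp_evaluates by blast
  obtain g :: "nat poly" where g: "\<And>x. aval G x 0 \<le> poly g (length x)"
    using pbounded_aval[of G] unfolding pbounded_def by (metis add_0_right)
  obtain s :: "nat poly" where s: "\<And>x. S x 0 \<le> poly s (length x)"
    using S(1) unfolding pbounded_def by (metis add_0_right)
  have "pbounded (\<lambda>x i. T x i + 2 * aval F x i + 9)"
    by (intro pbounded_intros T pbounded_aval)
  then obtain t :: "nat poly" where t: "\<And>x i. T x i + 2 * aval F x i + 9 \<le> poly t (length x + i)"
    unfolding pbounded_def by blast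
  let ?P = "[:5, 10:] + s + (g * (1 + pcompose t ([:0, 1:] + g)) + 1)"
  let ?c = "Seq len_prog (Seq (comp G 2) (While (Pos 2) (out_body F)))"
  show ?thesis
  proof (rule exec_polytime[of ?P ?c])
    fix x
    let ?f = "\<lambda>j. (0, (\<lambda>_. 0)(0 := length x, 1 := j, 2 := aval G x 0 - j), map (\<lambda>i. aval F x i \<noteq> 0) [0..<j])"
    \<comment> \<open>All indices \<open>j\<close> stay below \<open>aval G x 0\<close>, hence below
      \<open>poly g (length x)\<close>; by monotonicity of \<open>t\<close> this is one bound for
      every round.\<close>
    let ?U = "poly t (length x + poly g (length x))"
    have 2: "runs x (comp G 2) (0, (\<lambda>_. 0)(0 := length x), []) (S x 0) (?f 0)"
      by (rule evaluatesD[OF S(2)]) (auto simp: fun_eq_iff)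
    have 3: "runs x (While (Pos 2) (out_body F)) (?f 0) (aval G x 0 * Suc ?U + 1) (?f (aval G x 0))"
    proof (rule runs_While[where f = ?f])
      fix j assume j: "j < aval G x 0"
      have "T x j + 2 * aval F x j + 9 \<le> poly t (length x + j)"
        by (rule t)
      also have "\<dots> \<le> ?U"
        using j g[of x] by (intro poly_nat_mono) simp
      finally show "runs x (out_body F) (?f j) ?U (?f (Suc j))"
        by (rule runs_mono[OF runs_out_body[OF T(2) j refl]])
    qed auto
    have "runs x ?c (0, \<lambda>_. 0, []) (Suc (10 * length x + 3 + Suc (S x 0 + (aval G x 0 * Suc ?U + 1)))) (?f (aval G x 0))"
      by (rule runs_Seq[OF runs_len_prog runs_Seq[OF 2 3]])
    moreover have "Suc (10 * length x + 3 + Suc (S x 0 + (aval G x 0 * Suc ?U + 1))) \<le> poly ?P (length x)"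
    proof -
      have "aval G x 0 * Suc ?U \<le> poly g (length x) * Suc ?U"
        using g by (intro mult_mono) auto
      then show ?thesis
        using s[of x] by (simp add: poly_pcompose)
    qed
    ultimately show "\<exists>n\<le>poly ?P (length x). \<exists>p g. exec x ?c (0, \<lambda>_. 0, []) n
        (p, g, map (\<lambda>i. aval F x i \<noteq> 0) [0..<aval G x 0])"
      unfolding runs_def by (meson order_trans)
  qed
qed

section \<open>Tableaux\<close>

text \<open>\<open>None\<close> stands for idling in the accepting state.\<close>
type_synonym action = "transition option"

fun src :: "nat \<Rightarrow> action \<Rightarrow> nat" where
  "src acc None = acc"
| "src acc (Some (q, rs, q', ws, ds)) = q"

fun tgt :: "nat \<Rightarrow> action \<Rightarrow> nat" where
  "tgt acc None = acc"
| "tgt acc (Some (q, rs, q', ws, ds)) = q'"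

fun rd :: "transition \<Rightarrow> nat \<Rightarrow> symbol" where
  "rd (q, rs, q', ws, ds) c = rs ! c"

fun wr :: "transition \<Rightarrow> nat \<Rightarrow> symbol" where
  "wr (q, rs, q', ws, ds) c = ws ! c"

fun mv :: "transition \<Rightarrow> nat \<Rightarrow> int" where
  "mv (q, rs, q', ws, ds) c = offset (ds ! c)"

text \<open>\<open>N\<close> is the number of rows as well as of columns. Heads start in column
  \<open>P\<close> and runs have fewer than \<open>P\<close> steps, so the columns 0 to
  \<open>2 * P + 1\<close> contain every cell that a head reaches.\<close>

locale tableau =
  fixes M :: tm and x :: "bool list" and P :: nat and N :: nat and opts :: "(symbol \<times> bool \<times> action) list"
  assumes wf: "wf_tm M"
    and bound: "\<And>i c. (initial M x, c) \<in> step M ^^ i \<Longrightarrow> i < P"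
    and N: "N = 2 * P + 2"
    and opts: "{Blank, Bit True, Bit False} \<union> (\<Union>(q, rs, q', ws, ds) \<in> tm_delta M. set ws) \<subseteq> fst ` set opts"
      "set opts = fst ` set opts \<times> UNIV \<times> insert None (Some ` tm_delta M)"
begin

definition T :: nat where "T = tm_tapes M"
definition K :: nat where "K = length opts"
definition Q :: nat where "Q = T * K"

definition sy :: "nat \<Rightarrow> symbol" where "sy e = fst (opts ! (e mod K))"
definition hd :: "nat \<Rightarrow> bool" where "hd e = fst (snd (opts ! (e mod K)))"
definition ac :: "nat \<Rightarrow> action" where "ac e = snd (snd (opts ! (e mod K)))"
definition tp :: "nat \<Rightarrow> nat" where "tp e = e div K"

definition init_sym :: "nat \<Rightarrow> nat \<Rightarrow> symbol" where
  "init_sym c j = (if c = 0 \<and> P \<le> j \<and> j - P < length x then Bit (x ! (j - P)) else Blank)"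

text \<open>
  Time \<open>t\<close>, shifted position \<open>j\<close> (the heads start at \<open>P\<close>), and \<open>e\<close> for tape and option. After acceptance
  the tape contents are not constrained.
\<close>
definition bad :: "nat \<Rightarrow> nat \<Rightarrow> nat \<Rightarrow> bool" where
  "bad t j e \<longleftrightarrow>
     t = 0 \<and> (src (tm_accept M) (ac e) \<noteq> tm_start M \<or> hd e \<noteq> (j = P) \<or> sy e \<noteq> init_sym (tp e) j) \<or>
     Suc t = N \<and> ac e \<noteq> None \<or>
     (\<exists>tr. ac e = Some tr \<and> hd e \<and> sy e \<noteq> rd tr (tp e))"

text \<open>Unary conditions enter through \<open>bad\<close>, which makes an option clash with
  itself. Within a row at most one head per tape is demanded; that there is one follows from the
  initial row and the last clause. The shared action of a row tells each cell how the head moves,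
  which is why pairs of cells suffice.\<close>

definition clash :: "nat \<Rightarrow> nat \<Rightarrow> nat \<Rightarrow> nat \<Rightarrow> nat \<Rightarrow> nat \<Rightarrow> bool" where
  "clash t j e t' j' e' \<longleftrightarrow> bad t j e \<or>
     t' = t \<and> (ac e \<noteq> ac e' \<or> tp e = tp e' \<and> hd e \<and> hd e' \<and> j \<noteq> j') \<or>
     t' = Suc t \<and> (src (tm_accept M) (ac e') \<noteq> tgt (tm_accept M) (ac e) \<or>
       (\<exists>tr. ac e = Some tr \<and> tp e = tp e' \<and>
          (j = j' \<and> sy e' \<noteq> (if hd e then wr tr (tp e) else sy e) \<or>
           hd e \<and> int j' = int j + mv tr (tp e) \<and> \<not> hd e')))"

definition conflict :: "nat \<Rightarrow> nat \<Rightarrow> bool" where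
  "conflict v u \<longleftrightarrow> clash (v div Q div N) (v div Q mod N) (v mod Q) (u div Q div N) (u div Q mod N) (u mod Q)"

definition cell :: "nat \<Rightarrow> nat \<Rightarrow> nat \<Rightarrow> nat" where
  "cell t j e = (t * N + j) * Q + e"

text \<open>\<open>K\<close> consecutive numbers form the group of one time, position and tape.
  Several options of a group may lie in \<open>C\<close>; any of them then serves.\<close>

definition selects :: "nat set \<Rightarrow> bool" where
  "selects C \<longleftrightarrow> (\<forall>v \<in> C. v < N * N * Q) \<and> (\<forall>w < N * N * Q div K. \<exists>v \<in> C. v div K = w) \<and>
     (\<forall>v \<in> C. \<forall>u \<in> C. \<not> conflict v u)"

lemma T_pos: "0 < T"
  using wf by (simp add: wf_tm_def T_def)

lemma K_pos: "0 < K"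
  using opts(1) by (auto simp: K_def)

lemma N_pos: "0 < N"
  by (simp add: N)

lemma cell_decode:
  assumes "j < N" "e < Q"
  shows "cell t j e div Q div N = t" "cell t j e div Q mod N = j" "cell t j e mod Q = e"
proof -
  have "cell t j e div Q = t * N + j" "cell t j e mod Q = e"
    using assms(2) by (simp_all add: cell_def)
  then show "cell t j e div Q div N = t" "cell t j e div Q mod N = j" "cell t j e mod Q = e"
    using assms(1) by simp_all
qed

lemma conflict_cell:
  "j < N \<Longrightarrow> e < Q \<Longrightarrow> j' < N \<Longrightarrow> e' < Q \<Longrightarrow>
     conflict (cell t j e) (cell t' j' e') \<longleftrightarrow> clash t j e t' j' e'"
  by (simp add: conflict_def cell_decode)

lemma block_less: "a < A \<Longrightarrow> b < B \<Longrightarrow> a * B + b < A * B" for a b A B :: nat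
proof -
  assume "a < A" "b < B"
  then have "a * B + b < Suc a * B"
    by simp
  also have "\<dots> \<le> A * B"
    using \<open>a < A\<close> by (intro mult_right_mono) auto
  finally show ?thesis .
qed

lemma cell_group:
  assumes "c < T" "i < K"
  shows "c * K + i < Q" "cell t j (c * K + i) = ((t * N + j) * T + c) * K + i"
  using assms block_less[of c T i K] by (simp_all add: Q_def cell_def algebra_simps)

lemma ac_opts: "ac e = Some tr \<Longrightarrow> tr \<in> tm_delta M"
proof -
  assume "ac e = Some tr"
  moreover have "opts ! (e mod K) \<in> set opts"
    using K_pos by (simp add: K_def)
  then have "opts ! (e mod K) \<in> fst ` set opts \<times> UNIV \<times> insert None (Some ` tm_delta M)"
    by (subst (asm) opts(2))
  then have "ac e \<in> insert None (Some ` tm_delta M)"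
    unfolding ac_def by (simp only: mem_Times_iff)
  ultimately show ?thesis
    by auto
qed

text \<open>One option per group yields actions \<open>a\<close>, contents \<open>S\<close> and
  heads \<open>H\<close>; by induction on the row they describe a genuine partial run. The
  hypothesis \<open>bound\<close>, applied to this partial run, keeps the heads inside the
  columns.\<close>

lemma selects_accepts:
  assumes "selects C"
  shows "\<exists>ts. (initial M x, (tm_accept M, ts)) \<in> (step M)\<^sup>*"
proof -
  have "\<exists>e. e < Q \<and> tp e = c \<and> cell t j e \<in> C" if "t < N" "j < N" "c < T" for t j c
  proof -
    let ?w = "(t * N + j) * T + c"
    have "?w < N * N * T"
      using block_less[OF block_less[OF that(1,2)] that(3)] .
    moreover have "N * N * Q div K = N * N * T"
      using K_pos by (simp add: Q_def)
    ultimately obtain v where v: "v \<in> C" "v div K = ?w"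
      using assms unfolding selects_def by metis
    have i: "v mod K < K"
      using K_pos by simp
    have "v = ?w * K + v mod K"
      using v(2) by (metis div_mod_decomp)
    then have "v = cell t j (c * K + v mod K)"
      using cell_group(2)[OF that(3) i] by simp
    moreover have "tp (c * K + v mod K) = c"
      using i by (simp add: tp_def)
    ultimately show ?thesis
      using v(1) cell_group(1)[OF that(3) i] by metis
  qed
  then obtain e where e: "\<And>t j c. t < N \<Longrightarrow> j < N \<Longrightarrow> c < T \<Longrightarrow> e t j c < Q \<and> tp (e t j c) = c \<and> cell t j (e t j c) \<in> C"
    by metis
  have no: "\<not> clash t j (e t j c) t' j' (e t' j' c')"
    if "t < N" "j < N" "c < T" "t' < N" "j' < N" "c' < T" for t j c t' j' c'
  proof -
    have "\<not> conflict (cell t j (e t j c)) (cell t' j' (e t' j' c'))"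
      using assms e[OF that(1-3)] e[OF that(4-6)] unfolding selects_def by blast
    then show ?thesis
      using that e[OF that(1-3)] e[OF that(4-6)] by (simp add: conflict_cell)
  qed
  define a where "a t = ac (e t 0 0)" for t
  define S where "S t j c = sy (e t j c)" for t j c
  define H where "H t j c = hd (e t j c)" for t j c
  have F1: "ac (e t j c) = a t" if "t < N" "j < N" "c < T" for t j c
    using no[OF that that(1) N_pos T_pos] by (simp add: clash_def a_def del: split_paired_All split_paired_Ex)
  have tp: "tp (e t j c) = c" if "t < N" "j < N" "c < T" for t j c
    using e[OF that] by simp
  have F2: "j = j'" if "t < N" "j < N" "j' < N" "c < T" "H t j c" "H t j' c" for t j j' c
    using no[OF that(1,2,4) that(1,3,4)] that tp by (simp add: clash_def H_def)
  have F3: "src (tm_accept M) (a 0) = tm_start M" "H 0 j c \<longleftrightarrow> j = P" "S 0 j c = init_sym c j" if "j < N" "c < T" for j c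
    using no[OF N_pos that N_pos that] F1[OF N_pos that] tp[OF N_pos that]
    by (auto simp: clash_def bad_def H_def S_def simp del: split_paired_All split_paired_Ex)
  \<comment> \<open>The last row forces an idle action, whose source is the accepting state.\<close>
  have "\<not> bad (N - 1) 0 (e (N - 1) 0 0)"
    using no[of "N - 1" 0 0 "N - 1" 0 0] N_pos T_pos unfolding clash_def by simp
  then have F4: "a (N - 1) = None"
    using N_pos unfolding bad_def a_def by (metis Suc_pred')
  have F5: "S t j c = rd tr c" if "t < N" "j < N" "c < T" "a t = Some tr" "H t j c" for t j c tr
    using no[OF that(1-3) that(1-3)] F1[OF that(1-3)] tp[OF that(1-3)] that(4,5)
    by (simp add: clash_def bad_def H_def S_def del: split_paired_All split_paired_Ex)
  have F6: "src (tm_accept M) (a (Suc t)) = tgt (tm_accept M) (a t)" if "Suc t < N" for t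
    using no[of t 0 0 "Suc t" 0 0] that N_pos T_pos by (simp add: clash_def a_def del: split_paired_All split_paired_Ex)
  have F7: "S (Suc t) j c = (if H t j c then wr tr c else S t j c)"
    if "Suc t < N" "j < N" "c < T" "a t = Some tr" for t j c tr
    using no[of t j c "Suc t" j c] F1[of t j c] tp[of t j c] tp[of "Suc t" j c] that
    by (simp add: clash_def H_def S_def del: split_paired_All split_paired_Ex)
  have F8: "H (Suc t) j' c" if "Suc t < N" "j < N" "j' < N" "c < T" "a t = Some tr" "H t j c" "int j' = int j + mv tr c"
    for t j j' c tr
    using no[of t j c "Suc t" j' c] F1[of t j c] tp[of t j c] tp[of "Suc t" j' c] that
    by (simp add: clash_def H_def S_def del: split_paired_All split_paired_Ex)
  \<comment> \<open>Contents are constrained only up to the first idle row, so the simulation stops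
    there.\<close>
  define t' where "t' = (LEAST t. a t = None)"
  have t': "a t' = None" "t' < N"
    using LeastI[of "\<lambda>t. a t = None", OF F4] Least_le[of "\<lambda>t. a t = None", OF F4] N_pos
    by (auto simp: t'_def)
  have before: "t < t' \<Longrightarrow> a t \<noteq> None" for t
    using not_less_Least[of t "\<lambda>t. a t = None"] by (auto simp: t'_def)
  have "\<exists>ts. (initial M x, (src (tm_accept M) (a t), ts)) \<in> step M ^^ t \<and> length ts = T \<and>
     (\<forall>c < T. \<bar>fst (ts ! c)\<bar> \<le> int t \<and> (\<forall>j < N. (H t j c \<longleftrightarrow> int j = int P + fst (ts ! c)) \<and>
        S t j c = snd (ts ! c) (int j - int P)))" if "t \<le> t'" for t
    using that
  proof (induction t)
    case 0
    let ?ts = "word_tape x # replicate (T - 1) (word_tape [])"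
    have "initial M x = (tm_start M, ?ts)"
      by (simp add: initial_def T_def)
    moreover have "?ts ! c = word_tape (if c = 0 then x else [])" if "c < T" for c
      using that by (simp add: nth_Cons split: nat.split)
    moreover have "init_sym c j = snd (word_tape (if c = 0 then x else [])) (int j - int P)" for c j
      by (auto simp: init_sym_def word_tape_def nat_diff_distrib)
    moreover have "fst (word_tape z) = 0" for z
      by (simp add: word_tape_def)
    ultimately show ?case
      using F3 N_pos T_pos by (intro exI[of _ ?ts]) auto
  next
    case (Suc t)
    then obtain ts where ts: "(initial M x, (src (tm_accept M) (a t), ts)) \<in> step M ^^ t" "length ts = T"
      and cells: "\<And>c. c < T \<Longrightarrow> \<bar>fst (ts ! c)\<bar> \<le> int t"
        "\<And>c j. c < T \<Longrightarrow> j < N \<Longrightarrow> H t j c \<longleftrightarrow> int j = int P + fst (ts ! c)"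
        "\<And>c j. c < T \<Longrightarrow> j < N \<Longrightarrow> S t j c = snd (ts ! c) (int j - int P)"
      by auto
    have tN: "Suc t < N"
      using Suc.prems t' by simp
    have tP: "t < P"
      using bound[OF ts(1)] .
    obtain q rs q' ws ds where tr: "a t = Some (q, rs, q', ws, ds)"
      using before[of t] Suc.prems by (metis Suc_le_lessD option.exhaust prod_cases5)
    have delta: "(q, rs, q', ws, ds) \<in> tm_delta M"
      using ac_opts tr unfolding a_def by blast
    then have len: "length rs = T" "length ws = T" "length ds = T"
      using wf by (auto simp: wf_tm_def T_def)
    have head: "nat (int P + fst (ts ! c)) < N" "int (nat (int P + fst (ts ! c))) = int P + fst (ts ! c)" if "c < T" for c
      using cells(1)[OF that] tP N by auto
    have "map tape_read ts = rs"
    proof (rule nth_equalityI)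
      fix c assume "c < length (map tape_read ts)"
      then have c: "c < T"
        using ts(2) by simp
      let ?j = "nat (int P + fst (ts ! c))"
      have "H t ?j c"
        using cells(2)[OF c head(1)[OF c]] head(2)[OF c] by simp
      then have "S t ?j c = rs ! c"
        using F5[OF _ head(1)[OF c] c tr] tN by simp
      then have "snd (ts ! c) (fst (ts ! c)) = rs ! c"
        using cells(3)[OF c head(1)[OF c]] head(2)[OF c] by simp
      then show "map tape_read ts ! c = rs ! c"
        using c ts(2) by (cases "ts ! c") simp
    qed (use ts len in simp)
    let ?ts = "map2 tape_update (zip ws ds) ts"
    have "((q, ts), (q', ?ts)) \<in> step M"
      using delta \<open>map tape_read ts = rs\<close> unfolding step_def by blast
    then have r1: "(initial M x, (q', ?ts)) \<in> step M ^^ Suc t"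
      using ts(1) tr by auto
    have r2: "src (tm_accept M) (a (Suc t)) = q'"
      using F6[OF tN] tr by simp
    have r3: "length ?ts = T"
      using ts(2) len by simp
    have r4: "\<bar>fst (?ts ! c)\<bar> \<le> int (Suc t) \<and> (\<forall>j < N. (H (Suc t) j c \<longleftrightarrow> int j = int P + fst (?ts ! c)) \<and>
        S (Suc t) j c = snd (?ts ! c) (int j - int P))" if c: "c < T" for c
    proof -
      have upd: "fst (?ts ! c) = fst (ts ! c) + offset (ds ! c)" "snd (?ts ! c) = (snd (ts ! c))(fst (ts ! c) := ws ! c)"
        using c ts(2) len by (cases "ts ! c"; simp)+
      have off: "\<bar>offset (ds ! c)\<bar> \<le> 1"
        by (cases "ds ! c") auto
      then have b: "\<bar>fst (?ts ! c)\<bar> \<le> int (Suc t)"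
        using cells(1)[OF c] upd(1) by linarith
      let ?j = "nat (int P + fst (ts ! c))" and ?j' = "nat (int P + fst (?ts ! c))"
      have j': "?j' < N" "int ?j' = int P + fst (?ts ! c)"
        using b tP N by auto
      have "H t ?j c"
        using cells(2)[OF c head(1)[OF c]] head(2)[OF c] by simp
      then have H': "H (Suc t) ?j' c"
        using F8[OF tN head(1)[OF c] j'(1) c tr] j'(2) head(2)[OF c] upd(1) by simp
      have "H (Suc t) j c \<longleftrightarrow> int j = int P + fst (?ts ! c)" if "j < N" for j
      proof
        assume "H (Suc t) j c"
        then have "j = ?j'"
          using F2[OF tN that j'(1) c _ H'] by blast
        then show "int j = int P + fst (?ts ! c)"
          using j'(2) by simp
      next
        assume "int j = int P + fst (?ts ! c)"
        then have "j = ?j'"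
          by simp
        then show "H (Suc t) j c"
          using H' by simp
      qed
      moreover have "S (Suc t) j c = snd (?ts ! c) (int j - int P)" if "j < N" for j
        using F7[OF tN that c tr] cells(2,3)[OF c that] upd(2) by auto
      ultimately show ?thesis
        using b by blast
    qed
    show ?case
      unfolding r2 using r1 r3 r4 by (intro exI[of _ ?ts]) simp
  qed
  from this[of t'] obtain ts where "(initial M x, (tm_accept M, ts)) \<in> step M ^^ t'"
    using t'(1) by auto
  then show ?thesis
    using relpow_imp_rtrancl by blast
qed

text \<open>An accepting run is padded: after step \<open>n\<close> its last configuration is
  repeated with idle actions. It fits into the rows because \<open>n < P\<close>.\<close>

lemma accepts_selects:
  assumes "(initial M x, (tm_accept M, ts)) \<in> (step M)\<^sup>*"
  shows "\<exists>C. selects C"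
proof -
  let ?\<Gamma> = "fst ` set opts"
  obtain n where "(initial M x, (tm_accept M, ts)) \<in> step M ^^ n"
    using assms rtrancl_imp_relpow by blast
  then obtain f where f: "f 0 = initial M x" "f n = (tm_accept M, ts)" "\<And>i. i < n \<Longrightarrow> (f i, f (Suc i)) \<in> step M"
    unfolding relpow_fun_conv by blast
  have nP: "n < P"
    using bound \<open>(initial M x, (tm_accept M, ts)) \<in> step M ^^ n\<close> by blast
  have "\<exists>tr. tr \<in> tm_delta M \<and> (case tr of (q, rs, q', ws, ds) \<Rightarrow> fst (f i) = q \<and> map tape_read (snd (f i)) = rs \<and>
      f (Suc i) = (q', map2 tape_update (zip ws ds) (snd (f i))))" if "i < n" for i
    using f(3)[OF that] unfolding step_def by fastforce
  then obtain tr where tr: "\<And>i. i < n \<Longrightarrow> tr i \<in> tm_delta M \<and> (case tr i of (q, rs, q', ws, ds) \<Rightarrow> fst (f i) = q \<and>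
      map tape_read (snd (f i)) = rs \<and> f (Suc i) = (q', map2 tape_update (zip ws ds) (snd (f i))))"
    by metis
  define cf where "cf t = f (min t n)" for t
  define act where "act t = (if t < n then Some (tr t) else None)" for t
  define tape where "tape t c = snd (cf t) ! c" for t c
  \<comment> \<open>Options exist only for symbols of the finite alphabet, so all tape contents must
    be shown to stay in it.\<close>
  have inv: "length (snd (f i)) = T \<and> (\<forall>c < T. \<forall>j. snd (snd (f i) ! c) j \<in> ?\<Gamma>)" if "i \<le> n" for i
    using that
  proof (induction i)
    case 0
    have "snd (word_tape z) j \<in> {Blank, Bit True, Bit False}" for z j
      by (cases "z ! nat j") (auto simp: word_tape_def)
    then have "snd (word_tape z) j \<in> ?\<Gamma>" for z j
      using opts(1) by blast
    then show ?case
      using T_pos by (auto simp: f(1) initial_def T_def nth_Cons split: nat.split)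
  next
    case (Suc i)
    then have IH: "length (snd (f i)) = T" "\<And>c j. c < T \<Longrightarrow> snd (snd (f i) ! c) j \<in> ?\<Gamma>"
      by auto
    obtain q rs q' ws ds where t: "tr i = (q, rs, q', ws, ds)"
      by (metis prod_cases5)
    have d: "(q, rs, q', ws, ds) \<in> tm_delta M" "snd (f (Suc i)) = map2 tape_update (zip ws ds) (snd (f i))"
      using tr[of i] Suc.prems t by auto
    then have len: "length ws = T" "length ds = T"
      using wf by (auto simp: wf_tm_def T_def)
    have ws: "ws ! c \<in> ?\<Gamma>" if "c < T" for c
    proof -
      have "ws ! c \<in> set ws"
        using that len by simp
      then have "ws ! c \<in> (\<Union>(q, rs, q', ws, ds) \<in> tm_delta M. set ws)"
        by (intro UN_I[OF d(1)]) simp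
      then show ?thesis
        using opts(1) by blast
    qed
    have "snd (snd (f (Suc i)) ! c) j \<in> ?\<Gamma>" if "c < T" for c j
      using that IH len ws[OF that] IH(2)[OF that, of j] unfolding d(2) by (cases "snd (f i) ! c") auto
    then show ?case
      using IH(1) len d(2) by simp
  qed
  have symb: "snd (tape t c) j \<in> ?\<Gamma>" if "c < T" for t c j
    using inv[of "min t n"] that by (simp add: tape_def cf_def)
  have act: "act t \<in> insert None (Some ` tm_delta M)" for t
    using tr[of t] by (simp add: act_def)
  have "\<exists>i. i < K \<and> opts ! i = (snd (tape t c) (int j - int P), int j = int P + fst (tape t c), act t)"
    if "c < T" for t j c
  proof -
    have "(snd (tape t c) (int j - int P), int j = int P + fst (tape t c), act t) \<in> set opts"
      using opts(2) symb[OF that] act by blast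
    then show ?thesis
      by (simp add: in_set_conv_nth K_def)
  qed
  note ex_ix = this
  define ix where "ix t j c = (SOME i. i < K \<and>
      opts ! i = (snd (tape t c) (int j - int P), int j = int P + fst (tape t c), act t))" for t j c
  have ix: "ix t j c < K \<and> opts ! ix t j c =
      (snd (tape t c) (int j - int P), int j = int P + fst (tape t c), act t)" if "c < T" for t j c
    unfolding ix_def by (rule someI_ex[OF ex_ix[OF that]])
  define e where "e t j c = c * K + ix t j c" for t j c
  have e: "e t j c < Q" "tp (e t j c) = c" "sy (e t j c) = snd (tape t c) (int j - int P)"
    "hd (e t j c) \<longleftrightarrow> int j = int P + fst (tape t c)" "ac (e t j c) = act t" if "c < T" for t j c
    using ix[OF that, of t j] cell_group(1)[OF that, of "ix t j c"]
    by (simp_all add: e_def tp_def sy_def hd_def ac_def)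
  define C where "C = {cell t j (e t j c) | t j c. t < N \<and> j < N \<and> c < T}"
  have src_act: "src (tm_accept M) (act t) = fst (cf t)" for t
  proof (cases "t < n")
    case True
    then show ?thesis
      using tr[OF True] by (cases "tr t") (simp add: act_def cf_def)
  qed (simp add: act_def cf_def f(2) min_def)
  have tgt_act: "tgt (tm_accept M) (act t) = fst (cf (Suc t))" for t
  proof (cases "t < n")
    case True
    then show ?thesis
      using tr[OF True] by (cases "tr t") (simp add: act_def cf_def min_def)
  qed (simp add: act_def cf_def f(2) min_def)
  have reads: "snd (tape t c) (fst (tape t c)) = rd (tr t) c" if "t < n" "c < T" for t c
  proof -
    obtain q rs q' ws ds where t: "tr t = (q, rs, q', ws, ds)"
      by (metis prod_cases5)
    then have "map tape_read (snd (f t)) = rs"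
      using tr[OF that(1)] by simp
    moreover have "length (snd (f t)) = T"
      using inv[of t] that by simp
    ultimately have "rs ! c = tape_read (snd (f t) ! c)"
      using that(2) by auto
    then show ?thesis
      using that(1) t by (cases "snd (f t) ! c") (simp add: tape_def cf_def min_def)
  qed
  have writes: "tape (Suc t) c = (fst (tape t c) + mv (tr t) c, (snd (tape t c))(fst (tape t c) := wr (tr t) c))"
    if "t < n" "c < T" for t c
  proof -
    obtain q rs q' ws ds where t: "tr t = (q, rs, q', ws, ds)"
      by (metis prod_cases5)
    then have d: "(q, rs, q', ws, ds) \<in> tm_delta M" "snd (f (Suc t)) = map2 tape_update (zip ws ds) (snd (f t))"
      using tr[OF that(1)] by auto
    then have len: "length ws = T" "length ds = T"
      using wf by (auto simp: wf_tm_def T_def)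
    have "length (snd (f t)) = T"
      using inv[of t] that by simp
    then have "snd (f (Suc t)) ! c = tape_update (ws ! c, ds ! c) (snd (f t) ! c)"
      using that(2) len d(2) by simp
    then show ?thesis
      using that(1) t by (cases "snd (f t) ! c") (simp add: tape_def cf_def min_def Suc_le_eq)
  qed
  have not_bad: "\<not> bad t j (e t j c)" if "t < N" "j < N" "c < T" for t j c
  proof -
    have "tape 0 c = word_tape (if c = 0 then x else [])"
      using that(3) by (simp add: tape_def cf_def f(1) initial_def T_def nth_Cons split: nat.split)
    then have init: "snd (tape 0 c) (int j - int P) = init_sym c j" "fst (tape 0 c) = 0"
      by (auto simp: init_sym_def word_tape_def nat_diff_distrib)
    have start: "fst (cf 0) = tm_start M"
      by (simp add: cf_def f(1) initial_def)
    have last: "act t = None" if "Suc t = N"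
      using that N nP by (simp add: act_def)
    have "sy (e t j c) = rd tr' c" if "act t = Some tr'" "hd (e t j c)" for tr'
      using that reads[of t c] e[OF \<open>c < T\<close>] \<open>c < T\<close> by (auto simp: act_def split: if_splits)
    then show ?thesis
      using e[OF \<open>c < T\<close>] init start last src_act[of 0] unfolding bad_def by auto
  qed
  have not_clash: "\<not> clash t j (e t j c) t' j' (e t' j' c')"
    if "t < N" "j < N" "c < T" "t' < N" "j' < N" "c' < T" for t j c t' j' c'
  proof -
    have "\<not> (tp (e t j c) = tp (e t j' c') \<and> hd (e t j c) \<and> hd (e t j' c') \<and> j \<noteq> j')"
      using e[OF \<open>c < T\<close>] e[OF \<open>c' < T\<close>] by auto
    moreover have "sy (e (Suc t) j c) = (if hd (e t j c) then wr tr' c else sy (e t j c))"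
      if "act t = Some tr'" for tr'
      using that writes[of t c] e[OF \<open>c < T\<close>] \<open>c < T\<close> by (auto simp: act_def split: if_splits)
    moreover have "hd (e (Suc t) j' c)"
      if "act t = Some tr'" "hd (e t j c)" "int j' = int j + mv tr' c" for tr'
      using that writes[of t c] e[OF \<open>c < T\<close>] \<open>c < T\<close> by (auto simp: act_def split: if_splits)
    ultimately show ?thesis
      using not_bad[OF that(1-3)] e(2,5)[OF \<open>c < T\<close>] e(2,5)[OF \<open>c' < T\<close>] src_act[of "Suc t"] tgt_act[of t]
      unfolding clash_def by auto
  qed
  have "selects C"
    unfolding selects_def
  proof (intro conjI ballI allI impI)
    fix v assume "v \<in> C"
    then show "v < N * N * Q"
      using e(1) block_less by (auto simp: C_def cell_def)
  next
    fix w assume "w < N * N * Q div K"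
    then have w: "w < N * N * T"
      using K_pos by (simp add: Q_def)
    define t j c where "t = w div T div N" "j = w div T mod N" "c = w mod T"
    have "w div T < N * N"
      using w by (simp add: less_mult_imp_div_less)
    then have "t < N" "j < N" "c < T"
      using N_pos T_pos by (simp_all add: t_j_c_def less_mult_imp_div_less)
    moreover have "cell t j (e t j c) div K = w"
    proof -
      have "w = (t * N + j) * T + c"
        by (simp add: t_j_c_def)
      then show ?thesis
        using ix[OF \<open>c < T\<close>, of t j] cell_group(2)[OF \<open>c < T\<close>, of "ix t j c" t j] by (simp add: e_def)
    qed
    ultimately show "\<exists>v \<in> C. v div K = w"
      unfolding C_def by blast
  next
    fix v u assume "v \<in> C" "u \<in> C"
    then obtain t j c t' j' c' where vu: "v = cell t j (e t j c)" "t < N" "j < N" "c < T"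
      "u = cell t' j' (e t' j' c')" "t' < N" "j' < N" "c' < T"
      unfolding C_def by blast
    then show "\<not> conflict v u"
      using not_clash[OF vu(2-4) vu(6-8)] by (simp add: conflict_cell e(1))
  qed
  then show ?thesis
    by blast
qed

theorem selects_iff_accepts:
  "(\<exists>C. selects C) \<longleftrightarrow> (\<exists>ts. (initial M x, (tm_accept M, ts)) \<in> (step M)\<^sup>*)"
  using selects_accepts accepts_selects by blast

end

section \<open>Forcing colours by chains\<close>

text \<open>A closed walk contains a cycle, so the simple cycles of the definition may be traded for
  the transitive closure.\<close>

lemma acyclic_digraph_iff:
  assumes "wf_digraph G"
  shows "acyclic_digraph G \<longleftrightarrow> acyclic (arcs_ends G)"
proof -
  interpret wf_digraph G by fact
  have "(\<exists>p. cycle p) \<longleftrightarrow> (\<exists>u. (u, u) \<in> (arcs_ends G)\<^sup>+)"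
  proof
    assume "\<exists>p. cycle p"
    then obtain u p where "awalk u p u" "p \<noteq> []"
      by (auto simp: cycle_def)
    then show "\<exists>u. (u, u) \<in> (arcs_ends G)\<^sup>+"
      using reachable1_awalk by blast
  next
    assume "\<exists>u. (u, u) \<in> (arcs_ends G)\<^sup>+"
    then obtain u p where "awalk u p u" "p \<noteq> []"
      using reachable1_awalk by blast
    then have "closed_w p"
      by (auto simp: closed_w_def)
    then show "\<exists>p. cycle p"
      by (rule closed_w_imp_cycle)
  qed
  then show ?thesis
    by (auto simp: acyclic_digraph_def acyclic_def)
qed

lemma acyclic_digraph_induce:
  assumes "pair_wf_digraph D"
  shows "acyclic_digraph (with_proj D \<restriction> S) \<longleftrightarrow> acyclic (parcs D \<inter> S \<times> S)"
proof -
  interpret pair_wf_digraph D by fact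
  have "arcs_ends (with_proj D \<restriction> S) = parcs D \<inter> S \<times> S"
    by (auto simp: arcs_ends_conv)
  moreover have "wf_digraph (with_proj D \<restriction> S)"
    by unfold_locales auto
  ultimately show ?thesis
    by (simp add: acyclic_digraph_iff)
qed

lemma acyclic_digraph_delete_arcs:
  assumes "pair_wf_digraph D"
  shows "acyclic_digraph (with_proj D\<lparr>arcs := arcs (with_proj D) - F\<rparr>) \<longleftrightarrow> acyclic (parcs D - F)"
proof -
  interpret pair_wf_digraph D by fact
  have "arcs_ends (with_proj D\<lparr>arcs := arcs (with_proj D) - F\<rparr>) = parcs D - F"
    by (auto simp: arcs_ends_conv)
  moreover have "wf_digraph (with_proj D\<lparr>arcs := arcs (with_proj D) - F\<rparr>)"
    by unfold_locales (auto dest: wellformed)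
  ultimately show ?thesis
    by (simp add: acyclic_digraph_iff)
qed

lemma acyclic_inv_imageI:
  assumes "acyclic S" "\<And>a b. (a, b) \<in> R \<Longrightarrow> (h a, h b) \<in> S"
  shows "acyclic R"
proof -
  have "(h a, h b) \<in> S\<^sup>+" if "(a, b) \<in> R\<^sup>+" for a b
    using that by induction (use assms(2) in \<open>auto intro: trancl_into_trancl\<close>)
  then show ?thesis
    using assms(1) by (auto simp: acyclic_def)
qed

lemma acyclic_measureI:
  fixes m :: "'a \<Rightarrow> nat"
  assumes "\<And>a b. (a, b) \<in> R \<Longrightarrow> m a < m b"
  shows "acyclic R"
proof -
  have "acyclic {(a, b :: nat). a < b}"
    by (rule wf_acyclic) (simp add: wf_less)
  then show ?thesis
    by (rule acyclic_inv_imageI[where h = m]) (use assms in auto)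
qed

text \<open>A monochromatic closed walk stays within one class, so the \<open>k\<close> acyclicity
  conditions merge into one on the monochromatic arcs.\<close>

lemma k_colorable_iff:
  assumes "pair_wf_digraph D"
  shows "k_colorable k (with_proj D) \<longleftrightarrow>
    (\<exists>c. (\<forall>v \<in> pverts D. c v < k) \<and> acyclic {(u, v) \<in> parcs D. c u = c v})"
proof -
  interpret pair_wf_digraph D by fact
  have "(\<forall>i < k. acyclic (parcs D \<inter> {v \<in> pverts D. c v = i} \<times> {v \<in> pverts D. c v = i})) \<longleftrightarrow>
      acyclic {(u, v) \<in> parcs D. c u = c v}" (is "?L \<longleftrightarrow> ?R")
    if c: "\<forall>v \<in> pverts D. c v < k" for c :: "'a \<Rightarrow> nat"
  proof
    assume L: ?L
    show ?R
      unfolding acyclic_def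
    proof (intro allI notI)
      fix u assume u: "(u, u) \<in> {(u, v) \<in> parcs D. c u = c v}\<^sup>+"
      let ?S = "{v \<in> pverts D. c v = c u}"
      have "(u, v) \<in> (parcs D \<inter> ?S \<times> ?S)\<^sup>+ \<and> c v = c u"
        if "(u, v) \<in> {(u, v) \<in> parcs D. c u = c v}\<^sup>+" for v
        using that
      proof induction
        case (base v)
        then have "(u, v) \<in> parcs D \<inter> ?S \<times> ?S"
          using wellformed' by auto
        then show ?case
          by auto
      next
        case (step v w)
        then have vw: "(v, w) \<in> parcs D \<inter> ?S \<times> ?S" and w: "c w = c u"
          using wellformed' by auto
        show ?case
          by (rule conjI[OF trancl_into_trancl[OF conjunct1[OF step.IH] vw] w])
      qed
      from this[OF u] have "\<not> acyclic (parcs D \<inter> {v \<in> pverts D. c v = c u} \<times> {v \<in> pverts D. c v = c u})"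
        by (auto simp: acyclic_def)
      moreover have "u \<in> pverts D"
        using u by (rule converse_tranclE) (use wellformed' in auto)
      ultimately show False
        using L c by blast
    qed
  next
    assume ?R
    then show ?L
      by (auto elim!: acyclic_subset)
  qed
  then show ?thesis
    unfolding k_colorable_def acyclic_digraph_induce[OF assms] by (auto simp: with_proj_simps)
qed

text \<open>
  Colour copies in block \<open>g\<close>: \<open>L g i\<close> forward, \<open>K g i\<close> backward, with \<open>L 0 i\<close> as roots. \<open>Dt g\<close> is vertex \<open>g\<close>
  of the DAG. The vertices \<open>Y g\<close> only form a star, which attains the maximum degree exactly.
\<close>
datatype vtx = L nat nat | K nat nat | Dt nat | Y nat

text \<open>\<open>A\<close> is the DAG with topological rank \<open>rk\<close>.
  \<open>So g i\<close> puts an arc from a forward copy of colour \<open>i\<close> to vertex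
  \<open>g\<close>, \<open>Si g i\<close> one from \<open>g\<close> to a backward copy. The bound 7
  comes from \<open>2 * (k - 2) + 7 \<le> 4 * k - 1\<close>, tight for \<open>k = 2\<close>;
  \<open>4 * k \<le> n\<close> makes room for the star.\<close>

locale frame =
  fixes k n :: nat and A So Si :: "nat \<Rightarrow> nat \<Rightarrow> bool"
    and rk :: "nat \<Rightarrow> nat"
    and preds succs :: "nat \<Rightarrow> nat list"
  assumes k: "2 \<le> k" and n: "4 * k \<le> n"
    and A_less: "\<And>g h. A g h \<Longrightarrow> g < n \<and> h < n \<and> rk g < rk h"
    and rk_le: "\<And>g. rk g \<le> n"
    and preds: "\<And>g h. A g h \<Longrightarrow> g \<in> set (preds h)"
    and succs: "\<And>g h. A g h \<Longrightarrow> h \<in> set (succs g)"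
    and low_degree: "\<And>g. g < n \<Longrightarrow> length (preds g) + length (succs g) +
       length (filter (So g) [0..<2]) + length (filter (Si g) [0..<2]) \<le> 7"
begin

text \<open>
  \<open>L\<close> and \<open>K\<close> are \<open>k\<close>-th powers of directed paths, \<open>\<dots>, K 1, K 0, L 0, L 1, \<dots>\<close> in this order, cut into
  blocks of \<open>k\<close>. The arcs from \<open>L\<close> to \<open>K\<close> make the colours of \<open>L 0, K 0, L 1, K 1, \<dots>\<close> forced one after the
  other. Each copy has degree at most \<open>4 * k - 2\<close> so far, leaving one arc for the DAG.
\<close>
fun arc :: "vtx \<Rightarrow> vtx \<Rightarrow> bool" where
  "arc (L g i) (L h j) \<longleftrightarrow> g = h \<and> i < j \<or> h = Suc g \<and> j \<le> i \<or> g = 0 \<and> h = 0 \<and> j < i"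
| "arc (K g i) (K h j) \<longleftrightarrow> g = h \<and> i < j \<or> g = Suc h \<and> j \<le> i"
| "arc (K g i) (L h j) \<longleftrightarrow> g = 0 \<and> h = 0 \<and> j \<le> i"
| "arc (L g i) (K h j) \<longleftrightarrow> i \<noteq> j \<and> (g = h \<or> g = Suc h)"
| "arc (L g i) (Dt h) \<longleftrightarrow> h < n \<and> g = Suc h \<and> (2 \<le> i \<or> So h i)"
| "arc (Dt g) (K h j) \<longleftrightarrow> g < n \<and> h = Suc g \<and> (2 \<le> j \<or> Si g j)"
| "arc (Dt g) (Dt h) \<longleftrightarrow> A g h"
| "arc (Y g) (Y h) \<longleftrightarrow> g = 0 \<and> 1 \<le> h \<and> h < 4 * k"
| "arc _ _ \<longleftrightarrow> False"

fun back_arc :: "vtx \<Rightarrow> vtx \<Rightarrow> bool" where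
  "back_arc (K g i) (L h j) \<longleftrightarrow> g = 0 \<and> h = 0 \<and> j \<le> i"
| "back_arc (L g i) (L h j) \<longleftrightarrow> g = 0 \<and> h = 0 \<and> j < i"
| "back_arc _ _ \<longleftrightarrow> False"

text \<open>All blocks from 0 to \<open>n\<close> are complete, so that the numbering fills an
  initial segment of the naturals, as \<open>standard_digraph\<close> demands.\<close>

fun vertex :: "vtx \<Rightarrow> bool" where
  "vertex (L g i) \<longleftrightarrow> g \<le> n \<and> i < k"
| "vertex (K g i) \<longleftrightarrow> g \<le> n \<and> i < k"
| "vertex (Dt g) \<longleftrightarrow> g \<le> n"
| "vertex (Y g) \<longleftrightarrow> g \<le> n"

section \<open>Numbering of the vertices\<close>

definition width :: nat where
  "width = 2 * k + 2"

fun loc :: "vtx \<Rightarrow> nat \<times> nat" where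
  "loc (L g i) = (g, i)"
| "loc (K g i) = (g, k + i)"
| "loc (Dt g) = (g, 2 * k)"
| "loc (Y g) = (g, 2 * k + 1)"

definition unloc :: "nat \<Rightarrow> nat \<Rightarrow> vtx" where
  "unloc g r = (if r < k then L g r else if r < 2 * k then K g (r - k) else if r = 2 * k then Dt g else Y g)"

definition num :: "vtx \<Rightarrow> nat" where
  "num v = fst (loc v) * width + snd (loc v)"

definition dec :: "nat \<Rightarrow> vtx" where
  "dec a = unloc (a div width) (a mod width)"

definition sz :: nat where
  "sz = (n + 1) * width"

lemma width_pos: "0 < width"
  by (simp add: width_def)

lemma snd_loc: "vertex v \<Longrightarrow> snd (loc v) < width"
  by (cases v) (auto simp: width_def)

lemma dec_num: "vertex v \<Longrightarrow> dec (num v) = v"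
proof -
  assume v: "vertex v"
  then have "num v div width = fst (loc v)" "num v mod width = snd (loc v)"
    using snd_loc[OF v] by (simp_all add: num_def)
  then show ?thesis
    using v by (cases v) (auto simp: dec_def unloc_def)
qed

lemma num_dec: "num (dec a) = a"
proof -
  have "loc (unloc g r) = (g, r)" if "r < width" for g r
    using that by (auto simp: unloc_def width_def)
  then have "loc (dec a) = (a div width, a mod width)"
    using width_pos by (simp add: dec_def)
  then show ?thesis
    by (simp add: num_def)
qed

lemma num_less: "vertex v \<Longrightarrow> num v < sz"
proof -
  assume v: "vertex v"
  have "fst (loc v) \<le> n"
    using v by (cases v) auto
  then have "fst (loc v) * width \<le> n * width"
    by (rule mult_right_mono) simp
  moreover have "sz = n * width + width"
    by (simp add: sz_def)
  ultimately show ?thesis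
    using snd_loc[OF v] unfolding num_def by linarith
qed

lemma vertex_dec: "a < sz \<Longrightarrow> vertex (dec a)"
proof -
  assume "a < sz"
  then have "a div width < n + 1"
    unfolding sz_def by (rule less_mult_imp_div_less)
  then show ?thesis
    by (auto simp: dec_def unloc_def)
qed

lemma num_eq_iff: "vertex v \<Longrightarrow> vertex w \<Longrightarrow> num v = num w \<longleftrightarrow> v = w"
  using dec_num by metis

definition D :: "nat pair_pre_digraph" where
  "D = \<lparr>pverts = {0..<sz}, parcs = {(a, b). a < sz \<and> b < sz \<and> arc (dec a) (dec b)}\<rparr>"

lemma pair_digraph_D: "pair_digraph D"
proof
  have "finite ({0..<sz} \<times> {0..<sz})"
    by simp
  then show "finite (parcs D)"
    by (rule finite_subset[rotated]) (auto simp: D_def)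
  fix e assume e: "e \<in> parcs D"
  show "fst e \<noteq> snd e"
  proof
    assume "fst e = snd e"
    then have "arc (dec (fst e)) (dec (fst e))"
      using e by (auto simp: D_def)
    then show False
      by (cases "dec (fst e)") (auto dest: A_less)
  qed
qed (auto simp: D_def)

lemma standard_D: "standard_digraph D"
  using pair_digraph_D by (simp add: standard_digraph_def) (simp add: D_def)

lemma pair_wf_D: "pair_wf_digraph D"
  using pair_digraph_D by (simp add: pair_digraph_def pair_fin_digraph_def)

section \<open>Feedback arc sets and feedback vertex sets\<close>

fun height :: "vtx \<Rightarrow> nat" where
  "height (L g i) = g * k + i"
| "height (K g i) = (n + 1) * k + (n + 1) + (n - g) * k + i"
| "height (Dt g) = (n + 1) * k + rk g"
| "height (Y g) = g"

lemma height_L: "g \<le> n \<Longrightarrow> i < k \<Longrightarrow> g * k + i < (n + 1) * k"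
proof -
  assume "g \<le> n" "i < k"
  then have "g * k + i < Suc g * k"
    by simp
  also have "\<dots> \<le> (n + 1) * k"
    using \<open>g \<le> n\<close> by (intro mult_right_mono) auto
  finally show ?thesis .
qed

text \<open>Topological order away from the back arcs: forward blocks ascending, then the DAG by
  \<open>rk\<close> (at most \<open>n\<close>, whence the offset \<open>n + 1\<close>), then
  backward blocks descending.\<close>

lemma arc_height:
  assumes "vertex v" "vertex w" "arc v w" "\<not> back_arc v w"
  shows "height v < height w"
proof (cases v)
  case v: (L g i)
  with assms show ?thesis
    using height_L[of g i] by (cases w) auto
next
  case v: (K g i)
  show ?thesis
  proof (cases w)
    case w: (K h j)
    have "(n - Suc h) * k + i < (n - h) * k + j" if "g = Suc h"
    proof -
      have "n - h = Suc (n - Suc h)"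
        using that v assms by (simp add: Suc_diff_Suc)
      then show ?thesis
        using v assms by simp
    qed
    then show ?thesis
      using v w assms by auto
  qed (use v assms in auto)
next
  case v: (Dt g)
  have "rk g < n + 1"
    using rk_le[of g] by simp
  with v assms show ?thesis
    by (cases w) (auto dest: A_less)
next
  case v: (Y g)
  with assms show ?thesis
    by (cases w) auto
qed

text \<open>One arc per pair: pairs with \<open>j \<le> i\<close> give the arcs from
  \<open>K 0\<close> to \<open>L 0\<close>, the others the arcs inside \<open>L 0\<close> against
  the order. This indexing makes the count \<open>k * k\<close> immediate.\<close>

definition fas :: "(nat \<times> nat) set" where
  "fas = (\<lambda>(i, j). if j \<le> i then (num (K 0 i), num (L 0 j)) else (num (L 0 j), num (L 0 i))) `
     ({..<k} \<times> {..<k})"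

lemma back_fas:
  assumes "vertex v" "vertex w" "back_arc v w"
  shows "(num v, num w) \<in> fas"
proof (cases v)
  case v: (L g i)
  with assms obtain j where "w = L 0 j" "g = 0" "j < i" "i < k"
    by (cases w) auto
  then show ?thesis
    using v unfolding fas_def by (intro image_eqI[of _ _ "(j, i)"]) auto
next
  case v: (K g i)
  with assms obtain j where "w = L 0 j" "g = 0" "j \<le> i" "i < k"
    by (cases w) auto
  then show ?thesis
    using v unfolding fas_def by (intro image_eqI[of _ _ "(i, j)"]) auto
qed (use assms in auto)

lemma feedback_arc_set_fas: "feedback_arc_set D fas"
proof -
  have "fas \<subseteq> parcs D"
  proof
    fix e assume "e \<in> fas"
    then obtain i j where ij: "i < k" "j < k"
      "e = (if j \<le> i then (num (K 0 i), num (L 0 j)) else (num (L 0 j), num (L 0 i)))"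
      unfolding fas_def by auto
    then obtain v w where e: "e = (num v, num w)" "vertex v" "vertex w" "arc v w"
      using that[of "K 0 i" "L 0 j"] that[of "L 0 j" "L 0 i"] by (auto split: if_splits)
    then show "e \<in> parcs D"
      by (simp add: D_def num_less dec_num)
  qed
  moreover have "acyclic (parcs D - fas)"
  proof (rule acyclic_measureI[where m = "height \<circ> dec"])
    fix a b assume "(a, b) \<in> parcs D - fas"
    then have "vertex (dec a)" "vertex (dec b)" "arc (dec a) (dec b)" "\<not> back_arc (dec a) (dec b)"
      using back_fas[of "dec a" "dec b"] by (auto simp: D_def vertex_dec num_dec)
    then show "(height \<circ> dec) a < (height \<circ> dec) b"
      by (simp add: arc_height)
  qed
  ultimately show ?thesis
    by (simp add: feedback_arc_set_def acyclic_digraph_delete_arcs[OF pair_wf_D, simplified])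
qed

lemma card_fas: "card fas = k\<^sup>2"
proof -
  have "inj_on (\<lambda>(i, j). if j \<le> i then (num (K 0 i), num (L 0 j)) else (num (L 0 j), num (L 0 i)))
     ({..<k} \<times> {..<k})"
    by (auto simp: inj_on_def num_eq_iff split: if_splits)
  then show ?thesis
    unfolding fas_def by (simp add: card_image power2_eq_square)
qed

text \<open>Every back arc ends in a root, so removing the roots removes them all.\<close>

lemma feedback_vertex_set_fvs: "feedback_vertex_set D (num ` L 0 ` {..<k})"
proof -
  let ?S = "pverts D - num ` L 0 ` {..<k}"
  have "num ` L 0 ` {..<k} \<subseteq> pverts D"
    using num_less by (auto simp: D_def)
  moreover have "acyclic (parcs D \<inter> ?S \<times> ?S)"
  proof (rule acyclic_measureI[where m = "height \<circ> dec"])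
    fix a b assume ab: "(a, b) \<in> parcs D \<inter> ?S \<times> ?S"
    then have v: "vertex (dec a)" "vertex (dec b)" "arc (dec a) (dec b)"
      by (auto simp: D_def vertex_dec)
    have "\<not> back_arc (dec a) (dec b)"
    proof
      assume "back_arc (dec a) (dec b)"
      with v(2) obtain j where "dec b = L 0 j" "j < k"
        by (cases "dec a"; cases "dec b") auto
      then have "b = num (L 0 j)"
        using num_dec[of b] by simp
      then show False
        using ab \<open>j < k\<close> by auto
    qed
    with v show "(height \<circ> dec) a < (height \<circ> dec) b"
      by (simp add: arc_height)
  qed
  ultimately show ?thesis
    by (simp add: feedback_vertex_set_def acyclic_digraph_induce[OF pair_wf_D])
qed

lemma card_fvs: "card (num ` L 0 ` {..<k}) = k"
proof -
  have "inj_on (num \<circ> L 0) {..<k}"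
    by (auto simp: inj_on_def num_eq_iff)
  then have "card ((num \<circ> L 0) ` {..<k}) = card {..<k}"
    by (rule card_image)
  then show ?thesis
    by (simp add: image_comp)
qed

section \<open>Degrees\<close>

fun ins :: "vtx \<Rightarrow> vtx list" where
  "ins (L g i) = map (L g) [0..<i] @
     (if g = 0 then map (L 0) [Suc i..<k] @ map (K 0) [i..<k] else map (L (g - 1)) [i..<k])"
| "ins (K g i) = map (K g) [0..<i] @ map (K (Suc g)) [i..<k] @ map (L g) ([0..<i] @ [Suc i..<k]) @
     map (L (Suc g)) ([0..<i] @ [Suc i..<k]) @ (if g = 0 then [] else [Dt (g - 1)])"
| "ins (Dt g) = (if g < n then map (L (Suc g)) ([2..<k] @ filter (So g) [0..<2]) @ map Dt (preds g) else [])"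
| "ins (Y g) = (if g = 0 then [] else [Y 0])"

fun outs :: "vtx \<Rightarrow> vtx list" where
  "outs (L g i) = map (L g) [Suc i..<k] @ map (L (Suc g)) [0..<Suc i] @ map (K g) ([0..<i] @ [Suc i..<k]) @
     (if g = 0 then map (L 0) [0..<i] else map (K (g - 1)) ([0..<i] @ [Suc i..<k]) @ [Dt (g - 1)])"
| "outs (K g i) = map (K g) [Suc i..<k] @
     (if g = 0 then map (L 0) [0..<Suc i] else map (K (g - 1)) [0..<Suc i])"
| "outs (Dt g) = (if g < n then map (K (Suc g)) ([2..<k] @ filter (Si g) [0..<2]) @ map Dt (succs g) else [])"
| "outs (Y g) = (if g = 0 then map Y [1..<4 * k] else [])"

lemma arc_ins: "vertex v \<Longrightarrow> vertex w \<Longrightarrow> arc v w \<Longrightarrow> v \<in> set (ins w)"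
  by (cases v; cases w)
    (auto simp: preds image_iff nat_neq_iff not_le simp del: upt_rec_numeral dest: A_less split: if_splits)

lemma arc_outs: "vertex v \<Longrightarrow> vertex w \<Longrightarrow> arc v w \<Longrightarrow> w \<in> set (outs v)"
  by (cases v; cases w)
    (auto simp: succs image_iff nat_neq_iff not_le simp del: upt_rec_numeral dest: A_less split: if_splits)

text \<open>The lists may contain non-vertices, and they count the arc between a copy and the DAG
  unconditionally, since only an upper bound is drawn from them. For \<open>Dt g\<close> the
  estimate is \<open>2 * (k - 2) + 7 \<le> 4 * k - 1\<close>, which rests on
  \<open>2 \<le> k\<close>.\<close>

lemma length_ins_outs: "vertex v \<Longrightarrow> length (ins v) + length (outs v) \<le> 4 * k - 1"
proof (cases v)
  case (Dt g)
  show ?thesis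
  proof (cases "g < n")
    case True
    have "length (ins v) = k - 2 + length (filter (So g) [0..<2]) + length (preds g)"
      "length (outs v) = k - 2 + length (filter (Si g) [0..<2]) + length (succs g)"
      using True Dt by (simp_all del: upt_rec_numeral filter.simps)
    then show ?thesis
      using low_degree[OF True] k by linarith
  qed (use Dt in simp)
qed (use k in auto)

lemma in_degree_D: "a < sz \<Longrightarrow> in_degree D a = card {w. vertex w \<and> arc w (dec a)}"
proof -
  assume a: "a < sz"
  have "in_arcs D a = (\<lambda>w. (num w, a)) ` {w. vertex w \<and> arc w (dec a)}"
    using a by (auto simp: in_arcs_def D_def vertex_dec num_less dec_num image_iff)
      (metis num_dec vertex_dec)
  moreover have "inj_on (\<lambda>w. (num w, a)) {w. vertex w \<and> arc w (dec a)}"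
    by (rule inj_onI) (metis dec_num mem_Collect_eq prod.inject)
  ultimately show ?thesis
    by (simp add: in_degree_def card_image)
qed

lemma out_degree_D: "a < sz \<Longrightarrow> out_degree D a = card {w. vertex w \<and> arc (dec a) w}"
proof -
  assume a: "a < sz"
  have "out_arcs D a = (\<lambda>w. (a, num w)) ` {w. vertex w \<and> arc (dec a) w}"
    using a by (auto simp: out_arcs_def D_def vertex_dec num_less dec_num image_iff)
      (metis num_dec vertex_dec)
  moreover have "inj_on (\<lambda>w. (a, num w)) {w. vertex w \<and> arc (dec a) w}"
    by (rule inj_onI) (metis dec_num mem_Collect_eq prod.inject)
  ultimately show ?thesis
    by (simp add: out_degree_def card_image)
qed

lemma max_degree_D: "max_degree D = 4 * k - 1"
  unfolding max_degree_def
proof (rule Max_eqI)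
  show "finite ((\<lambda>v. in_degree D v + out_degree D v) ` verts D)"
    by (simp add: D_def)
next
  fix y assume "y \<in> (\<lambda>v. in_degree D v + out_degree D v) ` verts D"
  then obtain a where a: "a < sz" "y = in_degree D a + out_degree D a"
    by (auto simp: D_def)
  have "{w. vertex w \<and> arc w (dec a)} \<subseteq> set (ins (dec a))" "{w. vertex w \<and> arc (dec a) w} \<subseteq> set (outs (dec a))"
    using arc_ins arc_outs vertex_dec[OF a(1)] by auto
  then have "in_degree D a \<le> length (ins (dec a))" "out_degree D a \<le> length (outs (dec a))"
    unfolding in_degree_D[OF a(1)] out_degree_D[OF a(1)]
    by (meson card_length card_mono finite_set order_trans)+
  then show "y \<le> 4 * k - 1"
    using length_ins_outs[OF vertex_dec[OF a(1)]] a(2) by linarith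
next
  \<comment> \<open>The bound is attained at the centre of the star, whose leaves \<open>Y 1\<close>
    to \<open>Y (4 * k - 1)\<close> exist because \<open>4 * k \<le> n\<close>.\<close>
  have v: "vertex (Y 0)"
    by simp
  have "{w. vertex w \<and> arc w (Y 0)} = {}"
    by (auto elim: arc.elims)
  then have "in_degree D (num (Y 0)) = 0"
    unfolding in_degree_D[OF num_less[OF v]] dec_num[OF v] by (simp only: card.empty)
  moreover have "{w. vertex w \<and> arc (Y 0) w} = Y ` {1..<4 * k}"
    using n by (auto elim: arc.elims)
  moreover have "card (Y ` {1..<4 * k}) = 4 * k - 1"
    by (subst card_image) (auto simp: inj_on_def)
  ultimately have "in_degree D (num (Y 0)) + out_degree D (num (Y 0)) = 4 * k - 1"
    unfolding out_degree_D[OF num_less[OF v]] dec_num[OF v] by simp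
  then show "4 * k - 1 \<in> (\<lambda>v. in_degree D v + out_degree D v) ` verts D"
    using num_less[OF v] by (intro image_eqI[of _ _ "num (Y 0)"]) (auto simp: D_def)
qed

end

section \<open>Colourings of the digraph versus labellings of the DAG\<close>

context frame
begin

definition mono_arcs :: "(nat \<Rightarrow> nat) \<Rightarrow> (nat \<times> nat) set" where
  "mono_arcs t = {(g, h). A g h \<and> t g = t h}"

text \<open>The reflexive closure matters: a vertex that is source and sink for its own colour is
  excluded too.\<close>

definition admissible :: "(nat \<Rightarrow> nat) \<Rightarrow> bool" where
  "admissible t \<longleftrightarrow> (\<forall>g < n. t g < 2) \<and>
     (\<forall>a b. a < n \<longrightarrow> b < n \<longrightarrow> So a (t a) \<longrightarrow> Si b (t b) \<longrightarrow> (a, b) \<notin> (mono_arcs t)\<^sup>*)"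

fun shade :: "(nat \<Rightarrow> nat) \<Rightarrow> vtx \<Rightarrow> nat" where
  "shade t (L g i) = i"
| "shade t (K g i) = i"
| "shade t (Dt g) = t g"
| "shade t (Y g) = 0"

text \<open>All copies get their root's colour. \<open>live\<close> marks the DAG vertices reached
  from a source by a monochromatic path; by admissibility none of them is a sink for its colour, so
  a monochromatic path that enters the DAG from a forward copy never gets to a backward
  copy.\<close>

lemma admissible_colorable:
  assumes "admissible t"
  shows "k_colorable k D"
proof -
  \<comment> \<open>\<open>admissible\<close> leaves \<open>t n\<close> free, but
    \<open>Dt n\<close> is a vertex and needs a colour.\<close>
  define t' where "t' g = (if g < n then t g else 0)" for g
  have t': "t' g < 2" for g
    using assms by (simp add: t'_def admissible_def)
  have mono_t': "A g h \<Longrightarrow> t' g = t' h \<Longrightarrow> (g, h) \<in> mono_arcs t" for g h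
    using A_less[of g h] by (simp add: t'_def mono_arcs_def)
  define live where "live h \<longleftrightarrow> (\<exists>g < n. So g (t g) \<and> (g, h) \<in> (mono_arcs t)\<^sup>*)" for h
  have live_step: "live g \<Longrightarrow> (g, h) \<in> mono_arcs t \<Longrightarrow> live h" for g h
    unfolding live_def by (meson rtrancl.rtrancl_into_rtrancl)
  have live_Si: "g < n \<Longrightarrow> Si g (t g) \<Longrightarrow> \<not> live g" for g
    using assms unfolding live_def admissible_def by blast
  \<comment> \<open>Monochromatic arcs ascend in the order: DAG vertices that are not live, backward
    copies, forward copies, live DAG vertices. Multiples of \<open>n + 1\<close> separate the
    ranges; the star is a component of its own.\<close>
  define m where "m v = (case v of
      Dt g \<Rightarrow> (if live g then 3 * (n + 1) + rk g else rk g)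
    | K g i \<Rightarrow> (n + 1) + (n - g)
    | L g i \<Rightarrow> 2 * (n + 1) + g
    | Y g \<Rightarrow> g)" for v
  have "m v < m w" if vw: "vertex v" "vertex w" "arc v w" "shade t' v = shade t' w" for v w
  proof (cases v)
    case v: (L g i)
    show ?thesis
    proof (cases w)
      case w: (Dt h)
      have "i = t h" "i < 2"
        using v w vw t'[of h] by (auto simp: t'_def)
      then have "live h"
        using v w vw unfolding live_def by auto
      then show ?thesis
        using v w vw by (simp add: m_def)
    qed (use v vw in \<open>auto simp: m_def\<close>)
  next
    case v: (K g i)
    with vw show ?thesis
      by (cases w) (auto simp: m_def)
  next
    case v: (Dt g)
    show ?thesis
    proof (cases w)
      case w: (K h j)
      have "j = t g" "j < 2" "g < n"
        using v w vw t'[of g] by (auto simp: t'_def)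
      then have "\<not> live g"
        using v w vw live_Si by auto
      then show ?thesis
        using v w rk_le[of g] by (simp add: m_def)
    next
      case w: (Dt h)
      have "(g, h) \<in> mono_arcs t" "rk g < rk h" "rk g \<le> n"
        using v w vw mono_t' A_less[of g h] rk_le by auto
      then show ?thesis
        using v w live_step[of g h] by (auto simp: m_def)
    qed (use v vw in auto)
  next
    case v: (Y g)
    with vw show ?thesis
      by (cases w) (auto simp: m_def)
  qed
  then have "acyclic {(a, b) \<in> parcs D. (shade t' \<circ> dec) a = (shade t' \<circ> dec) b}"
    by (intro acyclic_measureI[where m = "m \<circ> dec"]) (auto simp: D_def vertex_dec)
  moreover have "shade t' v < k" if "vertex v" for v
    using that k t' by (cases v) (auto intro: less_le_trans)
  then have "\<forall>a \<in> pverts D. (shade t' \<circ> dec) a < k"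
    by (auto simp: D_def vertex_dec)
  ultimately show ?thesis
    unfolding k_colorable_iff[OF pair_wf_D] by blast
qed

lemma colorable_admissible:
  assumes "k_colorable k D"
  shows "\<exists>t. admissible t"
proof -
  obtain c where c: "\<forall>v \<in> pverts D. c v < k" and acyc: "acyclic {(a, b) \<in> parcs D. c a = c b}"
    using assms unfolding k_colorable_iff[OF pair_wf_D] by blast
  define cv where "cv v = c (num v)" for v
  define R where "R = {(v, w). vertex v \<and> vertex w \<and> arc v w \<and> cv v = cv w}"
  have cvk: "vertex v \<Longrightarrow> cv v < k" for v
    using c by (simp add: cv_def D_def num_less)
  have "acyclic R"
    by (rule acyclic_inv_imageI[OF acyc, where h = num])
      (auto simp: R_def D_def num_less dec_num cv_def)
  then have R_irrefl: "(v, v) \<notin> R\<^sup>+" for v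
    by (simp add: acyclic_def)
  have RI: "vertex v \<Longrightarrow> vertex w \<Longrightarrow> arc v w \<Longrightarrow> cv v = cv w \<Longrightarrow> (v, w) \<in> R" for v w
    by (simp add: R_def)
  have R_cv: "(v, w) \<in> R\<^sup>* \<Longrightarrow> cv v = cv w" for v w
    by (induction rule: rtrancl_induct) (auto simp: R_def)
  define col where "col i = cv (L 0 i)" for i
  have col_inj: "i = j" if ij: "i < k" "j < k" "col i = col j" for i j
  proof (rule ccontr)
    assume "i \<noteq> j"
    then have "(L 0 i, L 0 j) \<in> R" "(L 0 j, L 0 i) \<in> R"
      using ij by (auto simp: R_def col_def)
    then show False
      using R_irrefl[of "L 0 i"] by (meson r_into_trancl' trancl_into_trancl)
  qed
  have "inj_on col {..<k}" "col ` {..<k} \<subseteq> {..<k}"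
    using col_inj cvk by (auto simp: inj_on_def col_def)
  then have col_surj: "col ` {..<k} = {..<k}"
    by (simp add: endo_inj_surj)
  \<comment> \<open>The roots use up all \<open>k\<close> colours, so a vertex barred from all root
    colours but one has that one.\<close>
  have cv_eqI: "cv v = col i" if "vertex v" "i < k" "\<And>j. j < k \<Longrightarrow> j \<noteq> i \<Longrightarrow> cv v \<noteq> col j" for v i
  proof -
    have "cv v \<in> col ` {..<k}"
      using cvk[OF that(1)] by (simp add: col_surj)
    then show ?thesis
      using that by auto
  qed
  define live where "live v \<longleftrightarrow> (\<exists>i < k. (L 0 i, v) \<in> R\<^sup>*)" for v
  define colive where "colive v \<longleftrightarrow> (\<exists>i < k. (v, L 0 i) \<in> R\<^sup>*)" for v
  have live_step: "live v \<Longrightarrow> (v, w) \<in> R \<Longrightarrow> live w" for v w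
    unfolding live_def by (meson rtrancl.rtrancl_into_rtrancl)
  have colive_step: "(v, w) \<in> R \<Longrightarrow> colive w \<Longrightarrow> colive v" for v w
    unfolding colive_def by (meson converse_rtrancl_into_rtrancl)
  \<comment> \<open>A nonempty monochromatic path between roots joins equally coloured, hence
    identical roots, and so is closed.\<close>
  have no_path: False if vw: "live v" "(v, w) \<in> R\<^sup>+" "colive w" for v w
  proof -
    obtain i j where i: "i < k" "(L 0 i, v) \<in> R\<^sup>*" and j: "j < k" "(w, L 0 j) \<in> R\<^sup>*"
      using vw unfolding live_def colive_def by blast
    have p: "(L 0 i, L 0 j) \<in> R\<^sup>+"
      using i j vw(2) by (meson rtrancl_trancl_trancl trancl_rtrancl_trancl)
    have "col i = col j"
      using R_cv[OF trancl_into_rtrancl[OF p]] by (simp add: col_def)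
    then have "i = j"
      using col_inj i j by blast
    then show False
      using p R_irrefl by blast
  qed
  \<comment> \<open>The forcing step: \<open>v\<close> sits between a live \<open>a\<close> and a
    colive \<open>b\<close> of colour \<open>x\<close>, so giving it colour \<open>x\<close> would
    create such a path.\<close>
  have excl: "cv v \<noteq> x"
    if "live a" "cv a = x" "colive b" "cv b = x" "arc a v" "arc v b" "vertex a" "vertex v" "vertex b"
    for v a b x
  proof
    assume "cv v = x"
    with that have "(a, v) \<in> R" "(v, b) \<in> R"
      by (auto simp: R_def)
    then have "(a, b) \<in> R\<^sup>+"
      by (meson r_into_trancl' trancl_into_trancl)
    then show False
      using no_path that by blast
  qed
  have S: "live (L 0 i)" "colive (L 0 i)" "cv (L 0 i) = col i" if "i < k" for i
    using that by (auto simp: live_def colive_def col_def)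
  define LL where "LL g \<longleftrightarrow> (\<forall>i < k. live (L g i) \<and> cv (L g i) = col i)" for g
  define KK where "KK g \<longleftrightarrow> (\<forall>i < k. colive (K g i) \<and> cv (K g i) = col i)" for g
  have LL0: "LL 0"
    using S by (simp add: LL_def)
  \<comment> \<open>Descending induction on \<open>i\<close>: colours \<open>j > i\<close> are
    excluded by \<open>K 0 j\<close> as out-neighbour, colours \<open>j < i\<close> by the digon
    with the root \<open>L 0 j\<close>.\<close>
  have KK0: "KK 0"
  proof -
    have "colive (K 0 i) \<and> cv (K 0 i) = col i" if "i < k" for i
      using that
    proof (induction "k - i" arbitrary: i rule: less_induct)
      case less
      have "cv (K 0 i) = col i"
      proof (rule cv_eqI)
        fix j assume j: "j < k" "j \<noteq> i"
        show "cv (K 0 i) \<noteq> col j"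
        proof (cases "j < i")
          case True
          show ?thesis
            by (rule excl[of "L 0 j" _ "L 0 j"]) (use S j True less.prems in auto)
        next
          case False
          then have "colive (K 0 j) \<and> cv (K 0 j) = col j"
            using j by (intro less.hyps) auto
          then show ?thesis
            by (intro excl[of "L 0 j" _ "K 0 j"]) (use S j False less.prems in auto)
        qed
      qed (use less.prems in auto)
      moreover have "colive (K 0 i)"
        by (rule colive_step[OF RI S(2)]) (use less.prems S calculation in auto)
      ultimately show ?case
        by blast
    qed
    then show ?thesis
      by (simp add: KK_def)
  qed
  \<comment> \<open>Ascending induction on \<open>i\<close>. To exclude colour \<open>j\<close>, the
    out-neighbour is always \<open>K g j\<close>; the in-neighbour is \<open>L (Suc g) j\<close> for
    \<open>j < i\<close> and \<open>L g j\<close> for \<open>j > i\<close>.\<close>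
  have LL_Suc: "LL (Suc g)" if g: "LL g" "KK g" "Suc g \<le> n" for g
  proof -
    have "live (L (Suc g) i) \<and> cv (L (Suc g) i) = col i" if "i < k" for i
      using that
    proof (induction i rule: less_induct)
      case (less i)
      have "cv (L (Suc g) i) = col i"
      proof (rule cv_eqI)
        fix j assume j: "j < k" "j \<noteq> i"
        have K: "colive (K g j)" "cv (K g j) = col j"
          using g(2) j by (auto simp: KK_def)
        show "cv (L (Suc g) i) \<noteq> col j"
        proof (cases "j < i")
          case True
          show ?thesis
            by (rule excl[of "L (Suc g) j" _ "K g j"]) (use less K j g True in auto)
        next
          case False
          have "live (L g j)" "cv (L g j) = col j"
            using g(1) j by (auto simp: LL_def)
          then show ?thesis
            by (intro excl[of "L g j" _ "K g j"]) (use less.prems K j g(3) False in auto)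
        qed
      qed (use less.prems g in auto)
      moreover have "live (L (Suc g) i)"
        by (rule live_step[OF _ RI, of "L g i"]) (use less.prems g calculation in \<open>auto simp: LL_def\<close>)
      ultimately show ?case
        by blast
    qed
    then show ?thesis
      by (simp add: LL_def)
  qed
  \<comment> \<open>Descending again: the in-neighbour is always \<open>L (Suc g) j\<close>; the
    out-neighbour is \<open>K g j\<close> for \<open>j < i\<close> and \<open>K (Suc g) j\<close>
    for \<open>j > i\<close>.\<close>
  have KK_Suc: "KK (Suc g)" if g: "LL (Suc g)" "KK g" "Suc g \<le> n" for g
  proof -
    have "colive (K (Suc g) i) \<and> cv (K (Suc g) i) = col i" if "i < k" for i
      using that
    proof (induction "k - i" arbitrary: i rule: less_induct)
      case less
      have "cv (K (Suc g) i) = col i"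
      proof (rule cv_eqI)
        fix j assume j: "j < k" "j \<noteq> i"
        have L: "live (L (Suc g) j)" "cv (L (Suc g) j) = col j"
          using g(1) j by (auto simp: LL_def)
        show "cv (K (Suc g) i) \<noteq> col j"
        proof (cases "j < i")
          case True
          have "colive (K g j)" "cv (K g j) = col j"
            using g(2) j by (auto simp: KK_def)
          then show ?thesis
            by (intro excl[of "L (Suc g) j" _ "K g j"]) (use less.prems L j g(3) True in auto)
        next
          case False
          then have "colive (K (Suc g) j) \<and> cv (K (Suc g) j) = col j"
            using j by (intro less.hyps) auto
          then show ?thesis
            by (intro excl[of "L (Suc g) j" _ "K (Suc g) j"]) (use less.prems L j g(3) False in auto)
        qed
      qed (use less.prems g in auto)
      moreover have "colive (K (Suc g) i)"
        by (rule colive_step[OF RI, of _ "K g i"]) (use less.prems g calculation in \<open>auto simp: KK_def\<close>)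
      ultimately show ?case
        by blast
    qed
    then show ?thesis
      by (simp add: KK_def)
  qed
  have LK: "LL g \<and> KK g" if "g \<le> n" for g
    using that by (induction g) (use LL0 KK0 LL_Suc KK_Suc in auto)
  define t where "t g = (if cv (Dt g) = col 0 then 0 else 1 :: nat)" for g
  have t2: "t g < 2" for g
    by (simp add: t_def)
  \<comment> \<open>The colours from 2 on are excluded between the copies in block
    \<open>Suc g\<close>, which leaves the first two root colours.\<close>
  have cv_Dt: "cv (Dt g) = col (t g)" if g: "g < n" for g
  proof -
    have "cv (Dt g) \<noteq> col j" if j: "2 \<le> j" "j < k" for j
      by (rule excl[of "L (Suc g) j" _ "K (Suc g) j"])
        (use LK[of "Suc g"] g j in \<open>auto simp: LL_def KK_def\<close>)
    moreover have "cv (Dt g) \<in> col ` {..<k}"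
      using cvk[of "Dt g"] g by (simp add: col_surj)
    ultimately obtain j where "cv (Dt g) = col j" "j < 2"
      by (metis imageE lessThan_iff not_le)
    then show ?thesis
      by (auto simp: t_def less_2_cases_iff)
  qed
  have path: "(Dt a, Dt b) \<in> R\<^sup>*" if "(a, b) \<in> (mono_arcs t)\<^sup>*" for a b
    using that
  proof (induction rule: rtrancl_induct)
    case (step b d)
    then have "(Dt b, Dt d) \<in> R"
      using A_less[of b d] cv_Dt by (auto simp: R_def mono_arcs_def)
    then show ?case
      using step.IH by (meson rtrancl.rtrancl_into_rtrancl)
  qed simp
  have "admissible t"
    unfolding admissible_def
  proof (intro conjI allI impI notI)
    fix a b assume ab: "a < n" "b < n" "So a (t a)" "Si b (t b)" "(a, b) \<in> (mono_arcs t)\<^sup>*"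
    have tk: "t g < k" for g
      using t2[of g] k by simp
    have "live (L (Suc a) (t a))" "cv (L (Suc a) (t a)) = col (t a)"
      using LK[of "Suc a"] ab(1) tk by (auto simp: LL_def)
    then have "live (L (Suc a) (t a))" "(L (Suc a) (t a), Dt a) \<in> R"
      using ab tk cv_Dt by (auto simp: R_def)
    moreover have "colive (K (Suc b) (t b))" "cv (K (Suc b) (t b)) = col (t b)"
      using LK[of "Suc b"] ab(2) tk by (auto simp: KK_def)
    then have "colive (K (Suc b) (t b))" "(Dt b, K (Suc b) (t b)) \<in> R"
      using ab tk cv_Dt by (auto simp: R_def)
    ultimately show False
      using no_path path[OF ab(5)] by (meson rtrancl_into_trancl1 rtrancl_trancl_trancl r_into_rtrancl trancl_into_rtrancl rtrancl_into_trancl2)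
  qed (rule t2)
  then show ?thesis
    by blast
qed

theorem colorable_iff_admissible: "k_colorable k D \<longleftrightarrow> (\<exists>t. admissible t)"
  using admissible_colorable colorable_admissible by blast

end

section \<open>Choices without conflicts\<close>

text \<open>
  Variables \<open>v < V\<close> come in consecutive groups of size \<open>m\<close>; one wants a set meeting every group and
  containing no \<open>v, u\<close> with \<open>E v u\<close>. Colour \<open>0\<close> means that a variable is chosen. Vertex \<open>pos v u \<tau>\<close> has
  type \<open>\<tau>\<close>: types \<open>0\<close> and \<open>1\<close> form for each \<open>v\<close> a chain along which colour \<open>0\<close> of the first vertex forces
  the alternating colours \<open>0, 1, 0, 1, \<dots>\<close>; type \<open>2\<close> cannot be coloured if \<open>v\<close> and \<open>u\<close> are chosen and
  \<open>E v u\<close>. The first vertices of the chains of a group form a path that must not have colour \<open>1\<close>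
  throughout.
\<close>
locale choice =
  fixes k V m :: nat and E :: "nat \<Rightarrow> nat \<Rightarrow> bool"
  assumes k: "2 \<le> k" and V: "4 * k \<le> 3 * (V * V)" and m: "0 < m" and dvd: "m dvd V"
begin

definition pos :: "nat \<Rightarrow> nat \<Rightarrow> nat \<Rightarrow> nat" where
  "pos v u \<tau> = 3 * (v * V + u) + \<tau>"

definition ty :: "nat \<Rightarrow> nat" where
  "ty g = g mod 3"

definition va :: "nat \<Rightarrow> nat" where
  "va g = g div 3 div V"

definition vb :: "nat \<Rightarrow> nat" where
  "vb g = g div 3 mod V"

lemma V_pos: "0 < V"
  using k V by (cases V) auto

lemma decode [simp]:
  assumes "u < V" "\<tau> < 3"
  shows "ty (pos v u \<tau>) = \<tau>" "va (pos v u \<tau>) = v" "vb (pos v u \<tau>) = u"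
proof -
  have "(3 * q + \<tau>) div 3 = q" "(3 * q + \<tau>) mod 3 = \<tau>" for q
    using assms by simp_all
  then have "pos v u \<tau> div 3 = v * V + u" "pos v u \<tau> mod 3 = \<tau>"
    unfolding pos_def by blast+
  then show "ty (pos v u \<tau>) = \<tau>" "va (pos v u \<tau>) = v" "vb (pos v u \<tau>) = u"
    using assms by (simp_all add: ty_def va_def vb_def)
qed

lemma encode: "g = pos (va g) (vb g) (ty g)"
  by (simp add: pos_def va_def vb_def ty_def)

lemma ty_less: "ty g < 3"
  by (simp add: ty_def)

lemma vb_less: "vb g < V"
  using V_pos by (simp add: vb_def)

lemma va_less: "g < 3 * (V * V) \<Longrightarrow> va g < V"
  by (simp add: va_def less_mult_imp_div_less)

lemma pos_less [simp]:
  assumes "v < V" "u < V" "\<tau> < 3"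
  shows "pos v u \<tau> < 3 * (V * V)"
proof -
  have "Suc v * V \<le> V * V"
    using assms by (intro mult_right_mono) auto
  then have "v * V + u < V * V"
    using assms(2) by simp
  moreover have "3 * a + \<tau> < 3 * b" if "a < b" for a b
    using that assms(3) by linarith
  ultimately show ?thesis
    unfolding pos_def by blast
qed

text \<open>\<open>P\<close>, \<open>N\<close>, \<open>Z\<close> in the rule names stand for types
  0, 1, 2. A chain gives its variable a fresh pair of vertices for every partner, which keeps the
  degree constant. In \<open>NZ\<close> the indices are swapped: the vertex testing the pair
  \<open>(v, u)\<close> also hears from the chain of \<open>u\<close> at place \<open>v\<close>.
  That arc is present for all pairs; where \<open>PZ\<close> adds no arc, colour 0 remains open for
  the test.\<close>

inductive data_arc :: "nat \<Rightarrow> nat \<Rightarrow> bool" where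
  PN: "v < V \<Longrightarrow> u < V \<Longrightarrow> data_arc (pos v u 0) (pos v u 1)"
| NP: "v < V \<Longrightarrow> Suc u < V \<Longrightarrow> data_arc (pos v u 1) (pos v (Suc u) 0)"
| PZ: "v < V \<Longrightarrow> u < V \<Longrightarrow> E v u \<Longrightarrow> data_arc (pos v u 0) (pos v u 2)"
| NZ: "v < V \<Longrightarrow> u < V \<Longrightarrow> data_arc (pos u v 1) (pos v u 2)"
| PP: "Suc v < V \<Longrightarrow> Suc v mod m \<noteq> 0 \<Longrightarrow> data_arc (pos v 0 0) (pos (Suc v) 0 0)"

text \<open>Colour 0 on type 0 and colour 1 on type 1 carry the message that the variable is chosen.
  Colour 1 at the first vertex of a group starts the message that no variable of the group has been
  chosen so far.\<close>

definition source :: "nat \<Rightarrow> nat \<Rightarrow> bool" where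
  "source g i \<longleftrightarrow> ty g = 0 \<and> (i = 0 \<or> i = 1 \<and> vb g = 0 \<and> va g mod m = 0) \<or> ty g = 1 \<and> i = 1"

definition sink :: "nat \<Rightarrow> nat \<Rightarrow> bool" where
  "sink g i \<longleftrightarrow> ty g = 0 \<and> i = 1 \<and> (vb g \<noteq> 0 \<or> Suc (va g) mod m = 0) \<or> ty g = 1 \<and> i = 0 \<or> ty g = 2"

text \<open>Arcs of \<open>NZ\<close> swap the indices and may lead to a smaller number, so type 2
  is lifted to the top. The \<open>min\<close> gives the bound on ranks for numbers beyond the range
  as well.\<close>

definition rk :: "nat \<Rightarrow> nat" where
  "rk g = (if ty g = 2 then 3 * (V * V) else min g (3 * (V * V)))"

definition preds :: "nat \<Rightarrow> nat list" where
  "preds g = (if ty g = 0 then [if vb g = 0 then pos (va g - 1) 0 0 else pos (va g) (vb g - 1) 1]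
     else if ty g = 1 then [pos (va g) (vb g) 0] else [pos (va g) (vb g) 0, pos (vb g) (va g) 1])"

definition succs :: "nat \<Rightarrow> nat list" where
  "succs g = (if ty g = 0 then [pos (va g) (vb g) 1, pos (va g) (vb g) 2, pos (Suc (va g)) 0 0]
     else if ty g = 1 then [pos (va g) (Suc (vb g)) 0, pos (vb g) (va g) 2] else [])"

lemma rk_pos:
  assumes "v < V" "u < V" "\<tau> < 3"
  shows "rk (pos v u \<tau>) = (if \<tau> = 2 then 3 * (V * V) else pos v u \<tau>)"
  using assms pos_less[OF assms] by (simp add: rk_def)

sublocale frame k "3 * (V * V)" data_arc source sink rk preds succs
proof
  show "2 \<le> k" "4 * k \<le> 3 * (V * V)"
    by (fact k V)+
  show "rk g \<le> 3 * (V * V)" for g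
    by (simp add: rk_def)
  show "g < 3 * (V * V) \<and> h < 3 * (V * V) \<and> rk g < rk h" if "data_arc g h" for g h
    using that
  proof cases
    case (PN v u)
    then show ?thesis
      by (simp add: rk_pos) (simp add: pos_def)
  next
    case (NP v u)
    then show ?thesis
      by (simp add: rk_pos) (simp add: pos_def)
  next
    case (PP v)
    then show ?thesis
      using V_pos by (simp add: rk_pos) (simp add: pos_def)
  qed (simp_all add: rk_pos)
  show "g \<in> set (preds h)" if "data_arc g h" for g h
    using that V_pos by cases (simp_all add: preds_def)
  show "h \<in> set (succs g)" if "data_arc g h" for g h
    using that V_pos by cases (simp_all add: succs_def)
  show "length (preds g) + length (succs g) + length (filter (source g) [0..<2]) +
      length (filter (sink g) [0..<2]) \<le> 7" for g
  proof -
    have "[0..<2] = [0, 1 :: nat]"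
      by (simp add: upt_rec)
    then show ?thesis
      using ty_less[of g] by (auto simp: preds_def succs_def source_def sink_def)
  qed
qed

section \<open>Admissible labellings versus choices without conflicts\<close>

definition solution :: "nat set \<Rightarrow> bool" where
  "solution C \<longleftrightarrow> (\<forall>v \<in> C. v < V) \<and> (\<forall>w < V div m. \<exists>v \<in> C. v div m = w) \<and> (\<forall>v \<in> C. \<forall>u \<in> C. \<not> E v u)"

lemma admissible_solution:
  assumes "admissible t"
  shows "\<exists>C. solution C"
proof -
  have t2: "t (pos v u \<tau>) < 2" if "v < V" "u < V" "\<tau> < 3" for v u \<tau>
    using assms pos_less[OF that] by (simp add: admissible_def)
  have no_path: "\<not> (source a (t a) \<and> sink b (t b) \<and> (a, b) \<in> (mono_arcs t)\<^sup>* \<and> a < 3 * (V * V) \<and> b < 3 * (V * V))" for a b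
    using assms unfolding admissible_def by blast
  have no_arc: "t a \<noteq> t b" if "data_arc a b" "source a (t a)" "sink b (t a)" for a b
  proof
    assume "t a = t b"
    then have "(a, b) \<in> (mono_arcs t)\<^sup>*"
      using that by (auto simp: mono_arcs_def)
    then show False
      using no_path[of a b] A_less[OF that(1)] that \<open>t a = t b\<close> by simp
  qed
  define C where "C = {v. v < V \<and> t (pos v 0 0) = 0}"
  have chain: "u < V \<Longrightarrow> t (pos v u 0) = 0 \<and> t (pos v u 1) = 1" if "v \<in> C" for v u
  proof (induction u)
    case 0
    have v: "v < V" "t (pos v 0 0) = 0"
      using that by (auto simp: C_def)
    have "t (pos v 0 0) \<noteq> t (pos v 0 1)"
      by (rule no_arc[OF PN]) (use v V_pos in \<open>simp_all add: source_def sink_def\<close>)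
    then show ?case
      using v t2[of v 0 1] V_pos by simp
  next
    case (Suc u)
    have v: "v < V" "t (pos v u 1) = 1"
      using that Suc by (auto simp: C_def)
    have "t (pos v u 1) \<noteq> t (pos v (Suc u) 0)"
      by (rule no_arc[OF NP]) (use v Suc in \<open>simp_all add: source_def sink_def\<close>)
    then have P: "t (pos v (Suc u) 0) = 0"
      using v t2[of v "Suc u" 0] Suc.prems by simp
    have "t (pos v (Suc u) 0) \<noteq> t (pos v (Suc u) 1)"
      by (rule no_arc[OF PN]) (use v Suc P in \<open>simp_all add: source_def sink_def\<close>)
    then show ?case
      using P v t2[of v "Suc u" 1] Suc.prems by simp
  qed
  have "\<not> E v u" if "v \<in> C" "u \<in> C" for v u
  proof
    assume e: "E v u"
    have vu: "v < V" "u < V"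
      using that by (auto simp: C_def)
    \<comment> \<open>The test vertex loses colour 0 to the chain of \<open>v\<close> and colour 1
      to the chain of \<open>u\<close>.\<close>
    have "t (pos v u 0) \<noteq> t (pos v u 2)"
      by (rule no_arc[OF PZ]) (use vu e chain[OF that(1) vu(2)] in \<open>simp_all add: source_def sink_def\<close>)
    moreover have "t (pos u v 1) \<noteq> t (pos v u 2)"
      by (rule no_arc[OF NZ]) (use vu chain[OF that(2) vu(1)] in \<open>simp_all add: source_def sink_def\<close>)
    ultimately show False
      using chain[OF that(1) vu(2)] chain[OF that(2) vu(1)] t2[of v u 2] vu by simp
  qed
  moreover have "\<exists>v \<in> C. v div m = w" if w: "w < V div m" for w
  proof (rule ccontr)
    assume no: "\<not> (\<exists>v \<in> C. v div m = w)"
    have "Suc w * m \<le> V"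
      using w dvd by (metis Suc_leI dvd_div_mult_self mult_le_mono1)
    then have wV: "w * m + i < V" if "i < m" for i
      using that by simp
    have t1: "t (pos (w * m + i) 0 0) = 1" if "i < m" for i
    proof -
      have "(w * m + i) div m = w"
        using that by simp
      then have "w * m + i \<notin> C"
        using no by blast
      then show ?thesis
        using wV[OF that] t2[of "w * m + i" 0 0] V_pos by (simp add: C_def)
    qed
    \<comment> \<open>In a group without a chosen variable the first vertices form a path of colour
      1 from the source at its start to the sink at its end.\<close>
    have path: "i < m \<Longrightarrow> (pos (w * m) 0 0, pos (w * m + i) 0 0) \<in> (mono_arcs t)\<^sup>*" for i
    proof (induction i)
      case (Suc i)
      have "Suc (w * m + i) mod m = Suc i"
        using Suc.prems by (metis add_Suc_right mod_less mod_mult_self3)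
      then have "data_arc (pos (w * m + i) 0 0) (pos (Suc (w * m + i)) 0 0)"
        using wV[OF Suc.prems] by (intro PP) simp_all
      then have "(pos (w * m + i) 0 0, pos (w * m + Suc i) 0 0) \<in> mono_arcs t"
        using t1[of i] t1[of "Suc i"] Suc.prems by (simp add: mono_arcs_def)
      then show ?case
        using Suc by (meson Suc_lessD rtrancl.rtrancl_into_rtrancl)
    qed simp
    let ?a = "pos (w * m + 0) 0 0" and ?b = "pos (w * m + (m - 1)) 0 0"
    have "source ?a (t ?a)"
      using t1[of 0] m V_pos by (simp add: source_def)
    moreover have "Suc (w * m + (m - 1)) = Suc w * m"
      using m by simp
    then have "Suc (w * m + (m - 1)) mod m = 0"
      by (metis mod_mult_self2_is_0)
    then have "sink ?b (t ?b)"
      using t1[of "m - 1"] m V_pos by (simp add: sink_def)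
    moreover have "(?a, ?b) \<in> (mono_arcs t)\<^sup>*"
      using path[of "m - 1"] m by simp
    moreover have "?a < 3 * (V * V)" "?b < 3 * (V * V)"
      using wV[of 0] wV[of "m - 1"] m V_pos by simp_all
    ultimately show False
      using no_path by blast
  qed
  ultimately have "solution C"
    by (auto simp: solution_def C_def)
  then show ?thesis
    by blast
qed

lemma solution_admissible:
  assumes "solution C"
  shows "\<exists>t. admissible t"
proof -
  \<comment> \<open>Chosen variables alternate 0, 1 along their chain and the others 1, 0, so no
    chain arc is monochromatic. A type 2 vertex differs from the type 0 vertex of its pair whenever
    \<open>PZ\<close> joins them.\<close>
  define t :: "nat \<Rightarrow> nat" where "t g = (if ty g = 0 then if va g \<in> C then 0 else 1
    else if ty g = 1 then if va g \<in> C then 1 else 0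
    else if E (va g) (vb g) \<and> va g \<in> C then 1 else 0)" for g
  \<comment> \<open>Describes where the messages of \<open>source\<close> may arrive: it holds at
    sources of their own colour, passes along monochromatic arcs and excludes sinks of their own
    colour.\<close>
  define inv where "inv g \<longleftrightarrow>
      ty g = 0 \<and> (va g \<in> C \<or> vb g = 0 \<and> (\<forall>v. v div m = va g div m \<longrightarrow> v \<le> va g \<longrightarrow> v \<notin> C)) \<or>
      ty g = 1 \<and> va g \<in> C" for g
  have t0: "t g = (if va g \<in> C then 0 else 1)" if "ty g = 0" for g
    using that by (simp add: t_def)
  have t1: "t g = (if va g \<in> C then 1 else 0)" if "ty g = 1" for g
    using that by (simp add: t_def)
  have no_E: "v \<in> C \<Longrightarrow> u \<in> C \<Longrightarrow> \<not> E v u" for v u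
    using assms by (simp add: solution_def)
  \<comment> \<open>Starting from \<open>inv g\<close>, only an arc of \<open>PP\<close> can be
    monochromatic; the case \<open>NZ\<close> is where the absence of conflicts in \<open>C\<close>
    enters.\<close>
  have step: "inv h" if "inv g" "(g, h) \<in> mono_arcs t" for g h
  proof -
    have "data_arc g h" "t g = t h"
      using that(2) by (auto simp: mono_arcs_def)
    then show ?thesis
    proof cases
      case (PP v)
      have d: "Suc v div m = v div m"
        using PP(4) by (simp add: div_Suc)
      have "v \<in> C \<longleftrightarrow> Suc v \<in> C"
        using PP \<open>t g = t h\<close> V_pos by (simp add: t_def split: if_splits)
      moreover have "v \<in> C \<or> (\<forall>v'. v' div m = v div m \<longrightarrow> v' \<le> v \<longrightarrow> v' \<notin> C)"
        using \<open>inv g\<close> PP V_pos by (simp add: inv_def)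
      ultimately have "Suc v \<in> C \<or> (\<forall>v'. v' div m = Suc v div m \<longrightarrow> v' \<le> Suc v \<longrightarrow> v' \<notin> C)"
        unfolding d le_Suc_eq by blast
      then show ?thesis
        using PP(2) V_pos by (simp add: inv_def)
    next
      case (PN v u)
      then show ?thesis
        using \<open>t g = t h\<close> by (simp add: t_def split: if_splits)
    next
      case (NP v u)
      then show ?thesis
        using \<open>t g = t h\<close> by (simp add: t_def split: if_splits)
    next
      case (PZ v u)
      then show ?thesis
        using \<open>t g = t h\<close> by (simp add: t_def split: if_splits)
    next
      case (NZ v u)
      have "u \<in> C"
        using \<open>inv g\<close> NZ by (simp add: inv_def)
      then have "t g = 1"
        using NZ by (simp add: t_def)
      moreover have "t h = (if E v u \<and> v \<in> C then 1 else 0)"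
        using NZ by (simp add: t_def)
      ultimately have "E v u" "v \<in> C"
        using \<open>t g = t h\<close> by presburger+
      then show ?thesis
        using no_E \<open>u \<in> C\<close> by blast
    qed
  qed
  have source_inv: "inv g" if source: "source g (t g)" for g
  proof -
    have "v = va g" if "va g mod m = 0" "v div m = va g div m" "v \<le> va g" for v
    proof -
      have "m dvd va g"
        by (rule mod_0_imp_dvd) (rule that(1))
      then have "va g = v div m * m"
        unfolding that(2) by simp
      also have "\<dots> \<le> v"
        by (rule div_times_less_eq_dividend)
      finally show ?thesis
        using that(3) by simp
    qed
    note lone = this
    from source consider "ty g = 0" "t g = 0" | "ty g = 0" "t g = 1" "vb g = 0" "va g mod m = 0"
      | "ty g = 1" "t g = 1"
      unfolding source_def by metis
    then show ?thesis
    proof cases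
      case 2
      then have "va g \<notin> C"
        by (simp add: t_def split: if_splits)
      then have "v \<notin> C" if "v div m = va g div m" "v \<le> va g" for v
        using lone[OF 2(4) that] by simp
      with 2 show ?thesis
        by (simp add: inv_def)
    next
      case 1
      then have "va g \<in> C"
        using t0 by (metis zero_neq_one)
      with 1(1) show ?thesis
        unfolding inv_def by metis
    next
      case 3
      then have "va g \<in> C"
        using t1 by (metis zero_neq_one)
      with 3(1) show ?thesis
        unfolding inv_def by metis
    qed
  qed
  have sink: "\<not> sink g (t g)" if "inv g" "g < 3 * (V * V)" for g
  proof
    assume s: "sink g (t g)"
    have ne: "(0 :: nat) \<noteq> 1" "(2 :: nat) \<noteq> 0" "(2 :: nat) \<noteq> 1"
      by simp_all
    have "va g \<notin> C"
      using \<open>inv g\<close> s t0[of g] t1[of g] ne unfolding inv_def sink_def by metis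
    then have g: "ty g = 0" "vb g = 0" and no: "\<And>v. v div m = va g div m \<Longrightarrow> v \<le> va g \<Longrightarrow> v \<notin> C"
      using \<open>inv g\<close> unfolding inv_def by metis+
    \<comment> \<open>The message of a group without choice has reached the last variable of the
      group, although \<open>C\<close> meets the group.\<close>
    then have "Suc (va g) mod m = 0"
      using s ne unfolding sink_def by metis
    then obtain w where w: "Suc (va g) = w * m"
      by (metis dvd_def mod_0_imp_dvd mult.commute)
    have "va g div m < V div m"
      unfolding div_less_iff_less_mult[OF m] using va_less[OF that(2)] dvd by simp
    then obtain v where v: "v \<in> C" "v div m = va g div m"
      using assms unfolding solution_def by blast
    have "va g div m < w"
      unfolding div_less_iff_less_mult[OF m] using w by simp
    then have "v < Suc (va g)"
      unfolding v(2)[symmetric] div_less_iff_less_mult[OF m] w .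
    then show False
      using no v by auto
  qed
  have path: "inv b" if "(a, b) \<in> (mono_arcs t)\<^sup>*" "inv a" for a b
    using that by (induction rule: rtrancl_induct) (auto intro: step)
  have "t g < 2" for g
    by (simp add: t_def)
  then have "admissible t"
    using path source_inv sink unfolding admissible_def by blast
  then show ?thesis
    by blast
qed

theorem colorable_iff_solution: "k_colorable k D \<longleftrightarrow> (\<exists>C. solution C)"
  using colorable_iff_admissible admissible_solution solution_admissible by blast

end

section \<open>Polynomial-time computability of the reduction\<close>

text \<open>The semantic side of \<open>aexp\<close>: with closure lemmas, computability follows by
  decomposing a formula, and no expression has to be written down.\<close>

definition definable :: "(bool list \<Rightarrow> nat \<Rightarrow> nat) \<Rightarrow> bool" where
  "definable f \<longleftrightarrow> (\<exists>e. \<forall>x i. aval e x i = f x i)"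

lemma definable_const: "definable (\<lambda>x i. c)"
  unfolding definable_def by (rule exI[of _ "Const c"]) simp

lemma definable_len: "definable (\<lambda>x i. length x)"
  unfolding definable_def by (rule exI[of _ Len]) simp

lemma definable_idx: "definable (\<lambda>x i. i)"
  unfolding definable_def by (rule exI[of _ Idx]) simp

lemma definable_input: "definable f \<Longrightarrow> definable (\<lambda>x i. input_code x (f x i))"
  unfolding definable_def by (metis aval.simps(4))

lemma definable_add: "definable f \<Longrightarrow> definable g \<Longrightarrow> definable (\<lambda>x i. f x i + g x i)"
  unfolding definable_def by (metis aval.simps(5))

lemma definable_diff: "definable f \<Longrightarrow> definable g \<Longrightarrow> definable (\<lambda>x i. f x i - g x i)"
  unfolding definable_def by (metis aval.simps(6))

lemma definable_mult: "definable f \<Longrightarrow> definable g \<Longrightarrow> definable (\<lambda>x i. f x i * g x i)"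
  unfolding definable_def by (metis aval.simps(7))

lemma definable_Suc: "definable f \<Longrightarrow> definable (\<lambda>x i. Suc (f x i))"
  using definable_add[OF _ definable_const[of 1]] by simp

lemma definable_div:
  assumes "definable f" "definable g" "\<And>x i. 0 < g x i"
  shows "definable (\<lambda>x i. f x i div g x i)"
proof -
  have "definable (\<lambda>x i. g x i - 1)"
    by (intro definable_diff definable_const assms)
  then obtain a b where "\<And>x i. aval a x i = f x i" "\<And>x i. aval b x i = g x i - 1"
    using assms(1) unfolding definable_def by blast
  then show ?thesis
    unfolding definable_def using assms(3) by (intro exI[of _ "DivS a b"]) simp
qed

lemma definable_mod:
  assumes "definable f" "definable g" "\<And>x i. 0 < g x i"
  shows "definable (\<lambda>x i. f x i mod g x i)"
proof -
  have "definable (\<lambda>x i. f x i - f x i div g x i * g x i)"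
    by (intro definable_diff definable_mult definable_div assms)
  then show ?thesis
    by (simp add: minus_div_mult_eq_mod)
qed

lemma definable_poly: "definable f \<Longrightarrow> definable (\<lambda>x i. poly p (f x i))"
proof (induction p)
  case 0
  then show ?case
    using definable_const by simp
next
  case (pCons a p)
  then show ?case
    unfolding poly_pCons by (intro definable_add definable_mult definable_const) auto
qed

definition decidable :: "(bool list \<Rightarrow> nat \<Rightarrow> bool) \<Rightarrow> bool" where
  "decidable p \<longleftrightarrow> definable (\<lambda>x i. if p x i then 1 else 0)"

lemma decidable_const: "decidable (\<lambda>x i. b)"
  unfolding decidable_def by (rule definable_const)

lemma decidable_cong: "decidable q \<Longrightarrow> (\<And>x i. p x i \<longleftrightarrow> q x i) \<Longrightarrow> decidable p"
  unfolding decidable_def by simp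

lemma decidable_not: "decidable p \<Longrightarrow> decidable (\<lambda>x i. \<not> p x i)"
proof -
  assume "decidable p"
  then have "definable (\<lambda>x i. 1 - (if p x i then 1 else 0))"
    unfolding decidable_def by (intro definable_diff definable_const)
  moreover have "(\<lambda>x i. 1 - (if p x i then 1 else 0)) = (\<lambda>x i. if \<not> p x i then 1 else 0 :: nat)"
    by (intro ext) simp
  ultimately show ?thesis
    unfolding decidable_def by simp
qed

lemma decidable_conj: "decidable p \<Longrightarrow> decidable q \<Longrightarrow> decidable (\<lambda>x i. p x i \<and> q x i)"
proof -
  assume "decidable p" "decidable q"
  then have "definable (\<lambda>x i. (if p x i then 1 else 0) * (if q x i then 1 else 0))"
    unfolding decidable_def by (rule definable_mult)
  moreover have "(\<lambda>x i. (if p x i then 1 else 0) * (if q x i then 1 else 0)) =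
      (\<lambda>x i. if p x i \<and> q x i then 1 else 0 :: nat)"
    by (intro ext) simp
  ultimately show ?thesis
    unfolding decidable_def by simp
qed

lemma decidable_disj: "decidable p \<Longrightarrow> decidable q \<Longrightarrow> decidable (\<lambda>x i. p x i \<or> q x i)"
  using decidable_not[OF decidable_conj[OF decidable_not decidable_not]] by simp

lemma decidable_less: "definable f \<Longrightarrow> definable g \<Longrightarrow> decidable (\<lambda>x i. f x i < g x i)"
proof -
  assume "definable f" "definable g"
  then have "definable (\<lambda>x i. 1 - (1 - (g x i - f x i)))"
    by (intro definable_diff definable_const)
  moreover have "(\<lambda>x i. 1 - (1 - (g x i - f x i))) = (\<lambda>x i. if f x i < g x i then 1 else 0)"
    by (intro ext) auto
  ultimately show ?thesis
    unfolding decidable_def by simp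
qed

lemma decidable_le: "definable f \<Longrightarrow> definable g \<Longrightarrow> decidable (\<lambda>x i. f x i \<le> g x i)"
  using decidable_not[OF decidable_less] by (simp add: not_less)

lemma decidable_eq: "definable f \<Longrightarrow> definable g \<Longrightarrow> decidable (\<lambda>x i. f x i = g x i)"
  using decidable_conj[OF decidable_le decidable_le] by (simp add: order_eq_iff)

lemma decidable_iff_const: "decidable p \<Longrightarrow> decidable (\<lambda>x i. p x i = b)"
  by (cases b) (simp_all add: decidable_not)

lemmas definable_intros = definable_const definable_len definable_idx definable_add definable_diff
  definable_mult definable_Suc definable_input

lemmas decidable_intros = decidable_const decidable_not decidable_conj decidable_disj decidable_less
  decidable_le decidable_eq

text \<open>A parameter whose range is fixed in advance is eliminated by finitely many case
  distinctions. In this way tables that depend on the machine, such as \<open>opts\<close>, enter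
  formulas without being arithmetic.\<close>

lemma decidable_bounded_cases:
  assumes f: "definable f" "\<And>x i. f x i < B" and p: "\<And>c. c < B \<Longrightarrow> decidable (\<lambda>x i. p c x i)"
  shows "decidable (\<lambda>x i. p (f x i) x i)"
proof -
  have "decidable (\<lambda>x i. \<exists>c < n. f x i = c \<and> p c x i)" if "n \<le> B" for n
    using that
  proof (induction n)
    case 0
    then show ?case
      using decidable_const[of False] by simp
  next
    case (Suc n)
    then have "decidable (\<lambda>x i. (\<exists>c < n. f x i = c \<and> p c x i) \<or> f x i = n \<and> p n x i)"
      by (intro decidable_disj decidable_conj decidable_eq definable_const f p) auto
    then show ?case
      by (rule decidable_cong) (auto simp: less_Suc_eq)
  qed
  from this[OF order_refl] show ?thesis
    by (rule decidable_cong) (use f(2) in auto)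
qed

text \<open>Subtraction of naturals truncates, so a negative shift is moved to the other
  side.\<close>

lemma decidable_int_shift:
  assumes "definable f" "definable g"
  shows "decidable (\<lambda>x i. int (f x i) = int (g x i) + z)"
proof (cases "0 \<le> z")
  case True
  have "decidable (\<lambda>x i. f x i = g x i + nat z)"
    by (intro decidable_eq definable_add definable_const assms)
  then show ?thesis
    by (rule decidable_cong) (use True in auto)
next
  case False
  have "decidable (\<lambda>x i. f x i + nat (- z) = g x i)"
    by (intro decidable_eq definable_add definable_const assms)
  then show ?thesis
    by (rule decidable_cong) (use False in auto)
qed

theorem polytime_computable_bits:
  assumes "decidable p" "definable (\<lambda>x i. s x)"
  shows "polytime_computable (\<lambda>x. map (p x) [0..<s x])"
proof -
  obtain F where F: "\<And>x i. aval F x i = (if p x i then 1 else 0)"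
    using assms(1) unfolding decidable_def definable_def by blast
  obtain G where G: "\<And>x i. aval G x i = s x"
    using assms(2) unfolding definable_def by blast
  have "(\<lambda>x. map (p x) [0..<s x]) = (\<lambda>x. map (\<lambda>i. aval F x i \<noteq> 0) [0..<aval G x 0])"
    by (simp add: F G)
  then show ?thesis
    using aexp_polytime_computable by simp
qed

section \<open>The adjacency matrix as an arithmetic formula\<close>

lemma concat_rows:
  "concat (map (\<lambda>u. map (q u) [0..<n]) [0..<r]) = map (\<lambda>i. q (i div n) (i mod n)) [0..<r * n]"
proof (induction r)
  case (Suc r)
  have "[0..<Suc r * n] = [0..<r * n] @ [r * n..<r * n + n]"
    using upt_add_eq_append[of 0 "r * n" n] by (simp add: add.commute)
  moreover have "map (\<lambda>i. q (i div n) (i mod n)) [r * n..<r * n + n] = map (q r) [0..<n]"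
    by (intro nth_equalityI) auto
  ultimately show ?case
    using Suc by simp
qed simp

text \<open>This is \<open>arc\<close> on decoded vertices: \<open>g\<close>, \<open>h\<close> are
  blocks, \<open>r\<close>, \<open>s\<close> places within a block as in \<open>unloc\<close>.
  Comparisons replace pattern matching so that the closure rules of \<open>decidable\<close>
  apply.\<close>

definition adj :: "nat \<Rightarrow> nat \<Rightarrow> (nat \<Rightarrow> nat \<Rightarrow> bool) \<Rightarrow> (nat \<Rightarrow> nat \<Rightarrow> bool) \<Rightarrow> (nat \<Rightarrow> nat \<Rightarrow> bool) \<Rightarrow>
    nat \<Rightarrow> nat \<Rightarrow> nat \<Rightarrow> nat \<Rightarrow> bool" where
  "adj k n A So Si g r h s \<longleftrightarrow>
     r < k \<and> s < k \<and> (g = h \<and> r < s \<or> h = Suc g \<and> s \<le> r \<or> g = 0 \<and> h = 0 \<and> s < r) \<or>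
     k \<le> r \<and> r < 2 * k \<and> k \<le> s \<and> s < 2 * k \<and> (g = h \<and> r < s \<or> g = Suc h \<and> s \<le> r) \<or>
     k \<le> r \<and> r < 2 * k \<and> s < k \<and> g = 0 \<and> h = 0 \<and> s + k \<le> r \<or>
     r < k \<and> k \<le> s \<and> s < 2 * k \<and> \<not> r + k = s \<and> (g = h \<or> g = Suc h) \<or>
     r < k \<and> s = 2 * k \<and> h < n \<and> g = Suc h \<and> (2 \<le> r \<or> So h r) \<or>
     r = 2 * k \<and> k \<le> s \<and> s < 2 * k \<and> g < n \<and> h = Suc g \<and> (2 \<le> s - k \<or> Si g (s - k)) \<or>
     r = 2 * k \<and> s = 2 * k \<and> A g h \<or>
     r = 2 * k + 1 \<and> s = 2 * k + 1 \<and> g = 0 \<and> 1 \<le> h \<and> h < 4 * k"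

lemma (in frame) arc_unloc:
  assumes "r < width" "s < width"
  shows "arc (unloc g r) (unloc h s) \<longleftrightarrow> adj k n A So Si g r h s"
proof -
  have "r < k \<or> k \<le> r \<and> r < 2 * k \<or> r = 2 * k \<or> r = 2 * k + 1"
    and "s < k \<or> k \<le> s \<and> s < 2 * k \<or> s = 2 * k \<or> s = 2 * k + 1"
    using assms unfolding width_def by linarith+
  then show ?thesis
    using k by (elim disjE conjE) (auto simp: unloc_def adj_def)
qed

text \<open>The inductive \<open>data_arc\<close> with its existential indices turned into functions
  of \<open>g\<close>: under each rule the coordinates of the tail determine the head
  \<open>h\<close>.\<close>

definition darc :: "nat \<Rightarrow> nat \<Rightarrow> (nat \<Rightarrow> nat \<Rightarrow> bool) \<Rightarrow> nat \<Rightarrow> nat \<Rightarrow> bool" where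
  "darc V m E g h \<longleftrightarrow> (let \<tau> = g mod 3; v = g div 3 div V; u = g div 3 mod V in
     v < V \<and>
     (\<tau> = 0 \<and> h = 3 * (v * V + u) + 1 \<or>
      \<tau> = 1 \<and> Suc u < V \<and> h = 3 * (v * V + Suc u) + 0 \<or>
      \<tau> = 0 \<and> E v u \<and> h = 3 * (v * V + u) + 2 \<or>
      \<tau> = 1 \<and> h = 3 * (u * V + v) + 2 \<or>
      \<tau> = 0 \<and> u = 0 \<and> Suc v < V \<and> \<not> Suc v mod m = 0 \<and> h = 3 * (Suc v * V + 0) + 0))"

definition dsource :: "nat \<Rightarrow> nat \<Rightarrow> nat \<Rightarrow> nat \<Rightarrow> bool" where
  "dsource V m g i \<longleftrightarrow>
     g mod 3 = 0 \<and> (i = 0 \<or> i = 1 \<and> g div 3 mod V = 0 \<and> (g div 3 div V) mod m = 0) \<or> g mod 3 = 1 \<and> i = 1"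

definition dsink :: "nat \<Rightarrow> nat \<Rightarrow> nat \<Rightarrow> nat \<Rightarrow> bool" where
  "dsink V m g i \<longleftrightarrow>
     g mod 3 = 0 \<and> i = 1 \<and> (\<not> g div 3 mod V = 0 \<or> Suc (g div 3 div V) mod m = 0) \<or>
     g mod 3 = 1 \<and> i = 0 \<or> g mod 3 = 2"

definition adjacent :: "nat \<Rightarrow> nat \<Rightarrow> nat \<Rightarrow> (nat \<Rightarrow> nat \<Rightarrow> bool) \<Rightarrow> nat \<Rightarrow> nat \<Rightarrow> bool" where
  "adjacent k V m E a b \<longleftrightarrow> adj k (3 * (V * V)) (darc V m E) (dsource V m) (dsink V m)
     (a div (2 * k + 2)) (a mod (2 * k + 2)) (b div (2 * k + 2)) (b mod (2 * k + 2))"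

context choice
begin

lemma data_arc_darc: "data_arc = darc V m E"
proof (intro ext iffI)
  fix g h assume "data_arc g h"
  then have "va g < V \<and>
     (ty g = 0 \<and> h = pos (va g) (vb g) 1 \<or>
      ty g = 1 \<and> Suc (vb g) < V \<and> h = pos (va g) (Suc (vb g)) 0 \<or>
      ty g = 0 \<and> E (va g) (vb g) \<and> h = pos (va g) (vb g) 2 \<or>
      ty g = 1 \<and> h = pos (vb g) (va g) 2 \<or>
      ty g = 0 \<and> vb g = 0 \<and> Suc (va g) < V \<and> \<not> Suc (va g) mod m = 0 \<and> h = pos (Suc (va g)) 0 0)"
    using V_pos by cases simp_all
  then show "darc V m E g h"
    unfolding darc_def Let_def ty_def va_def vb_def pos_def by simp
next
  fix g h assume "darc V m E g h"
  then have *: "va g < V \<and>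
     (ty g = 0 \<and> h = pos (va g) (vb g) 1 \<or>
      ty g = 1 \<and> Suc (vb g) < V \<and> h = pos (va g) (Suc (vb g)) 0 \<or>
      ty g = 0 \<and> E (va g) (vb g) \<and> h = pos (va g) (vb g) 2 \<or>
      ty g = 1 \<and> h = pos (vb g) (va g) 2 \<or>
      ty g = 0 \<and> vb g = 0 \<and> Suc (va g) < V \<and> \<not> Suc (va g) mod m = 0 \<and> h = pos (Suc (va g)) 0 0)"
    unfolding darc_def Let_def ty_def va_def vb_def pos_def .
  show "data_arc g h"
    using * vb_less[of g] encode[of g] data_arc.intros by metis
qed

lemma source_dsource: "source = dsource V m"
  by (intro ext) (simp only: source_def dsource_def ty_def va_def vb_def)

lemma sink_dsink: "sink = dsink V m"
  by (intro ext) (simp only: sink_def dsink_def ty_def va_def vb_def)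

definition gadget :: "nat pair_pre_digraph" where
  "gadget = D"

lemma encode_gadget:
  defines "s \<equiv> (3 * (V * V) + 1) * (2 * k + 2)"
  shows "encode gadget = map (\<lambda>i. adjacent k V m E (i div s) (i mod s)) [0..<s * s]"
proof -
  have s: "sz = s"
    by (simp add: sz_def width_def s_def)
  have "(a, b) \<in> parcs D \<longleftrightarrow> adjacent k V m E a b" if "a < s" "b < s" for a b
  proof -
    have "(a, b) \<in> parcs D \<longleftrightarrow> arc (dec a) (dec b)"
      using that by (simp add: D_def s)
    also have "\<dots> \<longleftrightarrow> adjacent k V m E a b"
      unfolding dec_def adjacent_def using width_pos
      by (subst arc_unloc) (simp_all add: width_def data_arc_darc source_dsource sink_dsink)
    finally show ?thesis .
  qed
  then have "map (\<lambda>u. map (\<lambda>v. (u, v) \<in> parcs D) [0..<s]) [0..<s] =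
      map (\<lambda>u. map (adjacent k V m E u) [0..<s]) [0..<s]"
    by simp
  moreover have "card (pverts D) = s"
    by (simp add: D_def s)
  ultimately show ?thesis
    unfolding gadget_def encode_def Let_def by (simp only: concat_rows)
qed

end

text \<open>A formula has only one numeric argument, the index \<open>i\<close> of the matrix entry;
  predicates of two numbers are therefore stated for arbitrary definable functions of
  \<open>i\<close>.\<close>

context
  fixes V :: "bool list \<Rightarrow> nat" and E :: "bool list \<Rightarrow> nat \<Rightarrow> nat \<Rightarrow> bool" and m k :: nat
  assumes V: "definable (\<lambda>x i. V x)" "\<And>x. 0 < V x" and m: "0 < m"
    and E: "\<And>v u. definable v \<Longrightarrow> definable u \<Longrightarrow> decidable (\<lambda>x i. E x (v x i) (u x i))"
begin

lemma decidable_dsource: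
  assumes "definable g" "definable r"
  shows "decidable (\<lambda>x i. dsource (V x) m (g x i) (r x i))"
  unfolding dsource_def using V(2) m
  by (intro decidable_intros definable_intros definable_div definable_mod assms V(1)) auto

lemma decidable_dsink:
  assumes "definable g" "definable r"
  shows "decidable (\<lambda>x i. dsink (V x) m (g x i) (r x i))"
  unfolding dsink_def using V(2) m
  by (intro decidable_intros definable_intros definable_div definable_mod assms V(1)) auto

lemma decidable_darc:
  assumes "definable g" "definable h"
  shows "decidable (\<lambda>x i. darc (V x) m (E x) (g x i) (h x i))"
  unfolding darc_def Let_def using V(2) m
  by (intro E decidable_intros definable_intros definable_div definable_mod assms V(1)) auto

lemma decidable_adjacent:
  assumes "definable a" "definable b"
  shows "decidable (\<lambda>x i. adjacent k (V x) m (E x) (a x i) (b x i))"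
  unfolding adjacent_def adj_def
  by (intro decidable_dsource decidable_dsink decidable_darc decidable_intros definable_intros
      definable_div definable_mod assms V(1)) auto

end

lemma polytime_gadget:
  assumes V: "definable (\<lambda>x i. V x)" "\<And>x. 0 < V x" and m: "0 < m"
    and E: "\<And>v u. definable v \<Longrightarrow> definable u \<Longrightarrow> decidable (\<lambda>x i. E x (v x i) (u x i))"
    and ch: "\<And>x. choice k (V x) m"
  shows "polytime_computable (\<lambda>x. encode (choice.gadget k (V x) m (E x)))"
proof -
  define s where "s x = (3 * (V x * V x) + 1) * (2 * k + 2)" for x
  have s: "definable (\<lambda>x i. s x)" "0 < s x" for x
    unfolding s_def by (intro definable_intros V(1)) simp
  have "decidable (\<lambda>x i. adjacent k (V x) m (E x) (i div s x) (i mod s x))"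
    by (intro decidable_adjacent[OF V m E] definable_div definable_mod definable_idx s)
  moreover have "definable (\<lambda>x i. s x * s x)"
    by (intro definable_mult s)
  ultimately have "polytime_computable (\<lambda>x. map (\<lambda>i. adjacent k (V x) m (E x) (i div s x) (i mod s x)) [0..<s x * s x])"
    by (rule polytime_computable_bits)
  then show ?thesis
    unfolding choice.encode_gadget[OF ch] s_def .
qed

section \<open>Conflicts of the tableau as an arithmetic formula\<close>

lemma (in tableau) init_sym_eq:
  "init_sym c j = s \<longleftrightarrow> (case s of
      Blank \<Rightarrow> c \<noteq> 0 \<or> j < P \<or> input_code x (j - P) = 0
    | Bit b \<Rightarrow> c = 0 \<and> P \<le> j \<and> input_code x (j - P) = (if b then 2 else 1)
    | Work w \<Rightarrow> False)"
  by (cases s) (auto simp: init_sym_def input_code_def)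

context
  fixes M :: tm and P N :: "bool list \<Rightarrow> nat" and opts :: "(symbol \<times> bool \<times> action) list"
  assumes tab: "\<And>x. tableau M x (P x) (N x) opts"
    and P: "definable (\<lambda>x i. P x)" and N: "definable (\<lambda>x i. N x)"
begin

text \<open>For a fixed symbol \<open>s\<close> the question becomes a test of
  \<open>input_code\<close>, through which alone expressions see the bits of the input.\<close>

lemma decidable_init_sym:
  assumes "definable j"
  shows "decidable (\<lambda>x i. tableau.init_sym x (P x) c (j x i) = s)"
proof -
  have "decidable (\<lambda>x i. case s of
      Blank \<Rightarrow> c \<noteq> 0 \<or> j x i < P x \<or> input_code x (j x i - P x) = 0
    | Bit b \<Rightarrow> c = 0 \<and> P x \<le> j x i \<and> input_code x (j x i - P x) = (if b then 2 else 1)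
    | Work w \<Rightarrow> False)"
  proof (cases s)
    case (Bit b)
    show ?thesis
      unfolding Bit symbol.case by (intro decidable_intros definable_intros assms P)
  qed (simp_all only: symbol.case, (intro decidable_intros definable_intros assms P)+)
  then show ?thesis
    unfolding tableau.init_sym_eq[OF tab] .
qed

lemma decidable_bad:
  assumes "definable t" "definable j"
  shows "decidable (\<lambda>x i. tableau.bad M x (P x) (N x) opts (t x i) (j x i) e)"
proof -
  let ?ac = "tableau.ac opts e" and ?hd = "tableau.hd opts e" and ?sy = "tableau.sy opts e"
  have "decidable (\<lambda>x i.
     t x i = 0 \<and> (src (tm_accept M) ?ac \<noteq> tm_start M \<or> \<not> (j x i = P x) = ?hd \<or>
        \<not> tableau.init_sym x (P x) (tableau.tp opts e) (j x i) = ?sy) \<or>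
     Suc (t x i) = N x \<and> ?ac \<noteq> None \<or>
     (\<exists>tr. ?ac = Some tr \<and> ?hd \<and> ?sy \<noteq> rd tr (tableau.tp opts e)))"
    by (intro decidable_intros definable_intros decidable_iff_const decidable_init_sym assms P N)
  then show ?thesis
    unfolding tableau.bad_def[OF tab] by (rule decidable_cong) metis
qed

lemma decidable_clash:
  assumes "definable t" "definable j" "definable t'" "definable j'"
  shows "decidable (\<lambda>x i. tableau.clash M x (P x) (N x) opts (t x i) (j x i) e (t' x i) (j' x i) e')"
proof -
  let ?ac = "tableau.ac opts" and ?hd = "tableau.hd opts" and ?sy = "tableau.sy opts" and ?tp = "tableau.tp opts"
  have "decidable (\<lambda>x i. \<exists>tr. ?ac e = Some tr \<and> ?tp e = ?tp e' \<and>
          (j x i = j' x i \<and> ?sy e' \<noteq> (if ?hd e then wr tr (?tp e) else ?sy e) \<or>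
           ?hd e \<and> int (j' x i) = int (j x i) + mv tr (?tp e) \<and> \<not> ?hd e'))" (is "decidable ?p")
  \<comment> \<open>The action of a fixed option is known in advance, so the existential quantifier
    disappears.\<close>
  proof (cases "?ac e")
    case None
    then show ?thesis
      using decidable_const[of False] by simp
  next
    case (Some tr)
    have "decidable (\<lambda>x i. ?tp e = ?tp e' \<and>
          (j x i = j' x i \<and> ?sy e' \<noteq> (if ?hd e then wr tr (?tp e) else ?sy e) \<or>
           ?hd e \<and> int (j' x i) = int (j x i) + mv tr (?tp e) \<and> \<not> ?hd e'))"
      by (intro decidable_intros decidable_int_shift assms)
    then show ?thesis
      by (rule decidable_cong) (simp add: Some)
  qed
  then have "decidable (\<lambda>x i. tableau.bad M x (P x) (N x) opts (t x i) (j x i) e \<or>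
     t' x i = t x i \<and> (?ac e \<noteq> ?ac e' \<or> ?tp e = ?tp e' \<and> ?hd e \<and> ?hd e' \<and> \<not> j x i = j' x i) \<or>
     t' x i = Suc (t x i) \<and> (src (tm_accept M) (?ac e') \<noteq> tgt (tm_accept M) (?ac e) \<or> ?p x i))"
    by (intro decidable_bad decidable_const decidable_intros definable_Suc assms)
  then show ?thesis
    unfolding tableau.clash_def[OF tab] .
qed

text \<open>Times and columns grow with the input and are computed by division; the two residues
  modulo the constant \<open>Q\<close>, which number tape and option, are removed by case
  distinction.\<close>

lemma decidable_conflict:
  assumes "definable v" "definable u"
  shows "decidable (\<lambda>x i. tableau.conflict M x (P x) (N x) opts (v x i) (u x i))"
proof -
  let ?Q = "tableau.Q M opts"
  have Q: "0 < ?Q"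
    using tableau.T_pos[OF tab] tableau.K_pos[OF tab] by (simp add: tableau.Q_def[OF tab])
  note coords = definable_div[OF definable_div[OF _ definable_const Q] N tableau.N_pos[OF tab]]
    definable_mod[OF definable_div[OF _ definable_const Q] N tableau.N_pos[OF tab]]
  note residue = definable_mod[OF _ definable_const Q]
  have "decidable (\<lambda>x i. tableau.clash M x (P x) (N x) opts (v x i div ?Q div N x) (v x i div ?Q mod N x) e
      (u x i div ?Q div N x) (u x i div ?Q mod N x) (u x i mod ?Q))" for e
    by (rule decidable_bounded_cases[OF residue[OF assms(2)] mod_less_divisor[OF Q]])
      (intro decidable_clash coords assms)
  then have "decidable (\<lambda>x i. tableau.clash M x (P x) (N x) opts (v x i div ?Q div N x) (v x i div ?Q mod N x)
      (v x i mod ?Q) (u x i div ?Q div N x) (u x i div ?Q mod N x) (u x i mod ?Q))"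
    by (rule decidable_bounded_cases[OF residue[OF assms(1)] mod_less_divisor[OF Q],
          where p = "\<lambda>e x i. tableau.clash M x (P x) (N x) opts (v x i div ?Q div N x)
            (v x i div ?Q mod N x) e (u x i div ?Q div N x) (u x i div ?Q mod N x) (u x i mod ?Q)"])
  then show ?thesis
    unfolding tableau.conflict_def[OF tab] .
qed

end

section \<open>The reduction\<close>

theorem theorem8:
  fixes k :: nat and C :: "nat pair_pre_digraph set"
  assumes "k \<ge> 2"
  defines "C \<equiv> {D. standard_digraph D \<and>
                   (\<exists>F. feedback_vertex_set D F \<and> card F = k) \<and>
                   (\<exists>F. feedback_arc_set D F \<and> card F = k^2) \<and>
                   max_degree D = 4 * k - 1}"
  shows "NP_hard (encode ` {D \<in> C. k_colorable k D}) (encode ` {D \<in> C. \<not> k_colorable k D})"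
  unfolding NP_hard_def
proof
  fix A assume "A \<in> NP"
  then obtain M and p :: "nat poly" where wf: "wf_tm M"
    and time: "\<And>x n c. (initial M x, c) \<in> step M ^^ n \<Longrightarrow> n \<le> poly p (length x)"
    and acc: "\<And>x. x \<in> A \<longleftrightarrow> (\<exists>ts. (initial M x, (tm_accept M, ts)) \<in> (step M)\<^sup>*)"
    unfolding NP_def by blast
  let ?\<Gamma> = "{Blank, Bit True, Bit False} \<union> (\<Union>(q, rs, q', ws, ds) \<in> tm_delta M. set ws)"
  have "finite (tm_delta M)"
    using wf by (simp add: wf_tm_def)
  then have "finite (?\<Gamma> \<times> (UNIV :: bool set) \<times> insert None (Some ` tm_delta M))"
    by (auto split: prod.splits)
  then obtain opts where opts: "set opts = ?\<Gamma> \<times> (UNIV :: bool set) \<times> insert None (Some ` tm_delta M)"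
    using finite_list by blast
  then have fst_opts: "fst ` set opts = ?\<Gamma>"
    by force
  \<comment> \<open>The summand 1 makes the time bound strict; the summand \<open>k\<close> enforces
    \<open>k < V x\<close>, hence enough blocks for the star.\<close>
  define P where "P x = poly p (length x) + k + 1" for x :: "bool list"
  define N where "N x = 2 * P x + 2" for x
  have tab: "tableau M x (P x) (N x) opts" for x
  proof
    show "i < P x" if "(initial M x, c) \<in> step M ^^ i" for i c
      using time[OF that] by (simp add: P_def)
    show "set opts = fst ` set opts \<times> UNIV \<times> insert None (Some ` tm_delta M)"
      unfolding fst_opts by (rule opts)
  qed (use wf fst_opts in \<open>auto simp: N_def\<close>)
  define K where "K = tableau.K opts"
  define Q where "Q = tableau.Q M opts"
  define V where "V x = N x * N x * Q" for x
  define E where "E x = tableau.conflict M x (P x) (N x) opts" for x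
  have K: "0 < K"
    unfolding K_def by (rule tableau.K_pos[OF tab])
  have Q: "Q = tableau.T M * K" "0 < Q"
    using tableau.Q_def[OF tab] tableau.T_pos[OF tab] K by (simp_all add: Q_def K_def)
  have PN: "definable (\<lambda>x i. P x)" "definable (\<lambda>x i. N x)"
    unfolding N_def P_def by (intro definable_intros definable_poly)+
  have V: "definable (\<lambda>x i. V x)"
    unfolding V_def by (intro definable_intros PN)
  have Vk: "k < V x" for x
  proof -
    have "k < N x"
      by (simp add: N_def P_def)
    also have "N x * 1 \<le> N x * (N x * Q)"
      using Q(2) \<open>k < N x\<close> by (intro mult_left_mono) (simp_all add: Suc_le_eq)
    finally show ?thesis
      by (simp add: V_def mult.assoc)
  qed
  have ch: "choice k (V x) K" for x
  proof
    have "2 \<le> V x" "k \<le> V x"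
      using Vk[of x] assms(1) by simp_all
    then have "k * 2 \<le> V x * V x"
      by (intro mult_mono) auto
    then show "4 * k \<le> 3 * (V x * V x)"
      by simp
    show "K dvd V x"
      by (simp add: V_def Q)
  qed (use assms K in simp_all)
  define f where "f x = encode (choice.gadget k (V x) K (E x))" for x
  have "polytime_computable f"
    unfolding f_def
  proof (rule polytime_gadget[OF V _ K _ ch])
    show "0 < V x" for x
      using Vk[of x] by simp
    show "decidable (\<lambda>x i. E x (v x i) (u x i))" if "definable v" "definable u" for v u
      unfolding E_def by (rule decidable_conflict[OF tab PN that])
  qed
  moreover have "(x \<in> A \<longrightarrow> f x \<in> encode ` {D \<in> C. k_colorable k D}) \<and>
      (x \<notin> A \<longrightarrow> f x \<in> encode ` {D \<in> C. \<not> k_colorable k D})" for x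
  proof -
    interpret T: tableau M x "P x" "N x" opts
      by (rule tab)
    interpret G: choice k "V x" K "E x"
      by (rule ch)
    \<comment> \<open>Both sides speak of \<open>N x * N x * Q\<close> variables in consecutive
      groups of \<open>K\<close>: the numbering of the tableau cells was chosen for this.\<close>
    have "G.solution = T.selects"
      by (intro ext) (unfold G.solution_def T.selects_def, simp add: V_def E_def Q_def K_def)
    then have "k_colorable k G.gadget \<longleftrightarrow> x \<in> A"
      unfolding G.gadget_def G.colorable_iff_solution acc T.selects_iff_accepts[symmetric] by simp
    moreover have "G.gadget \<in> C"
      unfolding C_def G.gadget_def using G.standard_D G.feedback_vertex_set_fvs G.card_fvs
        G.feedback_arc_set_fas G.card_fas G.max_degree_D by blast
    ultimately show ?thesis
      unfolding f_def by blast
  qed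
  ultimately show "\<exists>f. polytime_computable f \<and>
      (\<forall>x. (x \<in> A \<longrightarrow> f x \<in> encode ` {D \<in> C. k_colorable k D}) \<and>
           (x \<notin> A \<longrightarrow> f x \<in> encode ` {D \<in> C. \<not> k_colorable k D}))"
    by blast
qed

end
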